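(* Let $(\Omega,\mathcal F,P)$ be a probability space carrying a uniformly distributed $[0,1]$-valued random variable, let $X$ be a Banach space over $\mathbb K\in\{\mathbb R,\mathbb C\}$, $\sigma$ a distortion function, and $p\in[1,\infty)$ with conjugate exponent $q\in(1,\infty]$. Then $(L_{\sigma,q}^*(P,X^* ),|\cdot|_{\sigma,q}^* )$ is a Banach space and the mapping $$\Psi:(L_{\sigma,q}^*(P,X^* ),|\cdot|_{\sigma,q}^* )\to(L_\sigma^p(P,X)^*,\|\cdot\|_{\sigma,p}^* ),\qquad \mu\mapsto\Big(Y\mapsto\int_\Omega Y\,d\mu\Big)$$ is an isometric isomorphism.
   Context: $\mathscr U(0,1)$ denotes the set of all $[0,1]$-valued random variables $U$ on $(\Omega,\mathcal F,P)$ with $P(U\le u)=u$ for all $u\in[0,1]$. A distortion function is a nondecreasing, left-continuous function $\sigma:[0,1)\to[0,\infty)$ with $\int_0^1\sigma(u)\,du=1$. For $r\in[1,\infty)$ and a Banach space $X$, $L_\sigma^r(P,X)$ is the Banach space of (a.e.-classes of) strongly measurable $Y:\Omega\to X$ with $\|Y\|_{\sigma,r}:=\big(\sup_{U\in\mathscr U(0,1)}\mathbb E(\sigma(U)\|Y\|^r)\big)^{1/r}<\infty$; $\|\cdot\|_{\sigma,p}^*$ is the dual norm on the continuous dual $L_\sigma^p(P,X)^*$. Scalar spaces: for a real random variable $W$, $F_W(t)=P(W\le t)$, $F_W^{-1}(\alpha)=\inf\{t:F_W(t)\ge\alpha\}$; for nonnegative $W$ and $\alpha\in[0,1)$, $\mathrm{AV@R}_\alpha(W)=\frac1{1-\alpha}\int_\alpha^1F_W^{-1}(u)\,du$.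 $L^0(P)$ is the set of (a.e.-classes of) $\mathbb K$-valued random variables. For $Z\in L^0(P)$, $|Z|_{\sigma,\infty}^*:=\sup_{\alpha\in[0,1)}\int_\alpha^1F_{|Z|}^{-1}(u)\,du\big/\int_\alpha^1\sigma(u)\,du$. For $q\in(1,\infty)$, $|Z|_{\sigma,q}^*:=\inf\|Z'\|_{\sigma,q}$, the infimum over all $Z'\in L^0(P)$ that $\sigma$-dominate $Z$, i.e. for which there is $U\in\mathscr U(0,1)$ with $\mathrm{AV@R}_\alpha(\sigma(U)|Z'|)\ge\mathrm{AV@R}_\alpha(|Z|)$ for all $\alpha\in[0,1)$ ($\inf\emptyset=\infty$). For $q\in(1,\infty]$, $L_{\sigma,q}^*(P):=\{Z\in L^0(P):|Z|_{\sigma,q}^*<\infty\}$. Vector measures: $L_{\sigma,q}^*(P,X^* )$ is the vector space of all $\sigma$-additive vector measures $\mu:\mathcal F\to X^*$ of bounded variation such that the variation $|\mu|$ satisfies $|\mu|\ll P$ and $\frac{d|\mu|}{dP}\in L_{\sigma,q}^*(P)$; it is equipped with $|\mu|_{\sigma,q}^*:=\big|\frac{d|\mu|}{dP}\big|_{\sigma,q}^*$. For $\mu\in L_{\sigma,q}^*(P,X^* )$, $Y\mapsto\int_\Omega Y\,d\mu$ denotes the unique continuous linear extension to $L_\sigma^p(P,X)$ of the functional defined on $X$-valued simple functions by $\sum_{j=1}^n\mathbf 1_{E_j}x_j\mapsto\sum_{j=1}^n\mu(E_j)(x_j)$ (simple functions are dense in $L_\sigma^p(P,X)$ and this functional is $\|\cdot\|_{\sigma,p}$-continuous).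 *)

theory Defs
  imports "HOL-Probability.Probability" "HOL-Library.Function_Algebras"
begin

text \<open>The scalar field: \<^typ>\<open>real\<close> or \<^typ>\<open>complex\<close>, up to isometric isomorphism of
  normed real algebras. Completeness and second countability follow from the isomorphism; they are
  superclasses only so that the library's instances for \<^typ>\<open>'x \<Rightarrow>\<^sub>L 'k\<close> and Borel measurability apply.\<close>

class real_or_complex = real_normed_field + banach + second_countable_topology +
  assumes iso_real_or_complex:
    "\<exists>h :: 'a \<Rightarrow> complex. (range h = \<real> \<or> range h = UNIV) \<and>
       (\<forall>x y. h (x + y) = h x + h y) \<and> (\<forall>x y. h (x * y) = h x * h y) \<and>
       (\<forall>r x. h (r *\<^sub>R x) = r *\<^sub>R h x) \<and> (\<forall>x. norm (h x) = norm x)"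

instance real :: real_or_complex
proof
  show "\<exists>h :: real \<Rightarrow> complex. (range h = \<real> \<or> range h = UNIV) \<and>
       (\<forall>x y. h (x + y) = h x + h y) \<and> (\<forall>x y. h (x * y) = h x * h y) \<and>
       (\<forall>r x. h (r *\<^sub>R x) = r *\<^sub>R h x) \<and> (\<forall>x. norm (h x) = norm x)"
    by (rule exI[of _ of_real]) (auto simp: Reals_def scaleR_conv_of_real)
qed

instance complex :: real_or_complex
proof
  show "\<exists>h :: complex \<Rightarrow> complex. (range h = \<real> \<or> range h = UNIV) \<and>
       (\<forall>x y. h (x + y) = h x + h y) \<and> (\<forall>x y. h (x * y) = h x * h y) \<and>
       (\<forall>r x. h (r *\<^sub>R x) = r *\<^sub>R h x) \<and> (\<forall>x. norm (h x) = norm x)"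
    by (rule exI[of _ "\<lambda>x. x"]) auto
qed

text \<open>A Banach space over \<^typ>\<open>'k\<close>: the type class supplies the underlying real Banach space, which
  has to be the restriction of scalars of the \<^typ>\<open>'k\<close>-space.\<close>

locale scalar_banach = vector_space smul
  for smul :: "'k::real_or_complex \<Rightarrow> 'x::banach \<Rightarrow> 'x" +
  assumes scale_of_real: "smul (of_real r) x = r *\<^sub>R x"
    and norm_scale: "norm (smul c x) = norm c * norm x"

text \<open>Normed and Banach spaces carried by a linear subspace \<^term>\<open>V\<close> of an ambient vector space; the
  norm \<^term>\<open>N\<close> is only meaningful on \<^term>\<open>V\<close>.\<close>

locale normed_space_on = vector_space smul
  for smul :: "'k::real_or_complex \<Rightarrow> 'v::ab_group_add \<Rightarrow> 'v" +
  fixes V :: "'v set" and N :: "'v \<Rightarrow> real"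
  assumes subspace_carrier: "subspace V"
    and N_nonneg: "v \<in> V \<Longrightarrow> 0 \<le> N v"
    and N_eq_0_iff: "v \<in> V \<Longrightarrow> N v = 0 \<longleftrightarrow> v = 0"
    and N_triangle: "v \<in> V \<Longrightarrow> w \<in> V \<Longrightarrow> N (v + w) \<le> N v + N w"
    and N_scale: "v \<in> V \<Longrightarrow> N (smul c v) = norm c * N v"

locale banach_space_on = normed_space_on smul V N
  for smul :: "'k::real_or_complex \<Rightarrow> 'v::ab_group_add \<Rightarrow> 'v" and V N +
  assumes complete_carrier:
    "(\<And>n. s n \<in> V) \<Longrightarrow> (\<And>e. 0 < e \<Longrightarrow> \<exists>n0. \<forall>m\<ge>n0. \<forall>n\<ge>n0. N (s m - s n) < e) \<Longrightarrow>
      \<exists>v\<in>V. (\<lambda>n. N (s n - v)) \<longlonglongrightarrow> 0"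

definition isometric_isomorphism ::
  "('k::real_or_complex \<Rightarrow> 'v::ab_group_add \<Rightarrow> 'v) \<Rightarrow> 'v set \<Rightarrow> ('v \<Rightarrow> real) \<Rightarrow>
   ('k \<Rightarrow> 'w::ab_group_add \<Rightarrow> 'w) \<Rightarrow> 'w set \<Rightarrow> ('w \<Rightarrow> real) \<Rightarrow> ('v \<Rightarrow> 'w) \<Rightarrow> bool" where
  "isometric_isomorphism sV V NV sW W NW f \<longleftrightarrow>
     normed_space_on sV V NV \<and> normed_space_on sW W NW \<and>
     bij_betw f V W \<and>
     (\<forall>v\<in>V. \<forall>w\<in>V. f (v + w) = f v + f w) \<and>
     (\<forall>c. \<forall>v\<in>V. f (sV c v) = sW c (f v)) \<and>
     (\<forall>v\<in>V. NW (f v) = NV v)"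

definition uniform_rvs :: "'w measure \<Rightarrow> ('w \<Rightarrow> real) set" where
  "uniform_rvs M = {U \<in> borel_measurable M. (\<forall>\<omega>\<in>space M. U \<omega> \<in> {0..1}) \<and>
     (\<forall>u\<in>{0..1}. measure M {\<omega> \<in> space M. U \<omega> \<le> u} = u)}"

text \<open>Only the values of \<^term>\<open>\<sigma>\<close> on \<open>[0,1)\<close> matter: a uniform random variable takes the value 1
  with probability zero.\<close>

definition distortion :: "(real \<Rightarrow> real) \<Rightarrow> bool" where
  "distortion \<sigma> \<longleftrightarrow> mono_on {0..<1} \<sigma> \<and> (\<forall>u\<in>{0..<1}. 0 \<le> \<sigma> u) \<and>
     (\<forall>u\<in>{0<..<1}. continuous (at_left u) \<sigma>) \<and>
     (\<integral>\<^sup>+u\<in>{0..<1}. ennreal (\<sigma> u) \<partial>lborel) = 1"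

definition quantile :: "'w measure \<Rightarrow> ('w \<Rightarrow> real) \<Rightarrow> real \<Rightarrow> real" where
  "quantile M W a = Inf {t. a \<le> measure M {\<omega> \<in> space M. W \<omega> \<le> t}}"

text \<open>The next two are meant for nonnegative \<^term>\<open>W\<close>. The endpoints \<open>a\<close> and \<open>1\<close> are left out of
  the domain of integration because \<^const>\<open>quantile\<close> may be an infimum of an unbounded or empty
  set of reals at levels \<open>0\<close> and \<open>1\<close>.\<close>

definition quantile_tail :: "'w measure \<Rightarrow> ('w \<Rightarrow> real) \<Rightarrow> real \<Rightarrow> ennreal" where
  "quantile_tail M W a = (\<integral>\<^sup>+u\<in>{a<..<1}. ennreal (quantile M W u) \<partial>lborel)"

definition avar :: "'w measure \<Rightarrow> real \<Rightarrow> ('w \<Rightarrow> real) \<Rightarrow> ennreal" where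
  "avar M a W = ennreal (1 / (1 - a)) * quantile_tail M W a"

definition strongly_measurable :: "'w measure \<Rightarrow> ('w \<Rightarrow> 'x::real_normed_vector) \<Rightarrow> bool" where
  "strongly_measurable M Y \<longleftrightarrow> (\<exists>s. (\<forall>n::nat. simple_function M (s n)) \<and>
     (\<forall>\<omega>\<in>space M. (\<lambda>n. s n \<omega>) \<longlonglongrightarrow> Y \<omega>))"

definition ennreal_root :: "real \<Rightarrow> ennreal \<Rightarrow> ennreal" where
  "ennreal_root r x = (if x = \<top> then \<top> else ennreal (enn2real x powr (1 / r)))"

definition sigma_norm ::
  "'w measure \<Rightarrow> (real \<Rightarrow> real) \<Rightarrow> real \<Rightarrow> ('w \<Rightarrow> 'x::real_normed_vector) \<Rightarrow> ennreal" where
  "sigma_norm M \<sigma> r Y = ennreal_root r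
     (SUP U \<in> uniform_rvs M. \<integral>\<^sup>+\<omega>. ennreal (\<sigma> (U \<omega>) * norm (Y \<omega>) powr r) \<partial>M)"

definition sigma_fun ::
  "'w measure \<Rightarrow> (real \<Rightarrow> real) \<Rightarrow> real \<Rightarrow> ('w \<Rightarrow> 'x::real_normed_vector) set" where
  "sigma_fun M \<sigma> r = {Y. strongly_measurable M Y \<and> sigma_norm M \<sigma> r Y < \<top>}"

definition ae_class :: "'w measure \<Rightarrow> ('w \<Rightarrow> 'x::real_normed_vector) \<Rightarrow> ('w \<Rightarrow> 'x) set" where
  "ae_class M Y = {Y'. strongly_measurable M Y' \<and> (AE \<omega> in M. Y' \<omega> = Y \<omega>)}"

definition sigma_space ::
  "'w measure \<Rightarrow> (real \<Rightarrow> real) \<Rightarrow> real \<Rightarrow> ('w \<Rightarrow> 'x::real_normed_vector) set set" where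
  "sigma_space M \<sigma> r = ae_class M ` sigma_fun M \<sigma> r"

text \<open>The continuous dual of \<^term>\<open>sigma_space M \<sigma> p\<close>. Functionals are extended by 0 to arguments that
  are not elements of the space, so that equality of functions is equality of functionals.\<close>

definition sigma_dual ::
  "('k::real_or_complex \<Rightarrow> 'x::banach \<Rightarrow> 'x) \<Rightarrow> 'w measure \<Rightarrow> (real \<Rightarrow> real) \<Rightarrow> real \<Rightarrow>
   (('w \<Rightarrow> 'x) set \<Rightarrow> 'k) set" where
  "sigma_dual smul M \<sigma> p = {\<phi>. (\<forall>C. C \<notin> sigma_space M \<sigma> p \<longrightarrow> \<phi> C = 0) \<and>
     (\<forall>Y\<in>sigma_fun M \<sigma> p. \<forall>Z\<in>sigma_fun M \<sigma> p.
        \<phi> (ae_class M (\<lambda>\<omega>. Y \<omega> + Z \<omega>)) = \<phi> (ae_class M Y) + \<phi> (ae_class M Z)) \<and>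
     (\<forall>c. \<forall>Y\<in>sigma_fun M \<sigma> p. \<phi> (ae_class M (\<lambda>\<omega>. smul c (Y \<omega>))) = c * \<phi> (ae_class M Y)) \<and>
     (\<exists>B. \<forall>Y\<in>sigma_fun M \<sigma> p. norm (\<phi> (ae_class M Y)) \<le> B * enn2real (sigma_norm M \<sigma> p Y))}"

definition sigma_dual_norm ::
  "'w measure \<Rightarrow> (real \<Rightarrow> real) \<Rightarrow> real \<Rightarrow> (('w \<Rightarrow> 'x::banach) set \<Rightarrow> 'k::real_or_complex) \<Rightarrow> real" where
  "sigma_dual_norm M \<sigma> p \<phi> =
     (SUP Y \<in> {Y \<in> sigma_fun M \<sigma> p. sigma_norm M \<sigma> p Y \<le> 1}. norm (\<phi> (ae_class M Y)))"

definition functional_scale :: "'k::real_or_complex \<Rightarrow> ('c \<Rightarrow> 'k) \<Rightarrow> 'c \<Rightarrow> 'k" where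
  "functional_scale c \<phi> = (\<lambda>C. c * \<phi> C)"

definition sigma_dominates ::
  "'w measure \<Rightarrow> (real \<Rightarrow> real) \<Rightarrow> ('w \<Rightarrow> 'k::real_or_complex) \<Rightarrow> ('w \<Rightarrow> 'k) \<Rightarrow> bool" where
  "sigma_dominates M \<sigma> Z' Z \<longleftrightarrow> (\<exists>U\<in>uniform_rvs M. \<forall>a\<in>{0..<1}.
     avar M a (\<lambda>\<omega>. norm (Z \<omega>)) \<le> avar M a (\<lambda>\<omega>. \<sigma> (U \<omega>) * norm (Z' \<omega>)))"

definition star_norm ::
  "'w measure \<Rightarrow> (real \<Rightarrow> real) \<Rightarrow> ennreal \<Rightarrow> ('w \<Rightarrow> 'k::real_or_complex) \<Rightarrow> ennreal" where
  "star_norm M \<sigma> q Z =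
     (if q = \<top>
      then (SUP a\<in>{0..<1}. quantile_tail M (\<lambda>\<omega>. norm (Z \<omega>)) a / (\<integral>\<^sup>+u\<in>{a..<1}. ennreal (\<sigma> u) \<partial>lborel))
      else (INF Z'\<in>{Z' \<in> borel_measurable M. sigma_dominates M \<sigma> Z' Z}. sigma_norm M \<sigma> (enn2real q) Z'))"

definition star_space ::
  "'w measure \<Rightarrow> (real \<Rightarrow> real) \<Rightarrow> ennreal \<Rightarrow> ('w \<Rightarrow> 'k::real_or_complex) set" where
  "star_space M \<sigma> q = {Z \<in> borel_measurable M. star_norm M \<sigma> q Z < \<top>}"

text \<open>The dual of a Banach space over \<^typ>\<open>'k\<close>, as a subspace of the bounded real-linear maps; its
  norm is that of \<^typ>\<open>'x \<Rightarrow>\<^sub>L 'k\<close>.\<close>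

definition scalar_dual :: "('k::real_or_complex \<Rightarrow> 'x::banach \<Rightarrow> 'x) \<Rightarrow> ('x \<Rightarrow>\<^sub>L 'k) set" where
  "scalar_dual smul = {f. \<forall>c x. blinfun_apply f (smul c x) = c * blinfun_apply f x}"

text \<open>Set functions are extended by 0 to nonmeasurable sets.\<close>

definition vector_measure ::
  "('k::real_or_complex \<Rightarrow> 'x::banach \<Rightarrow> 'x) \<Rightarrow> 'w measure \<Rightarrow> ('w set \<Rightarrow> 'x \<Rightarrow>\<^sub>L 'k) \<Rightarrow> bool" where
  "vector_measure smul M \<mu> \<longleftrightarrow> range \<mu> \<subseteq> scalar_dual smul \<and> (\<forall>E. E \<notin> sets M \<longrightarrow> \<mu> E = 0) \<and>
     (\<forall>A::nat \<Rightarrow> 'w set. range A \<subseteq> sets M \<longrightarrow> disjoint_family A \<longrightarrow> (\<lambda>i. \<mu> (A i)) sums \<mu> (\<Union>i. A i))"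

definition variation :: "'w measure \<Rightarrow> ('w set \<Rightarrow> 'b::real_normed_vector) \<Rightarrow> 'w set \<Rightarrow> ennreal" where
  "variation M \<mu> E =
     (SUP \<pi> \<in> {\<pi>. finite \<pi> \<and> \<pi> \<subseteq> sets M \<and> partition_on E \<pi>}. \<Sum>A\<in>\<pi>. ennreal (norm (\<mu> A)))"

definition variation_measure :: "'w measure \<Rightarrow> ('w set \<Rightarrow> 'b::real_normed_vector) \<Rightarrow> 'w measure" where
  "variation_measure M \<mu> = measure_of (space M) (sets M) (variation M \<mu>)"

definition variation_density ::
  "'w measure \<Rightarrow> ('w set \<Rightarrow> 'x::banach \<Rightarrow>\<^sub>L 'k::real_or_complex) \<Rightarrow> 'w \<Rightarrow> 'k" where
  "variation_density M \<mu> \<omega> = of_real (enn2real (RN_deriv M (variation_measure M \<mu>) \<omega>))"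

definition star_measures ::
  "('k::real_or_complex \<Rightarrow> 'x::banach \<Rightarrow> 'x) \<Rightarrow> 'w measure \<Rightarrow> (real \<Rightarrow> real) \<Rightarrow> ennreal \<Rightarrow>
   ('w set \<Rightarrow> 'x \<Rightarrow>\<^sub>L 'k) set" where
  "star_measures smul M \<sigma> q = {\<mu>. vector_measure smul M \<mu> \<and> variation M \<mu> (space M) < \<top> \<and>
     absolutely_continuous M (variation_measure M \<mu>) \<and>
     variation_density M \<mu> \<in> star_space M \<sigma> q}"

definition star_measure_norm ::
  "'w measure \<Rightarrow> (real \<Rightarrow> real) \<Rightarrow> ennreal \<Rightarrow> ('w set \<Rightarrow> 'x::banach \<Rightarrow>\<^sub>L 'k::real_or_complex) \<Rightarrow> real" where
  "star_measure_norm M \<sigma> q \<mu> = enn2real (star_norm M \<sigma> q (variation_density M \<mu>))"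

definition measure_scale ::
  "'k::real_or_complex \<Rightarrow> ('w set \<Rightarrow> 'x::banach \<Rightarrow>\<^sub>L 'k) \<Rightarrow> 'w set \<Rightarrow> 'x \<Rightarrow>\<^sub>L 'k" where
  "measure_scale c \<mu> = (\<lambda>E. blinfun_mult_right c o\<^sub>L \<mu> E)"

definition vm_integral ::
  "('k::real_or_complex \<Rightarrow> 'x::banach \<Rightarrow> 'x) \<Rightarrow> 'w measure \<Rightarrow> (real \<Rightarrow> real) \<Rightarrow> real \<Rightarrow>
   ('w set \<Rightarrow> 'x \<Rightarrow>\<^sub>L 'k) \<Rightarrow> ('w \<Rightarrow> 'x) set \<Rightarrow> 'k" where
  "vm_integral smul M \<sigma> p \<mu> = (THE \<phi>. \<phi> \<in> sigma_dual smul M \<sigma> p \<and>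
     (\<forall>(n::nat) E x. (\<forall>j<n. E j \<in> sets M) \<longrightarrow>
        \<phi> (ae_class M (\<lambda>\<omega>. \<Sum>j<n. indicator (E j) \<omega> *\<^sub>R x j)) = (\<Sum>j<n. blinfun_apply (\<mu> (E j)) (x j))))"

end

theory Submission
  imports Defs
begin

text \<open>Both norms turn out to be the same supremum. Quantile representations reduce the moments
  \<open>E (\<sigma>(U) |Y|\<^sup>p)\<close> over all uniform \<open>U\<close> to one integral over the unit interval, so that
  \<open>|Z|\<^sup>*\<^sub>\<sigma>\<^sub>,\<^sub>q \<le> D\<close> is equivalent to \<open>E |Z Y| \<le> D \<parallel>Y\<parallel>\<close> for all scalar \<open>Y\<close>: for \<open>p = 1\<close> by a layer-cake
  argument, for \<open>p > 1\<close> by Hoelder's inequality in one direction and, in the other, by maximising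
  \<open>\<integral> f y - (1/p) \<integral> \<sigma> y\<^sup>p\<close> over increasing \<open>y\<close>, whose maximiser produces a dominating \<open>Z'\<close>.

  A functional \<open>\<phi>\<close> is represented by the measure \<open>\<mu>(E)(x) = \<phi>(1\<^sub>E x)\<close>. Testing \<open>\<phi>\<close> on simple functions
  with almost norming vectors bounds the pairing of the variation density of \<open>\<mu>\<close> with scalar
  functions by the norm of \<open>\<phi>\<close>. Conversely a measure with this bound is integrated against every \<open>Y\<close>
  by completion in \<open>L\<^sup>1\<close> of the variation. So \<open>\<phi> \<mapsto> \<mu>\<close> is a bijection that preserves the norms, and all structure is
  transferred from the dual space, whose completeness is elementary.\<close>

subsection \<open>Uniform random variables and quantiles\<close>

text \<open>\<open>X^*\<close> need not have the Radon-Nikodym property, so a functional has in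
  general no \<open>X^*\<close>-valued density, while its variation always has a scalar one; every
  norm estimate is pushed onto that scalar density. Two further obstacles shape the proof. The norm
  is a supremum over all uniform \<open>U\<close>, through which dominated convergence does not
  pass: the quantile formula turns this supremum into a single integral, and that yields
  sigma-additivity of the representing measures and density of the simple functions. For finite
  \<open>q\<close> the dual norm is an infimum over dominating variables, for which even the
  triangle inequality is not visible; it is handled only through its equivalence with the pairing
  bound \<open>paired\<close>. The penalty \<open>(1/p) \<integral> \<sigma> y^p\<close> is the one
  that Young's inequality matches with a linear term: it bounds the maximum by \<open>D^q/q\<close>,
  and it gives the maximiser \<open>y\<close> the dominating weight \<open>y^(p-1)\<close>, whose
  \<open>q\<close>-th power is again \<open>y^p\<close>. The cone of increasing functions is a
  lattice that contains every \<open>indicator {a<..}\<close>, which makes these the directions of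
  variation.\<close>

definition unit_leb :: "real measure" where
  "unit_leb = restrict_space lborel {0<..<1}"

lemma space_unit_leb [simp]: "space unit_leb = {0<..<1}"
  by (simp add: unit_leb_def space_restrict_space)

lemma borel_measurable_unit_leb_mono_on:
  fixes g :: "real \<Rightarrow> real"
  assumes "mono_on {0<..<1} g"
  shows "g \<in> borel_measurable unit_leb"
proof -
  have "g \<in> borel_measurable (restrict_space borel {0<..<1})"
    by (rule borel_measurable_mono_on_fnc[OF assms])
  then show ?thesis
    unfolding unit_leb_def by (simp cong: measurable_cong_sets sets_restrict_space_cong)
qed

lemma borel_measurable_unit_leb_borel:
  "g \<in> borel_measurable borel \<Longrightarrow> g \<in> borel_measurable unit_leb"
  unfolding unit_leb_def by (intro measurable_restrict_space1) simp

lemma nn_integral_unit_leb: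
  "(\<integral>\<^sup>+u. g u \<partial>unit_leb) = (\<integral>\<^sup>+u\<in>{0<..<1}. g u \<partial>lborel)"
  unfolding unit_leb_def by (subst nn_integral_restrict_space) auto

lemma emeasure_unit_leb_tail:
  assumes "0 \<le> a" "a \<le> 1"
  shows "(\<integral>\<^sup>+u. indicator {a<..} u \<partial>unit_leb) = ennreal (1 - a)"
proof -
  have "(\<integral>\<^sup>+u. indicator {a<..} u \<partial>unit_leb) = (\<integral>\<^sup>+u. indicator {a<..<1} u \<partial>lborel)"
    unfolding nn_integral_unit_leb using assms
    by (intro nn_integral_cong) (auto simp: indicator_def)
  then show ?thesis using assms by simp
qed

context prob_space
begin

lemma uniform_rvsD:
  assumes "U \<in> uniform_rvs M"
  shows "U \<in> borel_measurable M" "\<omega> \<in> space M \<Longrightarrow> 0 \<le> U \<omega>" "\<omega> \<in> space M \<Longrightarrow> U \<omega> \<le> 1"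
    "0 \<le> u \<Longrightarrow> u \<le> 1 \<Longrightarrow> prob {\<omega>\<in>space M. U \<omega> \<le> u} = u"
  using assms by (auto simp: uniform_rvs_def)

lemma distributed_uniform_rvs:
  assumes "U \<in> uniform_rvs M"
  shows "distributed M lborel U (\<lambda>x. indicator {0..1} x)"
proof -
  have "distributed M lborel U (\<lambda>x. indicator {0..1::real} x / measure lborel {0..1::real})"
    using uniform_rvsD[OF assms] by (subst uniform_distributed_iff) auto
  then show ?thesis by (simp add: ennreal_indicator)
qed

lemma nn_integral_uniform_borel:
  assumes "U \<in> uniform_rvs M" "g \<in> borel_measurable borel"
  shows "(\<integral>\<^sup>+\<omega>. g (U \<omega>) \<partial>M) = (\<integral>\<^sup>+u\<in>{0..1}. g u \<partial>lborel)"
  using distributed_nn_integral[OF distributed_uniform_rvs[OF assms(1)], of g] assms(2)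
  by (simp add: mult.commute)

lemma AE_uniform_neq:
  assumes U: "U \<in> uniform_rvs M"
  shows "AE \<omega> in M. U \<omega> \<noteq> c"
proof -
  note [measurable] = uniform_rvsD(1)[OF U]
  have "(\<integral>\<^sup>+\<omega>. indicator {c} (U \<omega>) \<partial>M) = (\<integral>\<^sup>+u\<in>{0..1}. indicator {c} u \<partial>lborel)"
    by (rule nn_integral_uniform_borel[OF U]) simp
  also have "\<dots> \<le> (\<integral>\<^sup>+u. indicator {c} u \<partial>lborel)"
    by (intro nn_integral_mono) (auto simp: indicator_def)
  finally have "(\<integral>\<^sup>+\<omega>. indicator {c} (U \<omega>) \<partial>M) = 0" by simp
  then show ?thesis
    by (subst (asm) nn_integral_0_iff_AE) (auto simp: indicator_def split: if_splits)
qed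

lemma AE_uniform_unit:
  assumes U: "U \<in> uniform_rvs M"
  shows "AE \<omega> in M. U \<omega> \<in> {0<..<1}"
  using AE_uniform_neq[OF U, of 0] AE_uniform_neq[OF U, of 1] AE_space
proof eventually_elim
  case (elim \<omega>)
  then show ?case using uniform_rvsD(2,3)[OF U, of \<omega>] by auto
qed

text \<open>\<open>U\<close> may take the values \<open>0\<close> and \<open>1\<close>, where
  \<open>g\<close> is not controlled. On these two events the composition is constant, so
  measurability is checked separately over \<open>{0<..<1}\<close>, \<open>{0}\<close> and
  \<open>{1}\<close>.\<close>

lemma measurable_uniform_comp:
  assumes U: "U \<in> uniform_rvs M" and g: "g \<in> borel_measurable unit_leb"
  shows "(\<lambda>\<omega>. g (U \<omega>)) \<in> borel_measurable M"
proof -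
  note [measurable] = uniform_rvsD(1)[OF U]
  have "g \<in> borel_measurable (restrict_space borel {0<..<1})"
    using g unfolding unit_leb_def
    by (subst (asm) measurable_cong_sets[OF _ refl, where M'="restrict_space borel {0<..<1}"])
      (auto intro!: sets_restrict_space_cong)
  moreover have "U \<in> measurable (restrict_space M {\<omega>\<in>space M. U \<omega> \<in> {0<..<1}}) (restrict_space borel {0<..<1})"
    by (rule measurable_restrict_space3) auto
  ultimately have 1: "(\<lambda>\<omega>. g (U \<omega>)) \<in> borel_measurable (restrict_space M {\<omega>\<in>space M. U \<omega> \<in> {0<..<1}})"
    by (rule measurable_compose[rotated])
  show ?thesis
  proof (rule measurable_piecewise_restrict[of "(\<lambda>B. {\<omega>\<in>space M. U \<omega> \<in> B}) ` {{0<..<1},{0},{1}}"])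
    show "space M \<subseteq> \<Union> ((\<lambda>B. {\<omega> \<in> space M. U \<omega> \<in> B}) ` {{0<..<1}, {0}, {1}})"
      using uniform_rvsD(2,3)[OF U] by force
    fix S assume "S \<in> (\<lambda>B. {\<omega>\<in>space M. U \<omega> \<in> B}) ` {{0<..<1},{0},{1::real}}"
    then consider "S = {\<omega>\<in>space M. U \<omega> \<in> {0<..<1}}" | c where "S = {\<omega>\<in>space M. U \<omega> \<in> {c}}"
      by auto
    then show "(\<lambda>\<omega>. g (U \<omega>)) \<in> borel_measurable (restrict_space M S)"
    proof cases
      case 2
      have "(\<lambda>\<omega>. g c) \<in> borel_measurable (restrict_space M S)" by simp
      then show ?thesis
        by (rule measurable_cong[THEN iffD1, rotated]) (auto simp: 2 space_restrict_space)
    qed (use 1 in simp)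
  qed auto
qed

text \<open>The endpoints are null for \<open>U\<close>, so cutting \<open>g\<close> off to the open
  interval changes nothing and makes it Borel on the whole line.\<close>

lemma nn_integral_uniform:
  assumes U: "U \<in> uniform_rvs M" and g: "g \<in> borel_measurable unit_leb"
  shows "(\<integral>\<^sup>+\<omega>. g (U \<omega>) \<partial>M) = (\<integral>\<^sup>+u. g u \<partial>unit_leb)"
proof -
  have g': "(\<lambda>u. g u * indicator {0<..<1} u) \<in> borel_measurable borel"
    using g unfolding unit_leb_def
    by (subst (asm) borel_measurable_restrict_space_iff_ennreal) auto
  have "(\<integral>\<^sup>+\<omega>. g (U \<omega>) \<partial>M) = (\<integral>\<^sup>+\<omega>. g (U \<omega>) * indicator {0<..<1} (U \<omega>) \<partial>M)"
    using AE_uniform_unit[OF U] by (intro nn_integral_cong_AE) (rule eventually_mono, auto)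
  also have "\<dots> = (\<integral>\<^sup>+u\<in>{0..1}. (g u * indicator {0<..<1} u) \<partial>lborel)"
    by (rule nn_integral_uniform_borel[OF U g'])
  also have "\<dots> = (\<integral>\<^sup>+u. g u \<partial>unit_leb)"
    unfolding nn_integral_unit_leb by (intro nn_integral_cong) (auto simp: indicator_def)
  finally show ?thesis .
qed

lemma nn_integral_uniform_tail:
  assumes U: "U \<in> uniform_rvs M" and g: "g \<in> borel_measurable unit_leb"
  shows "(\<integral>\<^sup>+\<omega>. g (U \<omega>) * indicator {a<..} (U \<omega>) \<partial>M) = (\<integral>\<^sup>+u. g u * indicator {a<..} u \<partial>unit_leb)"
  by (rule nn_integral_uniform[OF U]) (intro borel_measurable_times_ennreal g borel_measurable_unit_leb_borel, simp)

text \<open>Probability integral transform. Without atoms the distribution function \<open>G\<close>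
  is continuous, hence attains each level \<open>u\<close> in \<open>(0,1)\<close>, and
  \<open>{G R \<le> u}\<close> is the event that \<open>R\<close> is at most the largest point of
  level \<open>u\<close>.\<close>

lemma uniform_cdf_comp:
  fixes R :: "_ \<Rightarrow> real"
  assumes R [measurable]: "R \<in> borel_measurable M"
    and atomless: "\<And>r. prob {\<omega>\<in>space M. R \<omega> = r} = 0"
  shows "(\<lambda>\<omega>. prob {\<omega>'\<in>space M. R \<omega>' \<le> R \<omega>}) \<in> uniform_rvs M"
proof -
  define G where "G = cdf (distr M borel R)"
  interpret D: real_distribution "distr M borel R"
    by (rule real_distribution_distr) simp
  have G: "G r = prob {\<omega>\<in>space M. R \<omega> \<le> r}" for r
    by (auto simp: G_def cdf_def measure_distr vimage_def Int_def intro!: arg_cong[where f=prob])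
  have "measure (distr M borel R) {r} = 0" for r
    using atomless[of r] by (simp add: measure_distr vimage_def Int_def conj_commute)
  then have cont: "isCont G r" for r
    unfolding G_def by (simp add: D.isCont_cdf)
  have mono: "mono G"
    unfolding G_def by (auto intro!: monoI D.cdf_nondecreasing)
  have "G \<in> borel_measurable borel" by (rule borel_measurable_mono[OF mono])
  then have meas [measurable]: "(\<lambda>\<omega>. G (R \<omega>)) \<in> borel_measurable M"
    by (rule measurable_compose[OF R])
  have main: "prob {\<omega>\<in>space M. G (R \<omega>) \<le> u} = u" if u: "0 < u" "u < 1" for u
  proof -
    define S where "S = {r. G r \<le> u}"
    have "closed S" unfolding S_def
      by (intro closed_Collect_le continuous_intros) (simp add: continuous_at_imp_continuous_on cont)
    have "eventually (\<lambda>r. G r < u) at_bot"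
      using D.cdf_lim_at_bot u(1) unfolding G_def by (auto simp: order_tendsto_iff)
    then obtain r0 where r0: "G r0 < u"
      using eventually_happens' by (metis trivial_limit_at_bot_linorder)
    have "eventually (\<lambda>r. G r > u) at_top"
      using D.cdf_lim_at_top_prob u(2) unfolding G_def by (auto simp: order_tendsto_iff)
    then obtain r1 where r1: "G r1 > u"
      using eventually_happens' by (metis trivial_limit_at_top_linorder)
    have "r0 \<le> r1" using r0 r1 mono by (meson dual_order.trans le_cases less_le_not_le monoD)
    then obtain r where r: "G r = u"
      using IVT[of G r0 u r1] r0 r1 cont by auto
    have "S \<noteq> {}" using r0 by (auto simp: S_def intro: less_imp_le)
    have bdd: "bdd_above S"
    proof (rule bdd_aboveI[of _ r1])
      fix x assume "x \<in> S"
      then show "x \<le> r1"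
        using r1 monoD[OF mono, of r1 x] by (cases "x \<le> r1") (auto simp: S_def)
    qed
    have "Sup S \<in> S" by (rule closed_contains_Sup) fact+
    moreover have "r \<le> Sup S" using r by (intro cSup_upper bdd) (auto simp: S_def)
    ultimately have "G (Sup S) = u"
      using monoD[OF mono, of r "Sup S"] r by (auto simp: S_def)
    moreover have "G x \<le> u \<longleftrightarrow> x \<le> Sup S" for x
      using \<open>G (Sup S) = u\<close> monoD[OF mono, of x "Sup S"] cSup_upper[OF _ bdd, of x]
      by (auto simp: S_def)
    ultimately show ?thesis by (simp add: G)
  qed
  have G01: "0 \<le> G r" "G r \<le> 1" for r by (auto simp: G)
  have "prob {\<omega>\<in>space M. G (R \<omega>) \<le> u} = u" if u: "0 \<le> u" "u \<le> 1" for u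
  proof -
    consider "u = 0" | "u = 1" | "0 < u" "u < 1" using u by fastforce
    then show ?thesis
    proof cases
      case 1
      have e: "prob {\<omega>\<in>space M. G (R \<omega>) \<le> 0} \<le> 0 + e" if "0 < e" for e
      proof -
        \<comment> \<open>The minimum with \<open>1/2\<close> keeps the level inside
          \<open>(0,1)\<close>, where \<open>main\<close> applies.\<close>
        have "prob {\<omega>\<in>space M. G (R \<omega>) \<le> 0} \<le> prob {\<omega>\<in>space M. G (R \<omega>) \<le> min e (1/2)}"
          using that by (intro finite_measure_mono) auto
        also have "\<dots> = min e (1/2)" using that by (intro main) auto
        finally show ?thesis by simp
      qed
      have "prob {\<omega>\<in>space M. G (R \<omega>) \<le> 0} \<le> 0" by (rule field_le_epsilon) (rule e)
      then show ?thesis using 1 by (simp add: measure_le_0_iff)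
    next
      case 2
      then show ?thesis using G01 by (simp add: prob_space)
    qed (rule main)
  qed
  then show ?thesis
    using meas G01 unfolding uniform_rvs_def by (auto simp: G)
qed

text \<open>Galois connection between quantile and distribution function. The limits at both ends
  make the defining set nonempty and bounded below, and right-continuity puts its infimum into the
  set.\<close>

lemma quantile_le_iff:
  assumes [measurable]: "W \<in> borel_measurable M" and u: "0 < u" "u < 1"
  shows "quantile M W u \<le> t \<longleftrightarrow> u \<le> prob {\<omega>\<in>space M. W \<omega> \<le> t}"
proof -
  define G where "G = cdf (distr M borel W)"
  interpret D: real_distribution "distr M borel W"
    by (rule real_distribution_distr) simp
  have G: "G r = prob {\<omega>\<in>space M. W \<omega> \<le> r}" for r
    by (auto simp: G_def cdf_def measure_distr vimage_def Int_def intro!: arg_cong[where f=prob])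
  have mono: "G s \<le> G t" if "s \<le> t" for s t
    unfolding G_def by (rule D.cdf_nondecreasing[OF that])
  define S where "S = {t. u \<le> G t}"
  have q: "quantile M W u = Inf S" by (simp add: quantile_def S_def G)
  have "eventually (\<lambda>r. G r < u) at_bot"
    using D.cdf_lim_at_bot u(1) unfolding G_def by (auto simp: order_tendsto_iff)
  then obtain r0 where r0: "G r0 < u"
    using eventually_happens' by (metis trivial_limit_at_bot_linorder)
  have "eventually (\<lambda>r. G r > u) at_top"
    using D.cdf_lim_at_top_prob u(2) unfolding G_def by (auto simp: order_tendsto_iff)
  then obtain r1 where r1: "G r1 > u"
    using eventually_happens' by (metis trivial_limit_at_top_linorder)
  have "S \<noteq> {}" using r1 by (auto simp: S_def intro: less_imp_le)
  have bdd: "bdd_below S"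
  proof (rule bdd_belowI[of _ r0])
    fix x assume "x \<in> S"
    then show "r0 \<le> x"
      using r0 mono[of x r0] by (cases "r0 \<le> x") (auto simp: S_def)
  qed
  have "u \<le> G (Inf S)"
  proof (rule ccontr)
    assume "\<not> u \<le> G (Inf S)"
    then have "eventually (\<lambda>r. G r < u) (at_right (Inf S))"
      using D.cdf_is_right_cont[of "Inf S"] unfolding G_def continuous_within
      by (auto simp: order_tendsto_iff)
    then obtain b where b: "b > Inf S" "\<And>y. Inf S < y \<Longrightarrow> y < b \<Longrightarrow> G y < u"
      unfolding eventually_at_right_field by auto
    then obtain s where "s \<in> S" "s < b"
      using cInf_lessD[OF \<open>S \<noteq> {}\<close>] by blast
    moreover have "Inf S \<le> s" by (rule cInf_lower[OF \<open>s \<in> S\<close> bdd])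
    ultimately show False
      using b \<open>\<not> u \<le> G (Inf S)\<close> by (cases "s = Inf S") (force simp: S_def)+
  qed
  then show ?thesis
    unfolding q using mono[of "Inf S" t] cInf_lower[OF _ bdd, of t] by (auto simp: S_def G[symmetric])
qed

lemma mono_on_quantile:
  assumes "W \<in> borel_measurable M"
  shows "mono_on {0<..<1} (quantile M W)"
proof (rule mono_onI)
  fix r s :: real assume "r \<in> {0<..<1}" "s \<in> {0<..<1}" "r \<le> s"
  then show "quantile M W r \<le> quantile M W s"
    using quantile_le_iff[OF assms, of r "quantile M W s"] quantile_le_iff[OF assms, of s "quantile M W s"]
    by auto
qed

lemmas borel_measurable_quantile = borel_measurable_unit_leb_mono_on[OF mono_on_quantile]

lemma quantile_nonneg:
  assumes W: "W \<in> borel_measurable M" and "\<And>\<omega>. \<omega> \<in> space M \<Longrightarrow> 0 \<le> W \<omega>" and "0 < u" "u < 1"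
  shows "0 \<le> quantile M W u"
proof (rule ccontr)
  assume "\<not> 0 \<le> quantile M W u"
  then have neg: "quantile M W u < 0" by simp
  have "u \<le> prob {\<omega>\<in>space M. W \<omega> \<le> quantile M W u}"
    using quantile_le_iff[OF W assms(3,4), of "quantile M W u"] by simp
  also have "{\<omega>\<in>space M. W \<omega> \<le> quantile M W u} = {}" using assms(2) neg by force
  finally show False using assms(3) by simp
qed

text \<open>Adding to \<open>W\<close> its distribution function, with the jumps filled by a uniform variable, gives an
  atomless \<open>R\<close> that is strictly increasing in \<open>W\<close>. The distribution function of \<open>R\<close> at \<open>R\<close> is then
  uniform.\<close>

lemma ex_uniform_quantile:
  assumes ex: "uniform_rvs M \<noteq> {}" and W [measurable]: "W \<in> borel_measurable M"
  shows "\<exists>V\<in>uniform_rvs M. AE \<omega> in M. W \<omega> = quantile M W (V \<omega>)"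
proof -
  obtain U where U: "U \<in> uniform_rvs M" using ex by auto
  note [measurable] = uniform_rvsD(1)[OF U]
  define F where "F t = prob {\<omega>\<in>space M. W \<omega> \<le> t}" for t
  define F' where "F' t = prob {\<omega>\<in>space M. W \<omega> < t}" for t
  have F: "mono F" "mono F'"
    unfolding F_def F'_def by (auto intro!: monoI finite_measure_mono)
  note [measurable] = borel_measurable_mono[OF F(1)] borel_measurable_mono[OF F(2)]
  have FF': "F s \<le> F' t" if "s < t" for s t
    using that unfolding F_def F'_def by (auto intro!: finite_measure_mono)
  have jump: "F t - F' t = prob {\<omega>\<in>space M. W \<omega> = t}" for t
  proof -
    have "F t = prob ({\<omega>\<in>space M. W \<omega> < t} \<union> {\<omega>\<in>space M. W \<omega> = t})"
      unfolding F_def by (rule arg_cong[where f=prob]) auto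
    also have "\<dots> = F' t + prob {\<omega>\<in>space M. W \<omega> = t}"
      unfolding F'_def by (rule finite_measure_Union) auto
    finally show ?thesis by simp
  qed
  then have jump0: "0 \<le> F t - F' t" for t by simp
  define R where "R \<omega> = W \<omega> + F' (W \<omega>) + (F (W \<omega>) - F' (W \<omega>)) * U \<omega>" for \<omega>
  have R [measurable]: "R \<in> borel_measurable M" unfolding R_def by measurable
  have R1: "W \<omega> + F' (W \<omega>) \<le> R \<omega>" if "\<omega> \<in> space M" for \<omega>
    unfolding R_def using uniform_rvsD(2)[OF U that] jump0 by simp
  have R2: "R \<omega> \<le> W \<omega> + F (W \<omega>)" if "\<omega> \<in> space M" for \<omega>
    unfolding R_def using mult_left_mono[OF uniform_rvsD(3)[OF U that] jump0[of "W \<omega>"]] by (simp add: algebra_simps)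
  \<comment> \<open>The intervals \<open>[t + F' t, t + F t]\<close> for different \<open>t\<close>
    are disjoint and ordered like \<open>t\<close>, so that \<open>R\<close> determines
    \<open>W\<close>.\<close>
  have R_less: "R \<omega> < R \<omega>'" if "\<omega> \<in> space M" "\<omega>' \<in> space M" "W \<omega> < W \<omega>'" for \<omega> \<omega>'
    using R2[OF that(1)] R1[OF that(2)] FF'[OF that(3)] that(3) by linarith
  have atomless: "prob {\<omega>\<in>space M. R \<omega> = r} = 0" for r
  proof (cases "{\<omega>\<in>space M. R \<omega> = r} = {}")
    case False
    then obtain \<omega>0 where \<omega>0: "\<omega>0 \<in> space M" "R \<omega>0 = r" by auto
    let ?w = "W \<omega>0"
    have W_eq: "W \<omega> = ?w" if "\<omega> \<in> space M" "R \<omega> = r" for \<omega>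
      using R_less[OF that(1) \<omega>0(1)] R_less[OF \<omega>0(1) that(1)] that \<omega>0 by force
    show ?thesis
    proof (cases "F ?w = F' ?w")
      case True
      then have "prob {\<omega>\<in>space M. W \<omega> = ?w} = 0" using jump[of ?w] by simp
      moreover have "prob {\<omega>\<in>space M. R \<omega> = r} \<le> prob {\<omega>\<in>space M. W \<omega> = ?w}"
        using W_eq by (intro finite_measure_mono) auto
      ultimately show ?thesis by (simp add: measure_le_0_iff)
    next
      case False
      \<comment> \<open>At a jump of the distribution function, \<open>R = r\<close> forces
        \<open>U\<close> to take this single value, which has probability zero.\<close>
      let ?c = "(r - ?w - F' ?w) / (F ?w - F' ?w)"
      have "prob {\<omega>\<in>space M. R \<omega> = r} \<le> prob {\<omega>\<in>space M. U \<omega> = ?c}"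
        using W_eq False by (intro finite_measure_mono) (auto simp: R_def field_simps)
      also have "prob {\<omega>\<in>space M. U \<omega> = ?c} = 0"
        using AE_uniform_neq[OF U, of ?c] by (subst prob_eq_0) auto
      finally show ?thesis by (simp add: measure_le_0_iff)
    qed
  next
    case True
    then show ?thesis by (simp only: measure_empty)
  qed
  define V where "V \<omega> = prob {\<omega>'\<in>space M. R \<omega>' \<le> R \<omega>}" for \<omega>
  have V: "V \<in> uniform_rvs M"
    unfolding V_def by (rule uniform_cdf_comp[OF R atomless])
  \<comment> \<open>The right endpoint of the interval of \<open>t\<close> is the threshold of
    \<open>R\<close> that corresponds to \<open>W \<le> t\<close>; this compares \<open>V\<close>
    with \<open>F t\<close>.\<close>
  have W_iff: "W \<omega> \<le> t \<longleftrightarrow> R \<omega> \<le> t + F t" if "\<omega> \<in> space M" for \<omega> t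
  proof
    assume "W \<omega> \<le> t"
    then show "R \<omega> \<le> t + F t" using R2[OF that] monoD[OF F(1), of "W \<omega>" t] by linarith
  next
    assume "R \<omega> \<le> t + F t"
    then show "W \<omega> \<le> t" using R1[OF that] FF'[of t "W \<omega>"] by (cases "W \<omega> \<le> t") auto
  qed
  have FR: "F t = prob {\<omega>\<in>space M. R \<omega> \<le> t + F t}" for t
    using W_iff by (subst F_def) (auto intro!: arg_cong[where f=prob])
  have 1: "V \<omega> \<le> F t" if "\<omega> \<in> space M" "W \<omega> \<le> t" for \<omega> t
    using that W_iff[OF that(1), of t] unfolding V_def by (subst FR) (auto intro!: finite_measure_mono)
  have 2: "F t \<le> V \<omega>" if "\<omega> \<in> space M" "\<not> W \<omega> \<le> t" for \<omega> t
    using that W_iff[OF that(1), of t] unfolding V_def by (subst FR) (auto intro!: finite_measure_mono)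
  have "AE \<omega> in M. \<forall>t\<in>\<rat>. V \<omega> \<noteq> F t"
    by (rule AE_ball_countable'[OF AE_uniform_neq[OF V] countable_rat])
  then have "AE \<omega> in M. W \<omega> = quantile M W (V \<omega>)"
    using AE_uniform_unit[OF V] AE_space
  proof eventually_elim
    case (elim \<omega>)
    then have *: "W \<omega> \<le> t \<longleftrightarrow> quantile M W (V \<omega>) \<le> t" if "t \<in> \<rat>" for t
      using quantile_le_iff[OF W, of "V \<omega>" t] 1[of \<omega> t] 2[of \<omega> t] that by (force simp: F_def)
    show ?case
    proof (rule ccontr)
      assume "W \<omega> \<noteq> quantile M W (V \<omega>)"
      then consider "W \<omega> < quantile M W (V \<omega>)" | "quantile M W (V \<omega>) < W \<omega>" by linarith
      then show False
      proof cases
        case 1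
        from Rats_dense_in_real[OF 1] obtain t where "t \<in> \<rat>" "W \<omega> < t" "t < quantile M W (V \<omega>)" by blast
        with *[of t] show False by simp
      next
        case 2
        from Rats_dense_in_real[OF 2] obtain t where "t \<in> \<rat>" "t < W \<omega>" "quantile M W (V \<omega>) < t" by blast
        with *[of t] show False by simp
      qed
    qed
  qed
  with V show ?thesis by blast
qed

end

subsection \<open>Rearrangement inequalities\<close>

text \<open>Fubini for the region under the graph of \<open>Y\<close>. Negative values of
  \<open>Y\<close> are truncated by \<open>ennreal\<close> on the left and by \<open>{0<..}\<close>
  on the right.\<close>

lemma nn_integral_layer_cake:
  fixes Y :: "'a \<Rightarrow> real" and W :: "'a \<Rightarrow> ennreal"
  assumes "sigma_finite_measure M"
    and Y [measurable]: "Y \<in> borel_measurable M" and W [measurable]: "W \<in> borel_measurable M"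
  shows "(\<integral>\<^sup>+\<omega>. W \<omega> * ennreal (Y \<omega>) \<partial>M) =
    (\<integral>\<^sup>+t. (\<integral>\<^sup>+\<omega>. W \<omega> * indicator {t<..} (Y \<omega>) \<partial>M) * indicator {0<..} t \<partial>lborel)"
proof -
  interpret M: sigma_finite_measure M by fact
  interpret P: pair_sigma_finite M lborel ..
  let ?f = "\<lambda>\<omega> t. W \<omega> * indicator {t<..} (Y \<omega>) * indicator {0<..} t :: ennreal"
  have "(\<integral>\<^sup>+\<omega>. W \<omega> * ennreal (Y \<omega>) \<partial>M) = (\<integral>\<^sup>+\<omega>. (\<integral>\<^sup>+t. ?f \<omega> t \<partial>lborel) \<partial>M)"
  proof (rule nn_integral_cong)
    fix \<omega>
    have "ennreal (Y \<omega>) = (\<integral>\<^sup>+t. indicator {0<..<Y \<omega>} t \<partial>lborel)"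
      by (cases "0 \<le> Y \<omega>") (auto simp: ennreal_neg)
    then have "W \<omega> * ennreal (Y \<omega>) = (\<integral>\<^sup>+t. W \<omega> * indicator {0<..<Y \<omega>} t \<partial>lborel)"
      by (simp add: nn_integral_cmult)
    also have "\<dots> = (\<integral>\<^sup>+t. ?f \<omega> t \<partial>lborel)"
      by (intro nn_integral_cong) (auto simp: indicator_def)
    finally show "W \<omega> * ennreal (Y \<omega>) = (\<integral>\<^sup>+t. ?f \<omega> t \<partial>lborel)" .
  qed
  also have "\<dots> = (\<integral>\<^sup>+t. (\<integral>\<^sup>+\<omega>. ?f \<omega> t \<partial>M) \<partial>lborel)"
  proof (rule P.Fubini'[symmetric])
    have "Measurable.pred (M \<Otimes>\<^sub>M lborel) (\<lambda>x. snd x < Y (fst x))" by measurable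
    then have "(\<lambda>x. W (fst x) * indicator {x \<in> space (M \<Otimes>\<^sub>M lborel). snd x < Y (fst x)} x * indicator {0<..} (snd x))
        \<in> borel_measurable (M \<Otimes>\<^sub>M lborel)"
      by (intro borel_measurable_times_ennreal borel_measurable_indicator) measurable
    then show "case_prod ?f \<in> borel_measurable (M \<Otimes>\<^sub>M lborel)"
      by (rule measurable_cong[THEN iffD1, rotated]) (auto simp: indicator_def space_pair_measure)
  qed
  also have "\<dots> = (\<integral>\<^sup>+t. (\<integral>\<^sup>+\<omega>. W \<omega> * indicator {t<..} (Y \<omega>) \<partial>M) * indicator {0<..} t \<partial>lborel)"
    by (intro nn_integral_cong nn_integral_multc) measurable
  finally show ?thesis .
qed

context prob_space
begin

lemma emeasure_uniform_greaterThan: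
  assumes "U \<in> uniform_rvs M" "0 \<le> a" "a \<le> 1"
  shows "emeasure M {\<omega>\<in>space M. a < U \<omega>} = ennreal (1 - a)"
proof -
  note [measurable] = uniform_rvsD(1)[OF assms(1)]
  have "emeasure M {\<omega>\<in>space M. a < U \<omega>} = (\<integral>\<^sup>+\<omega>. indicator {\<omega>\<in>space M. a < U \<omega>} \<omega> \<partial>M)"
    by simp
  also have "\<dots> = (\<integral>\<^sup>+\<omega>. indicator {a<..} (U \<omega>) \<partial>M)"
    by (intro nn_integral_cong) (auto simp: indicator_def)
  also have "\<dots> = (\<integral>\<^sup>+u. indicator {a<..} u \<partial>unit_leb)"
    by (rule nn_integral_uniform[OF assms(1)]) (rule borel_measurable_unit_leb_borel, simp)
  finally show ?thesis using emeasure_unit_leb_tail assms by simp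
qed

text \<open>Bathtub principle: among events of given probability, an increasing function of
  \<open>U\<close> has its largest integral on the upper tail \<open>B\<close>. The sets
  \<open>A - B\<close> and \<open>B - A\<close> have equal probability, and \<open>g (U)\<close> is
  at most \<open>g a\<close> on the first and at least \<open>g a\<close> on the second.\<close>

lemma nn_integral_uniform_set_le:
  fixes g :: "real \<Rightarrow> real"
  assumes U: "U \<in> uniform_rvs M" and A [measurable]: "A \<in> sets M" and g: "mono_on {0<..<1} g"
  shows "(\<integral>\<^sup>+\<omega>. ennreal (g (U \<omega>)) * indicator A \<omega> \<partial>M) \<le>
    (\<integral>\<^sup>+u. ennreal (g u) * indicator {1 - prob A<..} u \<partial>unit_leb)"
proof -
  note [measurable] = uniform_rvsD(1)[OF U]
  have gm: "(\<lambda>u. ennreal (g u)) \<in> borel_measurable unit_leb"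
    using borel_measurable_unit_leb_mono_on[OF g] by simp
  note [measurable] = measurable_uniform_comp[OF U gm]
  define a where "a = 1 - prob A"
  have a: "0 \<le> a" "a \<le> 1" by (auto simp: a_def)
  define B where "B = {\<omega>\<in>space M. a < U \<omega>}"
  have [measurable]: "B \<in> sets M" unfolding B_def by measurable
  have tail: "(\<integral>\<^sup>+u. ennreal (g u) * indicator {a<..} u \<partial>unit_leb) = (\<integral>\<^sup>+\<omega>. ennreal (g (U \<omega>)) * indicator B \<omega> \<partial>M)"
    by (subst nn_integral_uniform_tail[OF U gm, symmetric])
      (auto intro!: nn_integral_cong simp: indicator_def B_def)
  \<comment> \<open>The comparison value \<open>g a\<close> is available only for \<open>a\<close>
    inside the interval; at the two ends one of the events is trivial up to a null set.\<close>
  consider "a = 0" | "a = 1" | "0 < a" "a < 1" using a by linarith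
  then have "(\<integral>\<^sup>+\<omega>. ennreal (g (U \<omega>)) * indicator A \<omega> \<partial>M) \<le> (\<integral>\<^sup>+\<omega>. ennreal (g (U \<omega>)) * indicator B \<omega> \<partial>M)"
  proof cases
    case 1
    have "AE \<omega> in M. \<omega> \<in> B"
      using AE_uniform_unit[OF U] AE_space by eventually_elim (auto simp: B_def 1)
    then show ?thesis by (intro nn_integral_mono_AE) (auto simp: indicator_def)
  next
    case 2
    then have "AE \<omega> in M. \<omega> \<notin> A" by (subst prob_eq_0[symmetric]) (auto simp: a_def)
    then have "(\<integral>\<^sup>+\<omega>. ennreal (g (U \<omega>)) * indicator A \<omega> \<partial>M) = (\<integral>\<^sup>+\<omega>. 0 \<partial>M)"
      by (intro nn_integral_cong_AE) auto
    then show ?thesis by simp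
  next
    case 3
    let ?g = "\<lambda>\<omega>. ennreal (g (U \<omega>))"
    have eB: "emeasure M B = emeasure M A"
      unfolding B_def emeasure_uniform_greaterThan[OF U a] by (simp add: a_def emeasure_eq_measure)
    have eq: "emeasure M (A - B) = emeasure M (B - A)"
    proof -
      have "prob B = prob A" using eB by (simp add: emeasure_eq_measure)
      then show ?thesis
        using finite_measure_Diff'[of A B] finite_measure_Diff'[of B A]
        by (simp add: emeasure_eq_measure Int_commute)
    qed
    have "(\<integral>\<^sup>+\<omega>. ?g \<omega> * indicator A \<omega> \<partial>M) = (\<integral>\<^sup>+\<omega>. ?g \<omega> * indicator (A \<inter> B) \<omega> + ?g \<omega> * indicator (A - B) \<omega> \<partial>M)"
      by (intro nn_integral_cong) (auto simp: indicator_def)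
    also have "\<dots> = (\<integral>\<^sup>+\<omega>. ?g \<omega> * indicator (A \<inter> B) \<omega> \<partial>M) + (\<integral>\<^sup>+\<omega>. ?g \<omega> * indicator (A - B) \<omega> \<partial>M)"
      by (rule nn_integral_add) measurable
    also have "(\<integral>\<^sup>+\<omega>. ?g \<omega> * indicator (A - B) \<omega> \<partial>M) \<le> (\<integral>\<^sup>+\<omega>. ennreal (g a) * indicator (A - B) \<omega> \<partial>M)"
    proof (rule nn_integral_mono_AE)
      show "AE \<omega> in M. ?g \<omega> * indicator (A - B) \<omega> \<le> ennreal (g a) * indicator (A - B) \<omega>"
        using AE_uniform_unit[OF U] AE_space
      proof eventually_elim
        case (elim \<omega>)
        then show ?case using mono_onD[OF g, of "U \<omega>" a] 3
          by (auto simp: indicator_def B_def intro!: ennreal_leI)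
      qed
    qed
    also have "\<dots> = ennreal (g a) * emeasure M (B - A)" by (simp add: nn_integral_cmult_indicator eq)
    also have "\<dots> = (\<integral>\<^sup>+\<omega>. ennreal (g a) * indicator (B - A) \<omega> \<partial>M)" by (simp add: nn_integral_cmult_indicator)
    also have "\<dots> \<le> (\<integral>\<^sup>+\<omega>. ?g \<omega> * indicator (B - A) \<omega> \<partial>M)"
    proof (rule nn_integral_mono_AE)
      show "AE \<omega> in M. ennreal (g a) * indicator (B - A) \<omega> \<le> ?g \<omega> * indicator (B - A) \<omega>"
        using AE_uniform_unit[OF U] AE_space
      proof eventually_elim
        case (elim \<omega>)
        then show ?case using mono_onD[OF g, of a "U \<omega>"] 3
          by (auto simp: indicator_def B_def intro!: ennreal_leI)
      qed
    qed
    also have "(\<integral>\<^sup>+\<omega>. ?g \<omega> * indicator (A \<inter> B) \<omega> \<partial>M) + (\<integral>\<^sup>+\<omega>. ?g \<omega> * indicator (B - A) \<omega> \<partial>M) =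
        (\<integral>\<^sup>+\<omega>. ?g \<omega> * indicator (A \<inter> B) \<omega> + ?g \<omega> * indicator (B - A) \<omega> \<partial>M)"
      by (rule nn_integral_add[symmetric]) measurable
    also have "\<dots> = (\<integral>\<^sup>+\<omega>. ?g \<omega> * indicator B \<omega> \<partial>M)"
      by (intro nn_integral_cong) (auto simp: indicator_def)
    finally show ?thesis by (simp add: add_left_mono)
  qed
  then show ?thesis using tail by (simp add: a_def)
qed

text \<open>By the layer-cake formula only the sets \<open>{t < y (V)}\<close> matter. Since
  \<open>y\<close> is increasing, each of them is, up to a null event, either empty or a tail
  \<open>{a < V}\<close>.\<close>

lemma nn_integral_mono_tails:
  fixes y :: "real \<Rightarrow> real" and W G :: "'a \<Rightarrow> ennreal"
  assumes V: "V \<in> uniform_rvs M" and y: "mono_on {0<..<1} y"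
    and W [measurable]: "W \<in> borel_measurable M" and G [measurable]: "G \<in> borel_measurable M"
    and le: "\<And>a. 0 \<le> a \<Longrightarrow> a < 1 \<Longrightarrow>
      (\<integral>\<^sup>+\<omega>. W \<omega> * indicator {a<..} (V \<omega>) \<partial>M) \<le> (\<integral>\<^sup>+\<omega>. G \<omega> * indicator {a<..} (V \<omega>) \<partial>M)"
  shows "(\<integral>\<^sup>+\<omega>. W \<omega> * ennreal (y (V \<omega>)) \<partial>M) \<le> (\<integral>\<^sup>+\<omega>. G \<omega> * ennreal (y (V \<omega>)) \<partial>M)"
proof -
  note [measurable] = uniform_rvsD(1)[OF V] measurable_uniform_comp[OF V borel_measurable_unit_leb_mono_on[OF y]]
  have tails: "(\<integral>\<^sup>+\<omega>. W \<omega> * indicator {t<..} (y (V \<omega>)) \<partial>M) \<le> (\<integral>\<^sup>+\<omega>. G \<omega> * indicator {t<..} (y (V \<omega>)) \<partial>M)" for t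
  proof -
    define S where "S = {u\<in>{0<..<1}. t < y u}"
    show ?thesis
    proof (cases "S = {}")
      case True
      have "(\<integral>\<^sup>+\<omega>. W \<omega> * indicator {t<..} (y (V \<omega>)) \<partial>M) = (\<integral>\<^sup>+\<omega>. 0 \<partial>M)"
        by (intro nn_integral_cong_AE eventually_mono[OF AE_uniform_unit[OF V]])
          (use True in \<open>auto simp: S_def indicator_def\<close>)
      then show ?thesis by simp
    next
      case False
      have bdd: "bdd_below S" by (auto simp: S_def intro!: bdd_belowI[of _ 0])
      have 0: "0 \<le> Inf S" using False by (intro cInf_greatest) (auto simp: S_def)
      from False obtain s where s: "s \<in> S" by auto
      then have 1: "Inf S < 1" using cInf_lower[OF s bdd] by (auto simp: S_def)
      \<comment> \<open>The up-set \<open>S\<close> may or may not contain its infimum;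
        \<open>V\<close> hits this point with probability zero.\<close>
      have eq: "AE \<omega> in M. indicator {t<..} (y (V \<omega>)) = (indicator {Inf S<..} (V \<omega>) :: ennreal)"
        using AE_uniform_unit[OF V] AE_uniform_neq[OF V, of "Inf S"]
      proof eventually_elim
        case (elim \<omega>)
        have "t < y (V \<omega>) \<longleftrightarrow> Inf S < V \<omega>"
        proof
          assume "t < y (V \<omega>)"
          then have "V \<omega> \<in> S" using elim by (auto simp: S_def)
          then show "Inf S < V \<omega>" using cInf_lower[OF _ bdd, of "V \<omega>"] elim by simp
        next
          assume "Inf S < V \<omega>"
          then obtain x where "x \<in> S" "x < V \<omega>" using cInf_lessD[OF False] by blast
          then show "t < y (V \<omega>)" using mono_onD[OF y, of x "V \<omega>"] elim by (auto simp: S_def)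
        qed
        then show ?case by (auto simp: indicator_def)
      qed
      have "(\<integral>\<^sup>+\<omega>. W \<omega> * indicator {t<..} (y (V \<omega>)) \<partial>M) = (\<integral>\<^sup>+\<omega>. W \<omega> * indicator {Inf S<..} (V \<omega>) \<partial>M)"
        using eq by (intro nn_integral_cong_AE) (auto elim!: eventually_mono)
      also have "\<dots> \<le> (\<integral>\<^sup>+\<omega>. G \<omega> * indicator {Inf S<..} (V \<omega>) \<partial>M)" by (rule le[OF 0 1])
      also have "\<dots> = (\<integral>\<^sup>+\<omega>. G \<omega> * indicator {t<..} (y (V \<omega>)) \<partial>M)"
        using eq by (intro nn_integral_cong_AE) (auto elim!: eventually_mono)
      finally show ?thesis .
    qed
  qed
  have sf: "sigma_finite_measure M" ..
  show ?thesis
    by (subst (1 2) nn_integral_layer_cake[OF sf]) (auto intro!: nn_integral_mono mult_right_mono tails)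
qed

text \<open>The bathtub principle on the events \<open>{a < V}\<close> shows that replacing
  \<open>U\<close> by \<open>V\<close> increases every tail integral, hence the integral against
  \<open>y (V)\<close>. Afterwards both factors are functions of the same uniform variable.\<close>

lemma nn_integral_hardy_littlewood:
  fixes g y :: "real \<Rightarrow> real"
  assumes U: "U \<in> uniform_rvs M" and V: "V \<in> uniform_rvs M"
    and g: "mono_on {0<..<1} g" and y: "mono_on {0<..<1} y"
  shows "(\<integral>\<^sup>+\<omega>. ennreal (g (U \<omega>)) * ennreal (y (V \<omega>)) \<partial>M) \<le> (\<integral>\<^sup>+u. ennreal (g u) * ennreal (y u) \<partial>unit_leb)"
proof -
  note [measurable] = uniform_rvsD(1)[OF V] borel_measurable_unit_leb_mono_on[OF g] borel_measurable_unit_leb_mono_on[OF y]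
  have gm: "(\<lambda>u. ennreal (g u)) \<in> borel_measurable unit_leb" by measurable
  have "(\<integral>\<^sup>+\<omega>. ennreal (g (U \<omega>)) * ennreal (y (V \<omega>)) \<partial>M) \<le> (\<integral>\<^sup>+\<omega>. ennreal (g (V \<omega>)) * ennreal (y (V \<omega>)) \<partial>M)"
  proof (rule nn_integral_mono_tails[OF V y])
    fix a :: real assume a: "0 \<le> a" "a < 1"
    define A where "A = {\<omega>\<in>space M. a < V \<omega>}"
    have [measurable]: "A \<in> sets M" unfolding A_def by measurable
    have pA: "1 - prob A = a"
      using emeasure_uniform_greaterThan[OF V, of a] a by (simp add: A_def emeasure_eq_measure)
    have "(\<integral>\<^sup>+\<omega>. ennreal (g (U \<omega>)) * indicator {a<..} (V \<omega>) \<partial>M) = (\<integral>\<^sup>+\<omega>. ennreal (g (U \<omega>)) * indicator A \<omega> \<partial>M)"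
      by (intro nn_integral_cong) (auto simp: A_def indicator_def)
    also have "\<dots> \<le> (\<integral>\<^sup>+u. ennreal (g u) * indicator {1 - prob A<..} u \<partial>unit_leb)"
      by (rule nn_integral_uniform_set_le[OF U _ g]) measurable
    also have "\<dots> = (\<integral>\<^sup>+\<omega>. ennreal (g (V \<omega>)) * indicator {a<..} (V \<omega>) \<partial>M)"
      unfolding pA by (rule nn_integral_uniform_tail[OF V gm, symmetric])
    finally show "(\<integral>\<^sup>+\<omega>. ennreal (g (U \<omega>)) * indicator {a<..} (V \<omega>) \<partial>M) \<le> (\<integral>\<^sup>+\<omega>. ennreal (g (V \<omega>)) * indicator {a<..} (V \<omega>) \<partial>M)" .
  qed (rule measurable_uniform_comp[OF U gm] measurable_uniform_comp[OF V gm])+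
  also have "\<dots> = (\<integral>\<^sup>+u. ennreal (g u) * ennreal (y u) \<partial>unit_leb)"
    by (rule nn_integral_uniform[OF V, of "\<lambda>u. ennreal (g u) * ennreal (y u)"]) measurable
  finally show ?thesis .
qed

end

lemma distortionD:
  assumes "distortion \<sigma>"
  shows "mono_on {0<..<1} \<sigma>" "0 < u \<Longrightarrow> u < 1 \<Longrightarrow> 0 \<le> \<sigma> u" "(\<integral>\<^sup>+u. ennreal (\<sigma> u) \<partial>unit_leb) = 1"
proof -
  show "mono_on {0<..<1} \<sigma>"
    using assms by (auto simp: distortion_def intro: mono_on_subset)
  show "0 < u \<Longrightarrow> u < 1 \<Longrightarrow> 0 \<le> \<sigma> u" using assms by (auto simp: distortion_def)
  have "(\<integral>\<^sup>+u. ennreal (\<sigma> u) \<partial>unit_leb) = (\<integral>\<^sup>+u\<in>{0..<1}. ennreal (\<sigma> u) \<partial>lborel)"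
    unfolding nn_integral_unit_leb
  proof (rule nn_integral_cong_AE)
    show "AE u in lborel. ennreal (\<sigma> u) * indicator {0<..<1} u = ennreal (\<sigma> u) * indicator {0..<1} u"
      using AE_lborel_singleton[of 0] by eventually_elim (auto simp: indicator_def)
  qed
  then show "(\<integral>\<^sup>+u. ennreal (\<sigma> u) \<partial>unit_leb) = 1" using assms by (simp add: distortion_def)
qed

lemma ennreal_root_le_iff:
  assumes "0 < r" "0 \<le> c"
  shows "ennreal_root r x \<le> ennreal c \<longleftrightarrow> x \<le> ennreal (c powr r)"
proof (cases x)
  case (real a)
  have "a powr (1 / r) \<le> c \<longleftrightarrow> a \<le> c powr r"
  proof
    assume "a powr (1 / r) \<le> c"
    then have "(a powr (1 / r)) powr r \<le> c powr r" using assms by (intro powr_mono2) auto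
    then show "a \<le> c powr r" using assms real by (simp add: powr_powr)
  next
    assume "a \<le> c powr r"
    then have "a powr (1 / r) \<le> (c powr r) powr (1 / r)" using assms real by (intro powr_mono2) auto
    then show "a powr (1 / r) \<le> c" using assms by (simp add: powr_powr)
  qed
  then show ?thesis using real assms by (simp add: ennreal_root_def)
qed (simp add: ennreal_root_def top_unique)

lemma ennreal_root_less_top [simp]: "ennreal_root r x < \<top> \<longleftrightarrow> x < \<top>"
  by (auto simp: ennreal_root_def less_top)


subsection \<open>Moments over all uniform reweightings\<close>

text \<open>The norm before the root is taken. A bound on the norm is then written
  \<open>sigma_moment M \<sigma> r Y \<le> ennreal (b powr r)\<close> with a real \<open>b\<close>,
  without roots in \<open>ennreal\<close>.\<close>

definition sigma_moment ::
  "'w measure \<Rightarrow> (real \<Rightarrow> real) \<Rightarrow> real \<Rightarrow> ('w \<Rightarrow> 'x::real_normed_vector) \<Rightarrow> ennreal" where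
  "sigma_moment M \<sigma> r Y = (SUP U \<in> uniform_rvs M. \<integral>\<^sup>+\<omega>. ennreal (\<sigma> (U \<omega>) * norm (Y \<omega>) powr r) \<partial>M)"

lemma sigma_norm_eq: "sigma_norm M \<sigma> r Y = ennreal_root r (sigma_moment M \<sigma> r Y)"
  by (simp add: sigma_norm_def sigma_moment_def)

lemma sigma_norm_le_iff:
  "0 < r \<Longrightarrow> 0 \<le> c \<Longrightarrow> sigma_norm M \<sigma> r Y \<le> ennreal c \<longleftrightarrow> sigma_moment M \<sigma> r Y \<le> ennreal (c powr r)"
  unfolding sigma_norm_eq by (rule ennreal_root_le_iff)

lemma sigma_norm_less_top_iff: "sigma_norm M \<sigma> r Y < \<top> \<longleftrightarrow> sigma_moment M \<sigma> r Y < \<top>"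
  unfolding sigma_norm_eq by simp

locale distortion_space = prob_space M for M :: "'w measure" +
  fixes \<sigma> :: "real \<Rightarrow> real"
  assumes ex_uniform: "uniform_rvs M \<noteq> {}" and distortion: "distortion \<sigma>"
begin

lemmas sigma_mono = distortionD(1)[OF distortion]
lemmas sigma_nonneg = distortionD(2)[OF distortion]
lemmas nn_integral_sigma = distortionD(3)[OF distortion]
lemmas borel_measurable_sigma [measurable] = borel_measurable_unit_leb_mono_on[OF sigma_mono]

lemma AE_sigma_nonneg: "U \<in> uniform_rvs M \<Longrightarrow> AE \<omega> in M. 0 \<le> \<sigma> (U \<omega>)"
  by (rule eventually_mono[OF AE_uniform_unit]) (auto intro: sigma_nonneg)

lemma sigma_moment_mono:
  assumes "AE \<omega> in M. norm (Y \<omega>) \<le> norm (Z \<omega>)" "0 \<le> r"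
  shows "sigma_moment M \<sigma> r Y \<le> sigma_moment M \<sigma> r Z"
  unfolding sigma_moment_def
proof (intro SUP_mono bexI)
  fix U assume U: "U \<in> uniform_rvs M"
  show "(\<integral>\<^sup>+\<omega>. ennreal (\<sigma> (U \<omega>) * norm (Y \<omega>) powr r) \<partial>M) \<le> (\<integral>\<^sup>+\<omega>. ennreal (\<sigma> (U \<omega>) * norm (Z \<omega>) powr r) \<partial>M)"
  proof (rule nn_integral_mono_AE)
    show "AE \<omega> in M. ennreal (\<sigma> (U \<omega>) * norm (Y \<omega>) powr r) \<le> ennreal (\<sigma> (U \<omega>) * norm (Z \<omega>) powr r)"
      using assms(1) AE_sigma_nonneg[OF U]
      by eventually_elim (use assms(2) in \<open>auto intro!: ennreal_leI mult_left_mono powr_mono2\<close>)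
  qed
qed

lemma sigma_moment_cong:
  assumes "AE \<omega> in M. norm (Y \<omega>) = norm (Z \<omega>)" "0 \<le> r"
  shows "sigma_moment M \<sigma> r Y = sigma_moment M \<sigma> r Z"
  by (intro antisym sigma_moment_mono assms(2)) (use assms(1) in \<open>auto elim: eventually_mono\<close>)

lemma mono_on_powr:
  fixes y :: "real \<Rightarrow> real"
  assumes "mono_on {0<..<1} y" "\<And>u. 0 < u \<Longrightarrow> u < 1 \<Longrightarrow> 0 \<le> y u" "0 \<le> r"
  shows "mono_on {0<..<1} (\<lambda>u. y u powr r)"
  using assms by (auto intro!: mono_onI powr_mono2 dest: mono_onD)

text \<open>The rearrangement inequality bounds every choice of \<open>U\<close> by the integral on
  the right, and \<open>U = V\<close> attains it.\<close>

lemma sigma_moment_comonotone: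
  fixes Y :: "'w \<Rightarrow> 'x::real_normed_vector"
  assumes V: "V \<in> uniform_rvs M" and y: "mono_on {0<..<1} y" "\<And>u. 0 < u \<Longrightarrow> u < 1 \<Longrightarrow> 0 \<le> y u"
    and Y: "AE \<omega> in M. norm (Y \<omega>) = y (V \<omega>)" and r: "0 \<le> r"
  shows "sigma_moment M \<sigma> r Y = (\<integral>\<^sup>+u. ennreal (\<sigma> u * y u powr r) \<partial>unit_leb)"
proof (rule antisym)
  note yr = mono_on_powr[OF y r]
  note [measurable] = borel_measurable_unit_leb_mono_on[OF yr]
  show "sigma_moment M \<sigma> r Y \<le> (\<integral>\<^sup>+u. ennreal (\<sigma> u * y u powr r) \<partial>unit_leb)"
    unfolding sigma_moment_def
  proof (rule SUP_least)
    fix U assume U: "U \<in> uniform_rvs M"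
    have "(\<integral>\<^sup>+\<omega>. ennreal (\<sigma> (U \<omega>) * norm (Y \<omega>) powr r) \<partial>M) = (\<integral>\<^sup>+\<omega>. ennreal (\<sigma> (U \<omega>)) * ennreal (y (V \<omega>) powr r) \<partial>M)"
      using Y by (intro nn_integral_cong_AE) (auto simp: ennreal_mult'' elim: eventually_mono)
    also have "\<dots> \<le> (\<integral>\<^sup>+u. ennreal (\<sigma> u) * ennreal (y u powr r) \<partial>unit_leb)"
      by (rule nn_integral_hardy_littlewood[OF U V sigma_mono yr])
    finally show "(\<integral>\<^sup>+\<omega>. ennreal (\<sigma> (U \<omega>) * norm (Y \<omega>) powr r) \<partial>M) \<le> (\<integral>\<^sup>+u. ennreal (\<sigma> u * y u powr r) \<partial>unit_leb)"
      by (simp add: ennreal_mult'')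
  qed
  have "(\<integral>\<^sup>+u. ennreal (\<sigma> u * y u powr r) \<partial>unit_leb) = (\<integral>\<^sup>+\<omega>. ennreal (\<sigma> (V \<omega>) * y (V \<omega>) powr r) \<partial>M)"
    by (rule nn_integral_uniform[OF V, symmetric]) measurable
  also have "\<dots> = (\<integral>\<^sup>+\<omega>. ennreal (\<sigma> (V \<omega>) * norm (Y \<omega>) powr r) \<partial>M)"
    using Y by (intro nn_integral_cong_AE) (auto elim: eventually_mono)
  also have "\<dots> \<le> sigma_moment M \<sigma> r Y"
    unfolding sigma_moment_def by (rule SUP_upper[OF V])
  finally show "(\<integral>\<^sup>+u. ennreal (\<sigma> u * y u powr r) \<partial>unit_leb) \<le> sigma_moment M \<sigma> r Y" .
qed

text \<open>Law invariance: the quantile function along a representing uniform variable is a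
  comonotone description of \<open>norm (Y)\<close>.\<close>

lemma sigma_moment_quantile:
  fixes Y :: "'w \<Rightarrow> 'x::real_normed_vector"
  assumes Y: "(\<lambda>\<omega>. norm (Y \<omega>)) \<in> borel_measurable M" and r: "0 \<le> r"
  shows "sigma_moment M \<sigma> r Y = (\<integral>\<^sup>+u. ennreal (\<sigma> u * quantile M (\<lambda>\<omega>. norm (Y \<omega>)) u powr r) \<partial>unit_leb)"
proof -
  obtain V where "V \<in> uniform_rvs M" "AE \<omega> in M. norm (Y \<omega>) = quantile M (\<lambda>\<omega>. norm (Y \<omega>)) (V \<omega>)"
    using ex_uniform_quantile[OF ex_uniform Y] by auto
  then show ?thesis
    by (intro sigma_moment_comonotone[where V=V]) (use r in \<open>auto intro!: mono_on_quantile Y quantile_nonneg\<close>)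
qed

lemma borel_measurable_sigma_powr:
  fixes Y :: "'w \<Rightarrow> 'x::real_normed_vector"
  assumes U: "U \<in> uniform_rvs M" and [measurable]: "(\<lambda>\<omega>. norm (Y \<omega>)) \<in> borel_measurable M"
  shows "(\<lambda>\<omega>. ennreal (\<sigma> (U \<omega>) * norm (Y \<omega>) powr r)) \<in> borel_measurable M"
proof -
  note [measurable] = measurable_uniform_comp[OF U borel_measurable_sigma]
  show ?thesis by measurable
qed

lemma sigma_moment_scale:
  fixes Y :: "'w \<Rightarrow> 'x::real_normed_vector" and Z :: "'w \<Rightarrow> 'y::real_normed_vector"
  assumes Y: "(\<lambda>\<omega>. norm (Y \<omega>)) \<in> borel_measurable M"
    and Z: "\<And>\<omega>. norm (Z \<omega>) = c * norm (Y \<omega>)" and c: "0 \<le> c"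
  shows "sigma_moment M \<sigma> r Z = ennreal (c powr r) * sigma_moment M \<sigma> r Y"
proof -
  have "(\<integral>\<^sup>+\<omega>. ennreal (\<sigma> (U \<omega>) * norm (Z \<omega>) powr r) \<partial>M) =
      ennreal (c powr r) * (\<integral>\<^sup>+\<omega>. ennreal (\<sigma> (U \<omega>) * norm (Y \<omega>) powr r) \<partial>M)" if U: "U \<in> uniform_rvs M" for U
    unfolding nn_integral_cmult[OF borel_measurable_sigma_powr[OF U Y], symmetric]
    using c by (intro nn_integral_cong) (auto simp: Z powr_mult ennreal_mult'[symmetric] mult_ac)
  then show ?thesis
    unfolding sigma_moment_def by (simp add: SUP_mult_left_ennreal)
qed

text \<open>A crude constant, from \<open>norm (y + z) \<le> 2 * max (norm y) (norm z)\<close>; it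
  gives closure of \<open>sigma_fun\<close> under addition.\<close>

lemma sigma_moment_add_le:
  fixes Y Z :: "'w \<Rightarrow> 'x::real_normed_vector"
  assumes Y: "(\<lambda>\<omega>. norm (Y \<omega>)) \<in> borel_measurable M" and Z: "(\<lambda>\<omega>. norm (Z \<omega>)) \<in> borel_measurable M"
    and r: "0 \<le> r"
  shows "sigma_moment M \<sigma> r (\<lambda>\<omega>. Y \<omega> + Z \<omega>) \<le>
    ennreal (2 powr r) * (sigma_moment M \<sigma> r Y + sigma_moment M \<sigma> r Z)"
  unfolding sigma_moment_def[of M \<sigma> r "\<lambda>\<omega>. Y \<omega> + Z \<omega>"]
proof (rule SUP_least)
  fix U assume U: "U \<in> uniform_rvs M"
  note [measurable] = borel_measurable_sigma_powr[OF U Y] borel_measurable_sigma_powr[OF U Z]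
  let ?i = "\<lambda>Y \<omega>. ennreal (\<sigma> (U \<omega>) * norm (Y \<omega>) powr r)"
  have le: "norm (y + z) powr r \<le> 2 powr r * (norm y powr r + norm z powr r)" for y z :: 'x
  proof -
    have "norm (y + z) powr r \<le> (2 * max (norm y) (norm z)) powr r"
      using norm_triangle_ineq[of y z] r by (intro powr_mono2) auto
    also have "\<dots> = 2 powr r * max (norm y) (norm z) powr r" by (simp add: powr_mult)
    also have "max (norm y) (norm z) powr r \<le> norm y powr r + norm z powr r"
      by (simp add: max_def)
    finally show ?thesis by simp
  qed
  have "(\<integral>\<^sup>+\<omega>. ?i (\<lambda>\<omega>. Y \<omega> + Z \<omega>) \<omega> \<partial>M) \<le> (\<integral>\<^sup>+\<omega>. ennreal (2 powr r) * (?i Y \<omega> + ?i Z \<omega>) \<partial>M)"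
  proof (rule nn_integral_mono_AE)
    show "AE \<omega> in M. ?i (\<lambda>\<omega>. Y \<omega> + Z \<omega>) \<omega> \<le> ennreal (2 powr r) * (?i Y \<omega> + ?i Z \<omega>)"
      using AE_sigma_nonneg[OF U]
    proof eventually_elim
      case (elim \<omega>)
      have "\<sigma> (U \<omega>) * norm (Y \<omega> + Z \<omega>) powr r \<le> \<sigma> (U \<omega>) * (2 powr r * (norm (Y \<omega>) powr r + norm (Z \<omega>) powr r))"
        by (rule mult_left_mono[OF le elim])
      then show ?case using elim
        by (simp add: ennreal_plus[symmetric] ennreal_mult'[symmetric] algebra_simps del: ennreal_plus)
    qed
  qed
  also have "\<dots> = ennreal (2 powr r) * ((\<integral>\<^sup>+\<omega>. ?i Y \<omega> \<partial>M) + (\<integral>\<^sup>+\<omega>. ?i Z \<omega> \<partial>M))"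
    by (simp add: nn_integral_cmult nn_integral_add)
  also have "\<dots> \<le> ennreal (2 powr r) * (sigma_moment M \<sigma> r Y + sigma_moment M \<sigma> r Z)"
    unfolding sigma_moment_def by (intro mult_left_mono add_mono SUP_upper U) auto
  finally show "(\<integral>\<^sup>+\<omega>. ?i (\<lambda>\<omega>. Y \<omega> + Z \<omega>) \<omega> \<partial>M) \<le>
    ennreal (2 powr r) * (sigma_moment M \<sigma> r Y + sigma_moment M \<sigma> r Z)" .
qed

text \<open>The weight \<open>\<sigma> (U)\<close> has expectation \<open>1\<close> for every
  uniform \<open>U\<close>.\<close>

lemma sigma_moment_le_1:
  fixes Y :: "'w \<Rightarrow> 'x::real_normed_vector"
  assumes "\<And>\<omega>. \<omega> \<in> space M \<Longrightarrow> norm (Y \<omega>) \<le> 1" and r: "0 \<le> r"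
  shows "sigma_moment M \<sigma> r Y \<le> 1"
proof -
  have "sigma_moment M \<sigma> r Y \<le> sigma_moment M \<sigma> r (\<lambda>\<omega>. 1::real)"
    using assms by (intro sigma_moment_mono) auto
  also have "\<dots> \<le> 1"
    unfolding sigma_moment_def
    using nn_integral_uniform[of _ "\<lambda>u. ennreal (\<sigma> u)"] nn_integral_sigma by (intro SUP_least) simp
  finally show ?thesis .
qed

text \<open>Pointwise convergence implies convergence in probability: as soon as
  \<open>Y n \<le> e/2\<close> has probability above \<open>u\<close>, the quantile at
  \<open>u\<close> is at most \<open>e/2\<close>. This is where \<open>u < 1\<close> enters.\<close>

lemma quantile_tendsto_0:
  fixes Y :: "nat \<Rightarrow> 'w \<Rightarrow> real"
  assumes [measurable]: "\<And>n. Y n \<in> borel_measurable M" and nn: "\<And>n \<omega>. \<omega> \<in> space M \<Longrightarrow> 0 \<le> Y n \<omega>"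
    and lim: "\<And>\<omega>. \<omega> \<in> space M \<Longrightarrow> (\<lambda>n. Y n \<omega>) \<longlonglongrightarrow> 0" and u: "0 < u" "u < 1"
  shows "(\<lambda>n. quantile M (Y n) u) \<longlonglongrightarrow> 0"
proof (rule LIMSEQ_I)
  fix e :: real assume e: "0 < e"
  have "(\<lambda>n. \<integral>\<omega>. indicator {\<omega>\<in>space M. Y n \<omega> \<le> e/2} \<omega> \<partial>M) \<longlonglongrightarrow> (\<integral>\<omega>. (1::real) \<partial>M)"
  proof (rule integral_dominated_convergence[where w="\<lambda>_. 1"])
    show "AE \<omega> in M. (\<lambda>n. indicator {\<omega>\<in>space M. Y n \<omega> \<le> e/2} \<omega> :: real) \<longlonglongrightarrow> 1"
    proof (rule AE_I2)
      fix \<omega> assume w: "\<omega> \<in> space M"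
      have "\<forall>\<^sub>F n in sequentially. Y n \<omega> < e/2"
        using order_tendstoD(2)[OF lim[OF w], of "e/2"] e by simp
      then have "\<forall>\<^sub>F n in sequentially. indicator {\<omega>\<in>space M. Y n \<omega> \<le> e/2} \<omega> = (1::real)"
        by eventually_elim (use w in simp)
      then show "(\<lambda>n. indicator {\<omega>\<in>space M. Y n \<omega> \<le> e/2} \<omega> :: real) \<longlonglongrightarrow> 1"
        by (rule tendsto_eventually)
    qed
  qed (auto simp: indicator_def)
  then have "(\<lambda>n. prob {\<omega>\<in>space M. Y n \<omega> \<le> e/2}) \<longlonglongrightarrow> 1"
    by (simp add: prob_space)
  from order_tendstoD(1)[OF this u(2)]
  obtain N where N: "\<And>n. n \<ge> N \<Longrightarrow> u < prob {\<omega>\<in>space M. Y n \<omega> \<le> e/2}"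
    by (auto simp: eventually_sequentially)
  show "\<exists>N. \<forall>n\<ge>N. norm (quantile M (Y n) u - 0) < e"
  proof (intro exI allI impI)
    fix n assume "N \<le> n"
    then have "quantile M (Y n) u \<le> e/2"
      using quantile_le_iff[of "Y n" u "e/2"] u N[of n] by simp
    moreover have "0 \<le> quantile M (Y n) u" using nn u by (intro quantile_nonneg) auto
    ultimately show "norm (quantile M (Y n) u - 0) < e" using e by simp
  qed
qed

lemma quantile_mono:
  assumes [measurable]: "W \<in> borel_measurable M" "Y \<in> borel_measurable M"
    and "\<And>\<omega>. \<omega> \<in> space M \<Longrightarrow> Y \<omega> \<le> W \<omega>" and u: "0 < u" "u < 1"
  shows "quantile M Y u \<le> quantile M W u"
proof -
  have "u \<le> prob {\<omega>\<in>space M. W \<omega> \<le> quantile M W u}"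
    using quantile_le_iff[of W u "quantile M W u"] u by simp
  also have "\<dots> \<le> prob {\<omega>\<in>space M. Y \<omega> \<le> quantile M W u}"
    using assms(3) by (intro finite_measure_mono) (auto intro: order_trans)
  finally show ?thesis using quantile_le_iff[of Y u "quantile M W u"] u by simp
qed

text \<open>Order continuity of the norm. The supremum over \<open>U\<close> blocks dominated
  convergence on \<open>M\<close>; the quantile formula moves the question to the unit interval,
  where the quantile of \<open>norm (W)\<close> provides the integrable majorant.\<close>

lemma sigma_moment_tendsto_0:
  fixes Y :: "nat \<Rightarrow> 'w \<Rightarrow> 'x::real_normed_vector" and W :: "'w \<Rightarrow> 'y::real_normed_vector"
  assumes Y [measurable]: "\<And>n. (\<lambda>\<omega>. norm (Y n \<omega>)) \<in> borel_measurable M"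
    and W [measurable]: "(\<lambda>\<omega>. norm (W \<omega>)) \<in> borel_measurable M"
    and le: "\<And>n \<omega>. \<omega> \<in> space M \<Longrightarrow> norm (Y n \<omega>) \<le> norm (W \<omega>)"
    and fin: "sigma_moment M \<sigma> r W < \<top>"
    and lim: "\<And>\<omega>. \<omega> \<in> space M \<Longrightarrow> (\<lambda>n. Y n \<omega>) \<longlonglongrightarrow> 0" and r: "0 < r"
  shows "(\<lambda>n. sigma_moment M \<sigma> r (Y n)) \<longlonglongrightarrow> 0"
proof -
  let ?f = "\<lambda>n. quantile M (\<lambda>\<omega>. norm (Y n \<omega>))" and ?g = "quantile M (\<lambda>\<omega>. norm (W \<omega>))"
  note [measurable] = borel_measurable_quantile[OF Y] borel_measurable_quantile[OF W]
  have "(\<lambda>n. \<integral>\<^sup>+u. ennreal (\<sigma> u * ?f n u powr r) \<partial>unit_leb) \<longlonglongrightarrow> (\<integral>\<^sup>+u. 0 \<partial>unit_leb)"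
  proof (rule nn_integral_dominated_convergence[where w="\<lambda>u. ennreal (\<sigma> u * ?g u powr r)"])
    show "AE u in unit_leb. ennreal (\<sigma> u * ?f n u powr r) \<le> ennreal (\<sigma> u * ?g u powr r)" for n
      using r le by (intro AE_I2 ennreal_leI mult_left_mono powr_mono2 quantile_mono quantile_nonneg sigma_nonneg) auto
    show "(\<integral>\<^sup>+u. ennreal (\<sigma> u * ?g u powr r) \<partial>unit_leb) < \<infinity>"
      using fin sigma_moment_quantile[OF W, of r] r by simp
    show "AE u in unit_leb. (\<lambda>n. ennreal (\<sigma> u * ?f n u powr r)) \<longlonglongrightarrow> 0"
    proof (rule AE_I2)
      fix u assume u: "u \<in> space unit_leb"
      have "(\<lambda>n. ?f n u) \<longlonglongrightarrow> 0"
        using u lim by (intro quantile_tendsto_0) (auto intro: tendsto_norm_zero)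
      then have "(\<lambda>n. ?f n u powr r) \<longlonglongrightarrow> 0 powr r"
        using r u by (intro tendsto_powr2) (auto intro!: always_eventually quantile_nonneg)
      then have "(\<lambda>n. \<sigma> u * ?f n u powr r) \<longlonglongrightarrow> 0" using tendsto_mult_left[of _ 0 _ "\<sigma> u"] r by fastforce
      then show "(\<lambda>n. ennreal (\<sigma> u * ?f n u powr r)) \<longlonglongrightarrow> 0"
        using tendsto_ennrealI by fastforce
    qed
  qed measurable
  then show ?thesis using r by (simp add: sigma_moment_quantile[OF Y])
qed

end

subsection \<open>Level functions\<close>

lemma conjugate_exponents:
  fixes p q :: real
  assumes "1 < p" "1 / p + 1 / q = 1"
  shows "1 < q" "(p - 1) * q = p" "p / q = p - 1" "0 < q"
proof -
  have "1 / q = 1 - 1 / p" using assms by simp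
  then have q: "1 / q = (p - 1) / p" using assms by (simp add: field_simps)
  then have "q = p / (p - 1)" by (metis divide_divide_eq_right inverse_eq_divide inverse_inverse_eq mult_1)
  then show "(p - 1) * q = p" "p / q = p - 1" using assms by (auto simp: field_simps)
  have "0 < 1 / q" unfolding q using assms by simp
  then show "0 < q" by simp
  have "1 / q < 1" unfolding q using assms by simp
  then show "1 < q" using \<open>0 < q\<close> by (simp add: field_simps)
qed

text \<open>Convexity of the power \<open>p\<close>, with the tangent at \<open>x\<close>. It is
  Young's inequality for \<open>y\<close> and \<open>x powr (p - 1)\<close>, because
  \<open>(p - 1) * q = p\<close>.\<close>

lemma powr_tangent_le:
  fixes x y p q :: real
  assumes "1 < p" "1 / p + 1 / q = 1" "0 \<le> x" "0 \<le> y"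
  shows "x powr p - y powr p \<le> p * x powr (p - 1) * (x - y)"
proof -
  note q = conjugate_exponents[OF assms(1,2)]
  have "y * x powr (p - 1) \<le> y powr p / p + (x powr (p - 1)) powr q / q"
    using assms q by (intro Youngs_inequality) auto
  then have "p * (y * x powr (p - 1)) \<le> p * (y powr p / p + x powr p / q)"
    using assms q by (intro mult_left_mono) (auto simp: powr_powr)
  also have "\<dots> = y powr p + (p / q) * x powr p"
    using assms(1) by (simp add: distrib_left)
  also have "\<dots> = y powr p + (p - 1) * x powr p" by (simp only: q(3))
  finally have "p * (y * x powr (p - 1)) \<le> y powr p + (p - 1) * x powr p" .
  moreover have "x powr (p - 1) * x = x powr p"
    using assms by (cases "x = 0") (auto simp: powr_diff)
  ultimately show ?thesis by (simp add: algebra_simps)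
qed

text \<open>The dual of the cone of increasing functions in the weighted \<open>L\<^sup>p\<close>-space on the unit interval:
  a functional \<open>f\<close> of norm at most \<open>D\<close> on the cone is dominated there by an element \<open>h\<close> of the
  weighted \<open>L\<^sup>q\<close>-space of norm at most \<open>D\<close>.\<close>

locale level_problem =
  fixes f \<sigma> :: "real \<Rightarrow> real" and p q D :: real
  assumes f [measurable]: "f \<in> borel_measurable unit_leb" and f_nonneg: "u \<in> {0<..<1} \<Longrightarrow> 0 \<le> f u"
    and \<sigma> [measurable]: "\<sigma> \<in> borel_measurable unit_leb" and \<sigma>_nonneg: "u \<in> {0<..<1} \<Longrightarrow> 0 \<le> \<sigma> u"
    and p: "1 < p" and pq: "1 / p + 1 / q = 1" and D: "0 \<le> D"
    and \<sigma>_int: "(\<integral>\<^sup>+u. ennreal (\<sigma> u) \<partial>unit_leb) = 1"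
    and \<sigma>_tail: "u \<in> {0<..<1} \<Longrightarrow> 0 < (\<integral>\<^sup>+v. ennreal (\<sigma> v) * indicator {u<..} v \<partial>unit_leb)"
    and pairing: "mono_on {0<..<1} y \<Longrightarrow> (\<And>u. u \<in> {0<..<1} \<Longrightarrow> 0 \<le> y u) \<Longrightarrow> 0 \<le> b \<Longrightarrow>
      (\<integral>\<^sup>+u. ennreal (\<sigma> u * y u powr p) \<partial>unit_leb) \<le> ennreal (b powr p) \<Longrightarrow>
      (\<integral>\<^sup>+u. ennreal (f u * y u) \<partial>unit_leb) \<le> ennreal (D * b)"
begin

lemmas q = conjugate_exponents[OF p pq]

section \<open>The cone of increasing functions and the penalised functional\<close>

definition K :: "(real \<Rightarrow> real) set" where
  "K = {y. mono_on {0<..<1} y \<and> (\<forall>u\<in>{0<..<1}. 0 \<le> y u) \<and>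
    (\<integral>\<^sup>+u. ennreal (\<sigma> u * y u powr p) \<partial>unit_leb) < \<top>}"

definition A :: "(real \<Rightarrow> real) \<Rightarrow> real" where
  "A y = (\<integral>u. f u * y u \<partial>unit_leb)"

definition B :: "(real \<Rightarrow> real) \<Rightarrow> real" where
  "B y = (\<integral>u. \<sigma> u * y u powr p \<partial>unit_leb)"

text \<open>With the factor \<open>1/p\<close> the penalty absorbs exactly the power term of Young's
  inequality for \<open>D * B y powr (1 / p)\<close>, which leaves the upper bound
  \<open>D^q/q\<close>.\<close>

definition J :: "(real \<Rightarrow> real) \<Rightarrow> real" where
  "J y = A y - B y / p"

lemma K_mono: "y \<in> K \<Longrightarrow> mono_on {0<..<1} y"
  and K_nonneg: "y \<in> K \<Longrightarrow> u \<in> {0<..<1} \<Longrightarrow> 0 \<le> y u"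
  by (auto simp: K_def)

lemma K_meas: "y \<in> K \<Longrightarrow> y \<in> borel_measurable unit_leb"
  by (intro borel_measurable_unit_leb_mono_on K_mono)

lemma B_int: "y \<in> K \<Longrightarrow> integrable unit_leb (\<lambda>u. \<sigma> u * y u powr p)"
  using K_meas[of y] by (intro integrableI_nonneg) (auto simp: K_def \<sigma>_nonneg)

lemma B_nonneg: "0 \<le> B y"
  unfolding B_def by (intro integral_nonneg_AE AE_I2) (auto simp: \<sigma>_nonneg)

lemma B_eq: "y \<in> K \<Longrightarrow> (\<integral>\<^sup>+u. ennreal (\<sigma> u * y u powr p) \<partial>unit_leb) = ennreal (B y)"
  unfolding B_def by (intro nn_integral_eq_integral B_int) (auto simp: \<sigma>_nonneg)

lemma pairing_K: 
  assumes y: "y \<in> K"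
  shows "(\<integral>\<^sup>+u. ennreal (f u * y u) \<partial>unit_leb) \<le> ennreal (D * B y powr (1 / p))"
  using y p B_nonneg[of y] by (intro pairing) (auto simp: K_nonneg K_mono B_eq powr_powr)

lemma A_int: "y \<in> K \<Longrightarrow> integrable unit_leb (\<lambda>u. f u * y u)"
  using K_meas[of y] pairing_K[of y] 
  by (intro integrableI_nonneg) (auto simp: K_nonneg f_nonneg intro: le_less_trans)

lemma A_le: 
  assumes y: "y \<in> K"
  shows "A y \<le> D * B y powr (1 / p)"
proof -
  have "(\<integral>\<^sup>+u. ennreal (f u * y u) \<partial>unit_leb) = ennreal (A y)"
    unfolding A_def using y by (intro nn_integral_eq_integral A_int) (auto simp: f_nonneg K_nonneg)
  then show ?thesis using pairing_K[OF y] D by (simp add: ennreal_le_iff)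
qed

lemma K_I:
  assumes "mono_on {0<..<1} y" "\<And>u. u \<in> {0<..<1} \<Longrightarrow> 0 \<le> y u" "integrable unit_leb (\<lambda>u. \<sigma> u * y u powr p)"
  shows "y \<in> K"
proof -
  have "(\<integral>\<^sup>+u. ennreal (\<sigma> u * y u powr p) \<partial>unit_leb) = ennreal (B y)"
    unfolding B_def using assms by (intro nn_integral_eq_integral) (auto simp: \<sigma>_nonneg)
  then show ?thesis using assms by (auto simp: K_def)
qed

lemma K_dominated:
  assumes y: "mono_on {0<..<1} y" "\<And>u. u \<in> {0<..<1} \<Longrightarrow> 0 \<le> y u"
    and g: "integrable unit_leb g" and le: "\<And>u. u \<in> {0<..<1} \<Longrightarrow> \<sigma> u * y u powr p \<le> g u"
  shows "y \<in> K"
proof (rule K_I[OF y])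
  show "integrable unit_leb (\<lambda>u. \<sigma> u * y u powr p)"
  proof (rule Bochner_Integration.integrable_bound[OF g])
    show "(\<lambda>u. \<sigma> u * y u powr p) \<in> borel_measurable unit_leb"
      using borel_measurable_unit_leb_mono_on[OF y(1)] by measurable
    show "AE u in unit_leb. norm (\<sigma> u * y u powr p) \<le> norm (g u)"
      using le by (intro AE_I2) (force simp: \<sigma>_nonneg abs_mult)
  qed
qed auto

lemma \<sigma>_integrable: "integrable unit_leb \<sigma>"
  by (rule integrableI_nonneg) (auto simp: \<sigma>_int \<sigma>_nonneg)

lemma K_max: "y \<in> K \<Longrightarrow> z \<in> K \<Longrightarrow> (\<lambda>u. max (y u) (z u)) \<in> K"
  and K_min: "y \<in> K \<Longrightarrow> z \<in> K \<Longrightarrow> (\<lambda>u. min (y u) (z u)) \<in> K"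
proof -
  assume yz: "y \<in> K" "z \<in> K"
  have int: "integrable unit_leb (\<lambda>u. \<sigma> u * y u powr p + \<sigma> u * z u powr p)"
    by (intro Bochner_Integration.integrable_add B_int yz)
  have nn: "0 \<le> y u" "0 \<le> z u" "0 \<le> \<sigma> u" if "u \<in> {0<..<1}" for u
    using that yz by (auto simp: K_nonneg \<sigma>_nonneg)
  have m: "y u \<le> y v" "z u \<le> z v" if "u \<in> {0<..<1}" "v \<in> {0<..<1}" "u \<le> v" for u v
    using that yz[THEN K_mono] by (auto simp: mono_on_def)
  show "(\<lambda>u. max (y u) (z u)) \<in> K"
  proof (rule K_dominated[OF _ _ int])
    show "mono_on {0<..<1} (\<lambda>u. max (y u) (z u))" using m by (intro mono_onI max.mono) auto
  qed (use nn in \<open>auto simp: max_def\<close>)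
  show "(\<lambda>u. min (y u) (z u)) \<in> K"
  proof (rule K_dominated[OF _ _ int])
    show "mono_on {0<..<1} (\<lambda>u. min (y u) (z u))" using m by (intro mono_onI min.mono) auto
  qed (use nn in \<open>auto simp: min_def\<close>)
qed

text \<open>At each point, \<open>max\<close> and \<open>min\<close> permute the two values, so both
  integrals have the same sum over either pair.\<close>

lemma J_modular:
  assumes yz: "y \<in> K" "z \<in> K"
  shows "J (\<lambda>u. max (y u) (z u)) + J (\<lambda>u. min (y u) (z u)) = J y + J z"
proof -
  have "A (\<lambda>u. max (y u) (z u)) + A (\<lambda>u. min (y u) (z u)) = A y + A z"
    unfolding A_def
      Bochner_Integration.integral_add[OF A_int[OF K_max[OF yz]] A_int[OF K_min[OF yz]], symmetric]
      Bochner_Integration.integral_add[OF A_int[OF yz(1)] A_int[OF yz(2)], symmetric]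
    by (rule Bochner_Integration.integral_cong) (auto simp: max_def min_def)
  moreover have "B (\<lambda>u. max (y u) (z u)) + B (\<lambda>u. min (y u) (z u)) = B y + B z"
    unfolding B_def
      Bochner_Integration.integral_add[OF B_int[OF K_max[OF yz]] B_int[OF K_min[OF yz]], symmetric]
      Bochner_Integration.integral_add[OF B_int[OF yz(1)] B_int[OF yz(2)], symmetric]
    by (rule Bochner_Integration.integral_cong) (auto simp: max_def min_def)
  ultimately show ?thesis
    unfolding J_def by (smt (verit) add_divide_distrib)
qed

text \<open>A majorant \<open>g\<close> inside \<open>K\<close> dominates both integrals at once,
  because \<open>f * g\<close> and \<open>\<sigma> * g powr p\<close> are integrable for members of
  \<open>K\<close>.\<close>

lemma K_tendsto:
  assumes z: "\<And>n. z n \<in> K" and g: "g \<in> K" and le: "\<And>n u. u \<in> {0<..<1} \<Longrightarrow> z n u \<le> g u"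
    and lim: "\<And>u. u \<in> {0<..<1} \<Longrightarrow> (\<lambda>n. z n u) \<longlonglongrightarrow> y u"
  shows "y \<in> K" "(\<lambda>n. J (z n)) \<longlonglongrightarrow> J y"
proof -
  have y: "mono_on {0<..<1} y"
  proof (rule mono_onI)
    fix u v :: real assume uv: "u \<in> {0<..<1}" "v \<in> {0<..<1}" "u \<le> v"
    then have "z n u \<le> z n v" for n using K_mono[OF z] by (auto simp: mono_on_def)
    then show "y u \<le> y v" using LIMSEQ_le[OF lim[OF uv(1)] lim[OF uv(2)]] by auto
  qed
  have nn: "0 \<le> y u" if "u \<in> {0<..<1}" for u
    using K_nonneg[OF z that] by (intro LIMSEQ_le_const[OF lim[OF that]]) auto
  have yg: "y u \<le> g u" if "u \<in> {0<..<1}" for u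
    using le[OF that] by (intro LIMSEQ_le_const2[OF lim[OF that]]) auto
  show K: "y \<in> K"
    using y nn yg p by (intro K_dominated[OF _ _ B_int[OF g]] mult_left_mono powr_mono2 \<sigma>_nonneg) auto
  note [measurable] = K_meas[OF z] K_meas[OF K] K_meas[OF g]
  have "(\<lambda>n. A (z n)) \<longlonglongrightarrow> A y"
    unfolding A_def
  proof (rule integral_dominated_convergence[where w="\<lambda>u. f u * g u"])
    show "AE u in unit_leb. (\<lambda>n. f u * z n u) \<longlonglongrightarrow> f u * y u"
      using lim by (intro AE_I2 tendsto_intros) auto
    show "AE u in unit_leb. norm (f u * z n u) \<le> f u * g u" for n
      using le[of _ n] by (intro AE_I2) (auto simp: abs_mult f_nonneg K_nonneg[OF z] intro!: mult_left_mono)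
  qed (auto intro: A_int g)
  moreover have "(\<lambda>n. B (z n)) \<longlonglongrightarrow> B y"
    unfolding B_def
  proof (rule integral_dominated_convergence[where w="\<lambda>u. \<sigma> u * g u powr p"])
    show "AE u in unit_leb. (\<lambda>n. \<sigma> u * z n u powr p) \<longlonglongrightarrow> \<sigma> u * y u powr p"
      using lim p K_nonneg[OF z] by (intro AE_I2 tendsto_intros tendsto_powr2) auto
    show "AE u in unit_leb. norm (\<sigma> u * z n u powr p) \<le> \<sigma> u * g u powr p" for n
      using le[of _ n] p by (intro AE_I2) (auto simp: abs_mult \<sigma>_nonneg K_nonneg[OF z] intro!: mult_left_mono powr_mono2)
  qed (auto intro: B_int g)
  ultimately show "(\<lambda>n. J (z n)) \<longlonglongrightarrow> J y"
    unfolding J_def by (intro tendsto_intros) (use p in auto)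
qed

lemma J_le: 
  assumes y: "y \<in> K"
  shows "J y \<le> D powr q / q"
proof -
  have "D * B y powr (1 / p) \<le> D powr q / q + (B y powr (1 / p)) powr p / p"
    using p pq q D by (intro Youngs_inequality) auto
  then show ?thesis using A_le[OF y] p B_nonneg[of y] by (simp add: J_def powr_powr)
qed

text \<open>The factor \<open>2 powr (1 / p)\<close> is shifted onto \<open>D\<close> in Young's
  inequality, so that only half of the penalty is absorbed. The other half,
  \<open>B y / (2 * p)\<close>, is then bounded by the Young constant plus \<open>1\<close>, where
  the \<open>1\<close> comes from \<open>-1 \<le> J y\<close>.\<close>

definition \<beta> :: real where
  "\<beta> = 2 * p * ((2 powr (1 / p) * D) powr q / q + 1)"

lemma B_le: 
  assumes y: "y \<in> K" and J: "-1 \<le> J y"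
  shows "B y \<le> \<beta>"
proof -
  let ?c = "2 powr (1 / p)"
  have "(?c * D) * (B y powr (1 / p) / ?c) \<le> (?c * D) powr q / q + (B y powr (1 / p) / ?c) powr p / p"
    using p pq q D by (intro Youngs_inequality) auto
  also have "(B y powr (1 / p) / ?c) powr p = B y / 2"
    using p B_nonneg[of y] by (simp add: powr_divide powr_powr)
  finally have "D * B y powr (1 / p) \<le> (?c * D) powr q / q + B y / 2 / p" by simp
  then have "B y / p / 2 \<le> (?c * D) powr q / q + 1"
    using A_le[OF y] J by (simp add: J_def field_simps)
  then show ?thesis using p unfolding \<beta>_def by (simp add: field_simps)
qed

lemma \<beta>_nonneg: "0 \<le> \<beta>"
  unfolding \<beta>_def using p q by simp

text \<open>An increasing \<open>y\<close> is at least \<open>y u\<close> to the right of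
  \<open>u\<close>, so \<open>y u powr p\<close> times the mass of \<open>\<sigma>\<close> beyond
  \<open>u\<close> is at most \<open>B y\<close>; that mass is positive. This keeps the upper
  envelopes of a maximising sequence finite.\<close>

lemma K_pointwise_bound:
  assumes u: "u \<in> {0<..<1}"
  shows "\<exists>c. \<forall>y\<in>K. B y \<le> \<beta> \<longrightarrow> y u \<le> c"
proof -
  define S where "S = (\<integral>v. \<sigma> v * indicator {u<..} v \<partial>unit_leb)"
  have i: "integrable unit_leb (\<lambda>v. \<sigma> v * indicator {u<..} v)"
  proof (rule Bochner_Integration.integrable_bound[OF \<sigma>_integrable])
    have [measurable]: "indicator {u<..} \<in> borel_measurable unit_leb"
      by (rule borel_measurable_unit_leb_borel) simp
    show "(\<lambda>v. \<sigma> v * indicator {u<..} v) \<in> borel_measurable unit_leb" by measurable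
  qed (auto simp: indicator_def)
  have "ennreal S = (\<integral>\<^sup>+v. ennreal (\<sigma> v * indicator {u<..} v) \<partial>unit_leb)"
    unfolding S_def by (intro nn_integral_eq_integral[symmetric] i) (auto simp: \<sigma>_nonneg)
  also have "\<dots> = (\<integral>\<^sup>+v. ennreal (\<sigma> v) * indicator {u<..} v \<partial>unit_leb)"
    by (intro nn_integral_cong) (auto simp: indicator_def)
  finally have "0 < ennreal S" using \<sigma>_tail[OF u] by simp
  then have S: "0 < S" by (simp add: ennreal_less_zero_iff)
  have "y u \<le> (\<beta> / S) powr (1 / p)" if y: "y \<in> K" "B y \<le> \<beta>" for y
  proof -
    have "y u powr p * S = (\<integral>v. y u powr p * (\<sigma> v * indicator {u<..} v) \<partial>unit_leb)"
      by (simp add: S_def)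
    also have "\<dots> \<le> B y"
      unfolding B_def
    proof (rule integral_mono[OF _ B_int[OF y(1)]])
      fix v assume v: "v \<in> space unit_leb"
      show "y u powr p * (\<sigma> v * indicator {u<..} v) \<le> \<sigma> v * y v powr p"
        using u v mono_onD[OF K_mono[OF y(1)], of u v] p
        by (auto simp: indicator_def \<sigma>_nonneg K_nonneg[OF y(1)] mult.commute intro!: mult_left_mono powr_mono2)
    qed (use i in simp)
    finally have "y u powr p \<le> \<beta> / S" using y(2) S by (simp add: field_simps)
    then have "(y u powr p) powr (1 / p) \<le> (\<beta> / S) powr (1 / p)" using p by (intro powr_mono2) auto
    then show ?thesis using p K_nonneg[OF y(1) u] by (simp add: powr_powr)
  qed
  then show ?thesis by blast
qed

lemma zero_in_K: "(\<lambda>_. 0) \<in> K"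
  by (auto simp: K_def mono_on_def)

text \<open>A maximising sequence can be replaced by its upper envelopes, because \<^term>\<open>J\<close> is modular on
  the lattice \<^term>\<open>K\<close>: this makes it monotone, so that no weak compactness is needed.\<close>

lemma ex_maximizer: "\<exists>y\<in>K. \<forall>z\<in>K. J z \<le> J y"
proof -
  define s where "s = Sup (J ` K)"
  have bdd: "bdd_above (J ` K)" using J_le by (auto intro!: bdd_aboveI)
  have Js: "J z \<le> s" if "z \<in> K" for z
    unfolding s_def using that bdd by (intro cSup_upper) auto
  have s0: "0 \<le> s" using Js[OF zero_in_K] p by (simp add: J_def A_def B_def)
  \<comment> \<open>Geometric errors are summable: the total loss from index \<open>n\<close> on is
    at most \<open>(1/2) ^ n\<close>.\<close>
  have "\<exists>y\<in>K. s - (1/2) ^ Suc n < J y" for n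
  proof -
    have "s - (1/2) ^ Suc n < Sup (J ` K)" by (simp add: s_def)
    from less_cSupD[OF _ this] show ?thesis using zero_in_K by auto
  qed
  then obtain y where y: "\<And>n. y n \<in> K" "\<And>n. s - (1/2) ^ Suc n < J (y n)" by metis
  \<comment> \<open>\<open>w n m\<close> is the maximum of
    \<open>y n, ..., y (n + m)\<close>.\<close>
  define w where "w n = rec_nat (y n) (\<lambda>m z u. max (z u) (y (Suc (n + m)) u))" for n
  have w0: "w n 0 = y n" and wSuc: "w n (Suc m) = (\<lambda>u. max (w n m u) (y (Suc (n + m)) u))" for n m
    by (auto simp: w_def)
  have wK: "w n m \<in> K" for n m
    by (induction m) (auto simp: w0 wSuc y K_max)
  \<comment> \<open>Passing to the maximum with one more member loses at most the error of that
    member, because modularity leaves \<open>J\<close> of the minimum to subtract, and this is at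
    most \<open>s\<close>.\<close>
  have wJ: "s - ((1/2) ^ n - (1/2) ^ Suc (n + m)) \<le> J (w n m)" for n m
  proof (induction m)
    case 0
    then show ?case using y(2)[of n] by (simp add: w0)
  next
    case (Suc m)
    have "J (w n (Suc m)) = J (w n m) + J (y (Suc (n + m))) - J (\<lambda>u. min (w n m u) (y (Suc (n + m)) u))"
      using J_modular[OF wK[of n m] y(1)[of "Suc (n + m)"]] by (simp add: wSuc)
    also have "\<dots> \<ge> J (w n m) + J (y (Suc (n + m))) - s"
      using Js[OF K_min[OF wK[of n m] y(1)[of "Suc (n + m)"]]] by simp
    finally show ?case using Suc y(2)[of "Suc (n + m)"] by simp
  qed
  have pow1: "(1/2::real) ^ n \<le> 1" for n by (simp add: power_le_one)
  have wB: "B (w n m) \<le> \<beta>" for n m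
  proof (rule B_le[OF wK])
    \<comment> \<open>As \<open>s\<close> is nonnegative and the accumulated error is at most
      \<open>1\<close>, the threshold \<open>-1\<close> built into \<open>\<beta>\<close> is met by
      every envelope.\<close>
    have "0 \<le> (1/2::real) ^ Suc (n + m)" by simp
    then show "-1 \<le> J (w n m)" using wJ[of n m] pow1[of n] s0 by linarith
  qed
  have w_inc: "incseq (\<lambda>m. w n m u)" for n u
    by (auto simp: incseq_Suc_iff wSuc)
  define v where "v n u = (SUP m. w n m u)" for n u
  have w_bdd: "bdd_above (range (\<lambda>m. w n m u))" if u: "u \<in> {0<..<1}" for n u
  proof -
    obtain c where "\<forall>y\<in>K. B y \<le> \<beta> \<longrightarrow> y u \<le> c" using K_pointwise_bound[OF u] by blast
    then show ?thesis using wK wB by (intro bdd_aboveI[of _ c]) auto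
  qed
  have wv: "(\<lambda>m. w n m u) \<longlonglongrightarrow> v n u" if u: "u \<in> {0<..<1}" for n u
    unfolding v_def by (rule LIMSEQ_incseq_SUP[OF w_bdd[OF u] w_inc])
  have w_le_v: "w n m u \<le> v n u" if u: "u \<in> {0<..<1}" for n m u
    unfolding v_def by (rule cSUP_upper[OF _ w_bdd[OF u]]) simp
  have vK: "v n \<in> K" for n
  proof -
    have m: "mono_on {0<..<1} (v n)"
    proof (rule mono_onI)
      fix a b :: real assume ab: "a \<in> {0<..<1}" "b \<in> {0<..<1}" "a \<le> b"
      then have "w n m a \<le> w n m b" for m using K_mono[OF wK] by (auto simp: mono_on_def)
      then show "v n a \<le> v n b" using LIMSEQ_le[OF wv[OF ab(1)] wv[OF ab(2)]] by auto
    qed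
    have nn: "0 \<le> v n u" if "u \<in> {0<..<1}" for u
      using K_nonneg[OF wK that] w_le_v[OF that] order_trans by blast
    note [measurable] = K_meas[OF wK] borel_measurable_unit_leb_mono_on[OF m]
    have [measurable]: "indicator {0<..<1} \<in> borel_measurable unit_leb"
      by (rule borel_measurable_unit_leb_borel) simp
    \<comment> \<open>The indicator makes monotonicity and convergence hold at every real
      \<open>u\<close>; outside the interval nothing is known about \<open>\<sigma>\<close> or
      \<open>w\<close>.\<close>
    have "(\<lambda>m. \<integral>\<^sup>+u. ennreal (\<sigma> u * w n m u powr p) * indicator {0<..<1} u \<partial>unit_leb) \<longlonglongrightarrow>
        (\<integral>\<^sup>+u. ennreal (\<sigma> u * v n u powr p) * indicator {0<..<1} u \<partial>unit_leb)"
    proof (rule nn_integral_LIMSEQ)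
      show "incseq (\<lambda>m u. ennreal (\<sigma> u * w n m u powr p) * indicator {0<..<1} u)"
        using p by (intro monoI le_funI)
          (auto simp: indicator_def K_nonneg[OF wK] \<sigma>_nonneg intro!: ennreal_leI mult_left_mono powr_mono2 incseqD[OF w_inc])
      show "(\<lambda>m. ennreal (\<sigma> u * w n m u powr p) * indicator {0<..<1} u)
          \<longlonglongrightarrow> ennreal (\<sigma> u * v n u powr p) * indicator {0<..<1} u" for u
        using wv[of u n] p K_nonneg[OF wK]
        by (cases "u \<in> {0<..<1}") (auto intro!: tendsto_ennrealI tendsto_intros tendsto_powr2)
    qed measurable
    moreover have "(\<integral>\<^sup>+u. ennreal (\<sigma> u * z u powr p) * indicator {0<..<1} u \<partial>unit_leb) = (\<integral>\<^sup>+u. ennreal (\<sigma> u * z u powr p) \<partial>unit_leb)" for z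
      by (intro nn_integral_cong) auto
    ultimately have "(\<integral>\<^sup>+u. ennreal (\<sigma> u * v n u powr p) \<partial>unit_leb) \<le> ennreal \<beta>"
      using wB by (intro LIMSEQ_le_const2) (auto simp: B_eq[OF wK] intro!: ennreal_leI)
    then show ?thesis using m nn by (auto simp: K_def intro: le_less_trans)
  qed
  have vJ: "s - (1/2) ^ n \<le> J (v n)" for n
  proof (rule LIMSEQ_le_const)
    show "(\<lambda>m. J (w n m)) \<longlonglongrightarrow> J (v n)"
      by (rule K_tendsto(2)[OF wK vK w_le_v wv])
    have "0 \<le> (1/2::real) ^ Suc (n + m)" for m by simp
    then have "s - (1/2) ^ n \<le> J (w n m)" for m using wJ[of n m] by (smt (verit))
    then show "\<exists>N. \<forall>m\<ge>N. s - (1/2) ^ n \<le> J (w n m)" by auto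
  qed
  have w_shift: "w (Suc n) m u \<le> w n (Suc m) u" for n m u
    by (induction m) (auto simp: w0 wSuc max.coboundedI1)
  have v_dec: "decseq (\<lambda>n. v n u)" if u: "u \<in> {0<..<1}" for u
    unfolding decseq_Suc_iff
    using w_shift w_le_v[OF u] order_trans by (subst (1) v_def) (intro allI cSUP_least, auto, blast)
  \<comment> \<open>The upper limit of the maximising sequence: \<open>v n\<close> is the supremum
    of the members from \<open>n\<close> on and decreases with \<open>n\<close>, so
    \<open>v 0\<close> is a majorant.\<close>
  define x where "x u = (INF n. v n u)" for u
  have v_bdd: "bdd_below (range (\<lambda>n. v n u))" if u: "u \<in> {0<..<1}" for u
    using K_nonneg[OF vK u] by (auto intro!: bdd_belowI)
  have vx: "(\<lambda>n. v n u) \<longlonglongrightarrow> x u" if u: "u \<in> {0<..<1}" for u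
    unfolding x_def by (rule LIMSEQ_decseq_INF[OF v_bdd[OF u] v_dec[OF u]])
  have v_le: "v n u \<le> v 0 u" if "u \<in> {0<..<1}" for n u
    using decseqD[OF v_dec[OF that], of 0 n] by simp
  note x = K_tendsto[OF vK vK[of 0] v_le vx]
  have "s \<le> J x"
  proof (rule LIMSEQ_le[OF _ x(2)])
    have "(\<lambda>n. s - (1/2::real) ^ n) \<longlonglongrightarrow> s - 0"
      by (intro tendsto_intros LIMSEQ_realpow_zero) auto
    then show "(\<lambda>n. s - (1/2::real) ^ n) \<longlonglongrightarrow> s" by simp
  qed (use vJ in auto)
  then show ?thesis using x(1) Js order_trans by blast
qed

text \<open>First-order conditions at a maximiser \<open>y\<close> of \<^term>\<open>J\<close>: scaling \<open>y\<close> down gives \<open>B y \<le> A y\<close>, and adding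
  multiples of \<open>indicator {a<..}\<close> gives the tail inequalities for \<open>h = y powr (p - 1)\<close>.\<close>

lemma ex_level_function:
  "\<exists>h. mono_on {0<..<1} h \<and> (\<forall>u\<in>{0<..<1}. 0 \<le> h u) \<and>
    (\<integral>\<^sup>+u. ennreal (\<sigma> u * h u powr q) \<partial>unit_leb) \<le> ennreal (D powr q) \<and>
    (\<forall>a\<in>{0..<1}. (\<integral>\<^sup>+u. ennreal (f u) * indicator {a<..} u \<partial>unit_leb) \<le>
      (\<integral>\<^sup>+u. ennreal (\<sigma> u * h u) * indicator {a<..} u \<partial>unit_leb))"
proof -
  obtain y where yK: "y \<in> K" and max: "\<And>z. z \<in> K \<Longrightarrow> J z \<le> J y" using ex_maximizer by auto
  note y0 = K_nonneg[OF yK] and ym = mono_onD[OF K_mono[OF yK]]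
  note [measurable] = K_meas[OF yK]
  \<comment> \<open>Compare \<open>y\<close> with the competitor \<open>(1 - s) * y\<close>; the
    tangent inequality at \<open>1 - s\<close> turns the loss of penalty into a multiple of
    \<open>s\<close>, which cancels.\<close>
  have scale: "(1 - s) powr (p - 1) * B y \<le> A y" if s: "0 < s" "s < 1" for s
  proof -
    have eq: "\<sigma> u * ((1 - s) * y u) powr p = (1 - s) powr p * (\<sigma> u * y u powr p)" if "u \<in> space unit_leb" for u
      using that s y0[of u] by (simp add: powr_mult)
    have "integrable unit_leb (\<lambda>u. (1 - s) powr p * (\<sigma> u * y u powr p))"
      using B_int[OF yK] by simp
    then have "integrable unit_leb (\<lambda>u. \<sigma> u * ((1 - s) * y u) powr p)"
      by (subst Bochner_Integration.integrable_cong[OF refl eq])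
    then have "(\<lambda>u. (1 - s) * y u) \<in> K"
      using s y0 ym by (intro K_I mono_onI) (auto intro!: mult_left_mono)
    from max[OF this] have "J (\<lambda>u. (1 - s) * y u) \<le> J y" .
    moreover have "A (\<lambda>u. (1 - s) * y u) = (1 - s) * A y"
      unfolding A_def by (subst integral_mult_right_zero[symmetric]) (simp add: mult.left_commute)
    moreover have "B (\<lambda>u. (1 - s) * y u) = (1 - s) powr p * B y"
      unfolding B_def by (subst Bochner_Integration.integral_cong[OF refl eq]) auto
    ultimately have "(1 - (1 - s) powr p) * (B y / p) \<le> s * A y"
      by (simp add: J_def algebra_simps)
    moreover have "p * (1 - s) powr (p - 1) * s \<le> 1 - (1 - s) powr p"
      using powr_tangent_le[OF p pq, of "1 - s" 1] s by (simp add: algebra_simps)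
    then have "p * (1 - s) powr (p - 1) * s * (B y / p) \<le> (1 - (1 - s) powr p) * (B y / p)"
      using B_nonneg[of y] p by (intro mult_right_mono) auto
    ultimately have "s * ((1 - s) powr (p - 1) * B y) \<le> s * A y"
      using p by (simp add: mult_ac)
    then show ?thesis using s by simp
  qed
  have "B y \<le> A y"
  proof (rule LIMSEQ_le_const2)
    \<comment> \<open>The double \<open>Suc\<close> starts the sequence of scaling parameters at
      \<open>1/2\<close>, strictly below \<open>1\<close>.\<close>
    have "(\<lambda>n. (1 - inverse (real (Suc (Suc n)))) powr (p - 1) * B y) \<longlonglongrightarrow> (1 - 0) powr (p - 1) * B y"
      using LIMSEQ_Suc[OF LIMSEQ_inverse_real_of_nat] p by (intro tendsto_intros tendsto_powr2) (auto simp: field_simps)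
    then show "(\<lambda>n. (1 - inverse (real (Suc (Suc n)))) powr (p - 1) * B y) \<longlonglongrightarrow> B y" by simp
    show "\<exists>N. \<forall>n\<ge>N. (1 - inverse (real (Suc (Suc n)))) powr (p - 1) * B y \<le> A y"
      by (intro exI allI impI scale) (auto simp: field_simps)
  qed
  then have BD: "B y \<le> D * B y powr (1 / p)" using A_le[OF yK] by simp
  have By: "B y \<le> D powr q"
  proof (cases "B y = 0")
    case False
    then have pos: "0 < B y" using B_nonneg[of y] by simp
    \<comment> \<open>Dividing \<open>B y \<le> D * B y powr (1 / p)\<close> by the last power
      leaves \<open>B y powr (1 / q) \<le> D\<close>.\<close>
    have "1 / q = 1 - 1 / p" using pq by simp
    then have "B y powr (1 / q) = B y / B y powr (1 / p)"
      using pos by (simp only: powr_diff) simp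
    also have "\<dots> \<le> D" using BD pos by (simp add: field_simps)
    finally have "(B y powr (1 / q)) powr q \<le> D powr q" using q by (intro powr_mono2) auto
    then show ?thesis using q pos by (simp add: powr_powr)
  qed simp
  define h where "h u = y u powr (p - 1)" for u
  have hq: "h u powr q = y u powr p" for u unfolding h_def by (simp add: powr_powr q)
  have tail: "(\<integral>\<^sup>+u. ennreal (f u) * indicator {a<..} u \<partial>unit_leb) \<le>
      (\<integral>\<^sup>+u. ennreal (\<sigma> u * h u) * indicator {a<..} u \<partial>unit_leb)" if a: "a \<in> {0..<1}" for a
  proof -
    let ?i = "indicator {a<..} :: real \<Rightarrow> real"
    have [measurable]: "?i \<in> borel_measurable unit_leb" by (rule borel_measurable_unit_leb_borel) simp
    \<comment> \<open>Up to the factor \<open>p\<close>, the derivative of the penalty density in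
      the direction \<open>?i\<close> at the perturbed point. Taking the tangent there, and not at
      \<open>y\<close>, bounds the increment of \<open>B\<close> from above; afterwards
      \<open>s\<close> tends to \<open>0\<close>.\<close>
    define g where "g s u = \<sigma> u * (y u + s) powr (p - 1) * ?i u" for s u
    have [measurable]: "g s \<in> borel_measurable unit_leb" for s unfolding g_def by measurable
    have g0: "0 \<le> g s u" if "u \<in> {0<..<1}" for s u using that unfolding g_def by (auto simp: \<sigma>_nonneg)
    have i1: "(\<lambda>u. y u + s * ?i u) \<in> K" if s: "0 \<le> s" for s
    proof (rule K_dominated)
      show "mono_on {0<..<1} (\<lambda>u. y u + s * ?i u)"
        using s ym by (intro mono_onI add_mono mult_left_mono) (auto simp: indicator_def)
      show "integrable unit_leb (\<lambda>u. 2 powr p * (\<sigma> u * y u powr p) + (2 * s) powr p * \<sigma> u)"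
        using B_int[OF yK] \<sigma>_integrable by simp
      fix u :: real assume u: "u \<in> {0<..<1}"
      show "0 \<le> y u + s * ?i u" using y0[OF u] s by simp
      have "(y u + s * ?i u) powr p \<le> (2 * max (y u) s) powr p"
        using y0[OF u] s p by (intro powr_mono2) (auto simp: indicator_def)
      also have "\<dots> \<le> (2 * y u) powr p + (2 * s) powr p" by (auto simp: max_def)
      also have "\<dots> = 2 powr p * y u powr p + (2 * s) powr p" using y0[OF u] by (simp add: powr_mult)
      finally show "\<sigma> u * (y u + s * ?i u) powr p \<le> 2 powr p * (\<sigma> u * y u powr p) + (2 * s) powr p * \<sigma> u"
        using mult_left_mono[OF _ \<sigma>_nonneg[OF u]] by (fastforce simp: algebra_simps)
    qed
    \<comment> \<open>\<open>g 1\<close> is the majorant for all \<open>s\<close> in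
      \<open>[0,1]\<close>. It is integrable because \<open>y u + 1 \<ge> 1\<close> makes the power
      \<open>p - 1\<close> at most the power \<open>p\<close>.\<close>
    have gint: "integrable unit_leb (g 1)"
    proof (rule Bochner_Integration.integrable_bound)
      show "integrable unit_leb (\<lambda>u. \<sigma> u + \<sigma> u * (y u + 1 * ?i u) powr p)"
        using \<sigma>_integrable B_int[OF i1[of 1]] by simp
      show "AE u in unit_leb. norm (g 1 u) \<le> norm (\<sigma> u + \<sigma> u * (y u + 1 * ?i u) powr p)"
      proof (rule AE_I2)
        fix u assume u: "u \<in> space unit_leb"
        then have "1 \<le> y u + 1" using y0[of u] by simp
        then have "(y u + 1) powr (p - 1) \<le> (y u + 1) powr p" by (intro powr_mono) auto
        then have "\<sigma> u * (y u + 1) powr (p - 1) \<le> \<sigma> u * (y u + 1) powr p"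
          using u \<sigma>_nonneg[of u] by (intro mult_left_mono) auto
        then show "norm (g 1 u) \<le> norm (\<sigma> u + \<sigma> u * (y u + 1 * ?i u) powr p)"
          using u \<sigma>_nonneg[of u] g0[of u 1] by (auto simp: g_def indicator_def)
      qed
    qed simp
    have gint': "integrable unit_leb (g s)" if s: "0 \<le> s" "s \<le> 1" for s
      using s p y0 by (intro Bochner_Integration.integrable_bound[OF gint] AE_I2)
        (auto simp: g_def abs_mult \<sigma>_nonneg indicator_def intro!: mult_left_mono powr_mono2)
    have fi: "integrable unit_leb (\<lambda>u. f u * ?i u)"
    proof -
      have "(\<lambda>u. 0 + 1 * ?i u) \<in> K"
      proof (rule K_dominated)
        show "mono_on {0<..<1} (\<lambda>u. 0 + 1 * ?i u)" by (intro mono_onI) (auto simp: indicator_def)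
      qed (use \<sigma>_integrable in \<open>auto simp: indicator_def \<sigma>_nonneg\<close>)
      from A_int[OF this] show ?thesis by simp
    qed
    have le_s: "(\<integral>u. f u * ?i u \<partial>unit_leb) \<le> (\<integral>u. g s u \<partial>unit_leb)" if s: "0 < s" "s \<le> 1" for s
    proof -
      have zK: "(\<lambda>u. y u + s * ?i u) \<in> K" using i1 s by simp
      have "A (\<lambda>u. y u + s * ?i u) = A y + s * (\<integral>u. f u * ?i u \<partial>unit_leb)"
      proof -
        have "A (\<lambda>u. y u + s * ?i u) = (\<integral>u. f u * y u + s * (f u * ?i u) \<partial>unit_leb)"
          unfolding A_def by (simp add: algebra_simps)
        also have "\<dots> = A y + s * (\<integral>u. f u * ?i u \<partial>unit_leb)"
          using fi A_int[OF yK] unfolding A_def by (subst Bochner_Integration.integral_add) auto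
        finally show ?thesis .
      qed
      moreover have eB: "B (\<lambda>u. y u + s * ?i u) - B y \<le> p * s * (\<integral>u. g s u \<partial>unit_leb)"
      proof -
        have "B (\<lambda>u. y u + s * ?i u) - B y = (\<integral>u. \<sigma> u * (y u + s * ?i u) powr p - \<sigma> u * y u powr p \<partial>unit_leb)"
          unfolding B_def by (rule Bochner_Integration.integral_diff[symmetric]) (intro B_int zK yK)+
        also have "\<dots> \<le> (\<integral>u. p * s * g s u \<partial>unit_leb)"
        proof (rule integral_mono)
          show "integrable unit_leb (\<lambda>u. \<sigma> u * (y u + s * ?i u) powr p - \<sigma> u * y u powr p)"
            by (intro Bochner_Integration.integrable_diff B_int zK yK)
          show "integrable unit_leb (\<lambda>u. p * s * g s u)" using gint'[of s] s by simp
          fix u assume u: "u \<in> space unit_leb"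
          have "(y u + s) powr p - y u powr p \<le> p * (y u + s) powr (p - 1) * s"
            using powr_tangent_le[OF p pq, of "y u + s" "y u"] u s y0[of u] by simp
          from mult_left_mono[OF this, of "\<sigma> u"]
          show "\<sigma> u * (y u + s * ?i u) powr p - \<sigma> u * y u powr p \<le> p * s * g s u"
            using u \<sigma>_nonneg[of u] by (auto simp: g_def indicator_def algebra_simps)
        qed
        finally show ?thesis by simp
      qed
      moreover have "J (\<lambda>u. y u + s * ?i u) \<le> J y" by (rule max[OF zK])
      ultimately have "s * (\<integral>u. f u * ?i u \<partial>unit_leb) \<le> (B (\<lambda>u. y u + s * ?i u) - B y) / p"
        by (simp add: J_def diff_divide_distrib)
      moreover have "(B (\<lambda>u. y u + s * ?i u) - B y) / p \<le> s * (\<integral>u. g s u \<partial>unit_leb)"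
        using p eB by (simp add: pos_divide_le_eq mult_ac)
      ultimately have "s * (\<integral>u. f u * ?i u \<partial>unit_leb) \<le> s * (\<integral>u. g s u \<partial>unit_leb)" by linarith
      then show ?thesis using p s by simp
    qed
    have "(\<integral>u. f u * ?i u \<partial>unit_leb) \<le> (\<integral>u. g 0 u \<partial>unit_leb)"
    proof (rule LIMSEQ_le_const)
      show "(\<lambda>n. \<integral>u. g (inverse (real (Suc n))) u \<partial>unit_leb) \<longlonglongrightarrow> (\<integral>u. g 0 u \<partial>unit_leb)"
      proof (rule integral_dominated_convergence[OF _ _ gint])
        show "AE u in unit_leb. (\<lambda>n. g (inverse (real (Suc n))) u) \<longlonglongrightarrow> g 0 u"
          unfolding g_def using p y0
          by (intro AE_I2 tendsto_intros tendsto_powr2 LIMSEQ_inverse_real_of_nat) auto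
        show "AE u in unit_leb. norm (g (inverse (real (Suc n))) u) \<le> g 1 u" for n
          using p y0 by (intro AE_I2)
            (auto simp: g_def abs_mult \<sigma>_nonneg indicator_def field_simps intro!: mult_left_mono powr_mono2)
      qed auto
      show "\<exists>N. \<forall>n\<ge>N. (\<integral>u. f u * ?i u \<partial>unit_leb) \<le> (\<integral>u. g (inverse (real (Suc n))) u \<partial>unit_leb)"
        by (intro exI allI impI le_s) (auto simp: field_simps)
    qed
    then have "ennreal (\<integral>u. f u * ?i u \<partial>unit_leb) \<le> ennreal (\<integral>u. g 0 u \<partial>unit_leb)" by (rule ennreal_leI)
    also have "ennreal (\<integral>u. f u * ?i u \<partial>unit_leb) = (\<integral>\<^sup>+u. ennreal (f u * ?i u) \<partial>unit_leb)"
      by (intro nn_integral_eq_integral[symmetric] fi) (auto simp: f_nonneg)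
    also have "\<dots> = (\<integral>\<^sup>+u. ennreal (f u) * indicator {a<..} u \<partial>unit_leb)"
      by (intro nn_integral_cong) (auto simp: indicator_def)
    also have "ennreal (\<integral>u. g 0 u \<partial>unit_leb) = (\<integral>\<^sup>+u. ennreal (g 0 u) \<partial>unit_leb)"
      by (intro nn_integral_eq_integral[symmetric] gint') (auto simp: g0)
    also have "\<dots> = (\<integral>\<^sup>+u. ennreal (\<sigma> u * h u) * indicator {a<..} u \<partial>unit_leb)"
      by (intro nn_integral_cong) (auto simp: indicator_def g_def h_def)
    finally show ?thesis .
  qed
  show ?thesis
  proof (intro exI[of _ h] conjI ballI tail)
    show "mono_on {0<..<1} h" unfolding h_def using ym y0 p by (intro mono_onI powr_mono2) auto
    show "(\<integral>\<^sup>+u. ennreal (\<sigma> u * h u powr q) \<partial>unit_leb) \<le> ennreal (D powr q)"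
      unfolding hq using By by (simp add: B_eq[OF yK] ennreal_leI)
  qed (auto simp: h_def)
qed

end

subsection \<open>Duality of the scalar spaces\<close>

text \<open>Hoelder's inequality for the weight \<open>s\<close>, stated with upper bounds
  \<open>A\<close> and \<open>B\<close>. For positive bounds it is Young's inequality for
  \<open>a / C\<close> and \<open>b / E\<close>, integrated; bounds equal to \<open>0\<close> are
  reached by letting positive ones decrease.\<close>

lemma nn_integral_Hoelder_le:
  fixes s a b :: "'a \<Rightarrow> real"
  assumes [measurable]: "s \<in> borel_measurable M" "a \<in> borel_measurable M" "b \<in> borel_measurable M"
    and nn: "AE x in M. 0 \<le> s x" "AE x in M. 0 \<le> a x" "AE x in M. 0 \<le> b x"
    and p: "1 < p" "1 / p + 1 / q = 1" and AB: "0 \<le> A" "0 \<le> B"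
    and A: "(\<integral>\<^sup>+x. ennreal (s x * a x powr q) \<partial>M) \<le> ennreal (A powr q)"
    and B: "(\<integral>\<^sup>+x. ennreal (s x * b x powr p) \<partial>M) \<le> ennreal (B powr p)"
  shows "(\<integral>\<^sup>+x. ennreal (s x * a x * b x) \<partial>M) \<le> ennreal (A * B)"
proof -
  note q = conjugate_exponents[OF p]
  have pos: "(\<integral>\<^sup>+x. ennreal (s x * a x * b x) \<partial>M) \<le> ennreal (C * E)"
    if C: "A \<le> C" "0 < C" and E: "B \<le> E" "0 < E" for C E
  proof -
    let ?c = "C * E / (q * C powr q)" and ?d = "C * E / (p * E powr p)"
    have cd: "0 \<le> ?c" "0 \<le> ?d" using that p q by auto
    have "(\<integral>\<^sup>+x. ennreal (s x * a x * b x) \<partial>M) \<le>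
      (\<integral>\<^sup>+x. ennreal ?c * ennreal (s x * a x powr q) + ennreal ?d * ennreal (s x * b x powr p) \<partial>M)"
    proof (rule nn_integral_mono_AE)
      show "AE x in M. ennreal (s x * a x * b x) \<le>
          ennreal ?c * ennreal (s x * a x powr q) + ennreal ?d * ennreal (s x * b x powr p)"
        using nn
      proof eventually_elim
        case (elim x)
        have "(a x / C) * (b x / E) \<le> (a x / C) powr q / q + (b x / E) powr p / p"
          using p q that elim by (intro Youngs_inequality) auto
        then have "(C * E * s x) * ((a x / C) * (b x / E)) \<le> (C * E * s x) * ((a x / C) powr q / q + (b x / E) powr p / p)"
          using that elim by (intro mult_left_mono) auto
        then have "s x * a x * b x \<le> ?c * (s x * a x powr q) + ?d * (s x * b x powr p)"
          using that elim by (simp add: powr_divide field_simps)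
        then have "ennreal (s x * a x * b x) \<le> ennreal (?c * (s x * a x powr q) + ?d * (s x * b x powr p))"
          by (rule ennreal_leI)
        also have "\<dots> = ennreal (?c * (s x * a x powr q)) + ennreal (?d * (s x * b x powr p))"
          using cd elim by (intro ennreal_plus mult_nonneg_nonneg) auto
        also have "\<dots> = ennreal ?c * ennreal (s x * a x powr q) + ennreal ?d * ennreal (s x * b x powr p)"
          using ennreal_mult'[OF cd(1)] ennreal_mult'[OF cd(2)] by simp
        finally show ?case .
      qed
    qed
    also have "\<dots> = ennreal ?c * (\<integral>\<^sup>+x. ennreal (s x * a x powr q) \<partial>M) + ennreal ?d * (\<integral>\<^sup>+x. ennreal (s x * b x powr p) \<partial>M)"
      by (simp add: nn_integral_add nn_integral_cmult)
    also have "\<dots> \<le> ennreal ?c * ennreal (C powr q) + ennreal ?d * ennreal (E powr p)"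
    proof (intro add_mono mult_left_mono)
      have "A powr q \<le> C powr q" using AB that q by (intro powr_mono2) auto
      then show "(\<integral>\<^sup>+x. ennreal (s x * a x powr q) \<partial>M) \<le> ennreal (C powr q)"
        using A by (meson ennreal_leI order_trans)
      have "B powr p \<le> E powr p" using AB that p by (intro powr_mono2) auto
      then show "(\<integral>\<^sup>+x. ennreal (s x * b x powr p) \<partial>M) \<le> ennreal (E powr p)"
        using B by (meson ennreal_leI order_trans)
    qed auto
    also have "\<dots> = ennreal (?c * C powr q) + ennreal (?d * E powr p)"
      by (simp only: ennreal_mult'[OF cd(1)] ennreal_mult'[OF cd(2)])
    also have "\<dots> = ennreal (?c * C powr q + ?d * E powr p)"
      using cd by (intro ennreal_plus[symmetric] mult_nonneg_nonneg) auto
    also have "?c * C powr q + ?d * E powr p = C * E * (1 / p + 1 / q)"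
      using that p q by (simp add: field_simps)
    finally show ?thesis by (simp only: p mult_1_right)
  qed
  have "(\<lambda>n. ennreal ((A + inverse (real (Suc n))) * (B + inverse (real (Suc n))))) \<longlonglongrightarrow> ennreal ((A + 0) * (B + 0))"
    by (intro tendsto_ennrealI tendsto_intros LIMSEQ_inverse_real_of_nat)
  then have lim: "(\<lambda>n. ennreal ((A + inverse (real (Suc n))) * (B + inverse (real (Suc n))))) \<longlonglongrightarrow> ennreal (A * B)"
    by simp
  show ?thesis
    by (rule LIMSEQ_le_const[OF lim]) (use AB in \<open>auto intro!: pos exI[of _ 0] add_nonneg_pos\<close>)
qed

lemma quantile_tail_unit_leb:
  assumes "0 \<le> a"
  shows "quantile_tail M W a = (\<integral>\<^sup>+u. ennreal (quantile M W u) * indicator {a<..} u \<partial>unit_leb)"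
  unfolding quantile_tail_def nn_integral_unit_leb using assms
  by (intro nn_integral_cong) (auto simp: indicator_def)

lemma avar_le_iff:
  assumes "a < 1"
  shows "avar M a W \<le> avar N a W' \<longleftrightarrow> quantile_tail M W a \<le> quantile_tail N W' a"
proof -
  have "ennreal (1 / (1 - a)) \<noteq> 0" "ennreal (1 / (1 - a)) \<noteq> \<top>" using assms by auto
  then show ?thesis
    unfolding avar_def by (rule ennreal_mult_le_mult_iff)
qed

context distortion_space
begin

text \<open>Bathtub principle for \<open>W\<close> written as its quantile along some
  \<open>V'\<close>: the event \<open>{a < V}\<close> has probability \<open>1 - a\<close>, and no
  event of that probability carries more than the upper quantile tail.\<close>

lemma nn_integral_tail_le_quantile_tail:
  assumes V: "V \<in> uniform_rvs M" and W: "W \<in> borel_measurable M" and a: "0 \<le> a" "a < 1"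
  shows "(\<integral>\<^sup>+\<omega>. ennreal (W \<omega>) * indicator {a<..} (V \<omega>) \<partial>M) \<le> quantile_tail M W a"
proof -
  obtain V' where V': "V' \<in> uniform_rvs M" "AE \<omega> in M. W \<omega> = quantile M W (V' \<omega>)"
    using ex_uniform_quantile[OF ex_uniform W] by auto
  note [measurable] = uniform_rvsD(1)[OF V]
  define A where "A = {\<omega>\<in>space M. a < V \<omega>}"
  have [measurable]: "A \<in> sets M" unfolding A_def by measurable
  have pA: "1 - prob A = a"
    using emeasure_uniform_greaterThan[OF V, of a] a by (simp add: A_def emeasure_eq_measure)
  have "(\<integral>\<^sup>+\<omega>. ennreal (W \<omega>) * indicator {a<..} (V \<omega>) \<partial>M) = (\<integral>\<^sup>+\<omega>. ennreal (quantile M W (V' \<omega>)) * indicator A \<omega> \<partial>M)"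
  proof (rule nn_integral_cong_AE)
    show "AE \<omega> in M. ennreal (W \<omega>) * indicator {a<..} (V \<omega>) = ennreal (quantile M W (V' \<omega>)) * indicator A \<omega>"
      using V'(2) AE_space by eventually_elim (auto simp: A_def indicator_def)
  qed
  also have "\<dots> \<le> (\<integral>\<^sup>+u. ennreal (quantile M W u) * indicator {1 - prob A<..} u \<partial>unit_leb)"
    by (rule nn_integral_uniform_set_le[OF V'(1) _ mono_on_quantile[OF W]]) measurable
  finally show ?thesis unfolding pA quantile_tail_unit_leb[OF a(1)] .
qed

lemma sigma_tail_eq:
  assumes "0 \<le> a"
  shows "(\<integral>\<^sup>+u\<in>{a..<1}. ennreal (\<sigma> u) \<partial>lborel) = (\<integral>\<^sup>+u. ennreal (\<sigma> u) * indicator {a<..} u \<partial>unit_leb)"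
  unfolding nn_integral_unit_leb
proof (rule nn_integral_cong_AE)
  show "AE u in lborel. ennreal (\<sigma> u) * indicator {a..<1} u = ennreal (\<sigma> u) * indicator {a<..} u * indicator {0<..<1} u"
    using AE_lborel_singleton[of a] by eventually_elim (use assms in \<open>auto simp: indicator_def\<close>)
qed

lemma sigma_tail_less_top: "(\<integral>\<^sup>+u. ennreal (\<sigma> u) * indicator {a<..} u \<partial>unit_leb) < \<top>"
proof -
  have "(\<integral>\<^sup>+u. ennreal (\<sigma> u) * indicator {a<..} u \<partial>unit_leb) \<le> (\<integral>\<^sup>+u. ennreal (\<sigma> u) \<partial>unit_leb)"
    by (intro nn_integral_mono) (auto simp: indicator_def)
  then show ?thesis unfolding nn_integral_sigma by (simp add: order_le_less_trans)
qed

text \<open>If \<open>\<sigma>\<close> vanished almost everywhere above \<open>a\<close>,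
  monotonicity would make it vanish on the whole open interval, against total mass
  \<open>1\<close>.\<close>

lemma sigma_tail_pos:
  assumes a: "0 \<le> a" "a < 1"
  shows "0 < (\<integral>\<^sup>+u. ennreal (\<sigma> u) * indicator {a<..} u \<partial>unit_leb)"
proof (rule ccontr)
  have [measurable]: "indicator {a<..} \<in> borel_measurable unit_leb" for a :: real
    by (rule borel_measurable_unit_leb_borel) simp
  assume "\<not> ?thesis"
  then have "(\<integral>\<^sup>+u. ennreal (\<sigma> u) * indicator {a<..} u \<partial>unit_leb) = 0" by simp
  then have AE0: "AE u in unit_leb. ennreal (\<sigma> u) * indicator {a<..} u = 0"
    by (subst (asm) nn_integral_0_iff_AE) measurable
  have zero: "\<sigma> v = 0" if v: "v \<in> {0<..<1}" for v
  proof (rule ccontr)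
    assume "\<sigma> v \<noteq> 0"
    then have pos: "0 < \<sigma> v" using sigma_nonneg[of v] v by auto
    have "AE u in unit_leb. indicator {max a v<..} u = (0::ennreal)"
      using AE0 AE_space
    proof eventually_elim
      case (elim u)
      show ?case
      proof (cases "max a v < u")
        case True
        then have "\<sigma> v \<le> \<sigma> u" using elim v by (intro mono_onD[OF sigma_mono]) auto
        then show ?thesis using elim(1) True pos by (auto simp: indicator_def)
      qed (simp add: indicator_def)
    qed
    then have "(\<integral>\<^sup>+u. indicator {max a v<..} u \<partial>unit_leb) = 0"
      by (subst nn_integral_0_iff_AE) measurable
    then show False using emeasure_unit_leb_tail[of "max a v"] a v by (auto simp: max_def split: if_splits)
  qed
  have "(\<integral>\<^sup>+u. ennreal (\<sigma> u) \<partial>unit_leb) = (\<integral>\<^sup>+u. 0 \<partial>unit_leb)"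
    by (intro nn_integral_cong) (auto simp: zero)
  then show False using nn_integral_sigma by simp
qed

text \<open>States that the associate (Koethe dual) norm of \<open>W\<close> is at most
  \<open>D\<close>. The free bound \<open>b\<close> stands for the norm of \<open>Y\<close>. Signed
  products do no harm: \<open>ennreal\<close> truncates them, and replacing \<open>Y\<close> by its
  absolute value keeps the moment.\<close>

definition paired :: "real \<Rightarrow> ('w \<Rightarrow> real) \<Rightarrow> real \<Rightarrow> bool" where
  "paired p W D \<longleftrightarrow> (\<forall>(Y::'w \<Rightarrow> real) b. Y \<in> borel_measurable M \<longrightarrow> 0 \<le> b \<longrightarrow>
     sigma_moment M \<sigma> p Y \<le> ennreal (b powr p) \<longrightarrow> (\<integral>\<^sup>+\<omega>. ennreal (W \<omega> * Y \<omega>) \<partial>M) \<le> ennreal (D * b))"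

text \<open>Only comonotone \<^term>\<open>Y\<close> matter, because \<^term>\<open>sigma_moment\<close> depends on the distribution only.\<close>

lemma pairedI_comonotone:
  fixes W :: "'w \<Rightarrow> real"
  assumes W [measurable]: "W \<in> borel_measurable M" and p: "0 \<le> p" and W0: "\<And>\<omega>. \<omega> \<in> space M \<Longrightarrow> 0 \<le> W \<omega>"
    and *: "\<And>V y b. V \<in> uniform_rvs M \<Longrightarrow> mono_on {0<..<1} y \<Longrightarrow> (\<And>u. u \<in> {0<..<1} \<Longrightarrow> 0 \<le> y u) \<Longrightarrow> 0 \<le> b \<Longrightarrow>
      (\<integral>\<^sup>+u. ennreal (\<sigma> u * y u powr p) \<partial>unit_leb) \<le> ennreal (b powr p) \<Longrightarrow>
      (\<integral>\<^sup>+\<omega>. ennreal (W \<omega>) * ennreal (y (V \<omega>)) \<partial>M) \<le> ennreal (D * b)"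
  shows "paired p W D"
  unfolding paired_def
proof (intro allI impI)
  fix Y :: "'w \<Rightarrow> real" and b :: real
  assume Y [measurable]: "Y \<in> borel_measurable M" and b: "0 \<le> b"
    and mom: "sigma_moment M \<sigma> p Y \<le> ennreal (b powr p)"
  let ?Y = "\<lambda>\<omega>. norm (Y \<omega>)"
  have Ym: "?Y \<in> borel_measurable M" by measurable
  obtain V where V: "V \<in> uniform_rvs M" "AE \<omega> in M. ?Y \<omega> = quantile M ?Y (V \<omega>)"
    using ex_uniform_quantile[OF ex_uniform Ym] by auto
  have "(\<integral>\<^sup>+\<omega>. ennreal (W \<omega> * Y \<omega>) \<partial>M) \<le> (\<integral>\<^sup>+\<omega>. ennreal (W \<omega>) * ennreal (quantile M ?Y (V \<omega>)) \<partial>M)"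
  proof (rule nn_integral_mono_AE)
    show "AE \<omega> in M. ennreal (W \<omega> * Y \<omega>) \<le> ennreal (W \<omega>) * ennreal (quantile M ?Y (V \<omega>))"
      using V(2) AE_space
    proof eventually_elim
      case (elim \<omega>)
      have "ennreal (W \<omega> * Y \<omega>) \<le> ennreal (W \<omega> * norm (Y \<omega>))"
        using W0[OF elim(2)] by (intro ennreal_leI mult_left_mono) auto
      then show ?case using W0[OF elim(2)] elim(1) by (simp add: ennreal_mult)
    qed
  qed
  also have "\<dots> \<le> ennreal (D * b)"
    using mom b by (intro * V(1) mono_on_quantile quantile_nonneg Ym)
      (auto simp: sigma_moment_quantile[OF Ym p])
  finally show "(\<integral>\<^sup>+\<omega>. ennreal (W \<omega> * Y \<omega>) \<partial>M) \<le> ennreal (D * b)" .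
qed

text \<open>\<open>y\<close> composed with the \<open>V\<close> that represents \<open>W\<close> is
  an admissible test function. Both factors then depend on \<open>V\<close> alone, and the pairing
  descends to the unit interval.\<close>

lemma paired_comonotone:
  fixes W :: "'w \<Rightarrow> real"
  assumes paired: "paired p W D" and W0: "\<And>\<omega>. \<omega> \<in> space M \<Longrightarrow> 0 \<le> W \<omega>"
    and V: "V \<in> uniform_rvs M" "AE \<omega> in M. W \<omega> = quantile M W (V \<omega>)" and W: "W \<in> borel_measurable M"
    and y: "mono_on {0<..<1} y" "\<And>u. u \<in> {0<..<1} \<Longrightarrow> 0 \<le> y u" and b: "0 \<le> b" and p: "0 \<le> p"
    and mom: "(\<integral>\<^sup>+u. ennreal (\<sigma> u * y u powr p) \<partial>unit_leb) \<le> ennreal (b powr p)"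
  shows "(\<integral>\<^sup>+u. ennreal (quantile M W u * y u) \<partial>unit_leb) \<le> ennreal (D * b)"
proof -
  note [measurable] = borel_measurable_unit_leb_mono_on[OF y(1)] borel_measurable_quantile[OF W]
  have AEy: "AE \<omega> in M. norm (y (V \<omega>)) = y (V \<omega>)"
    using AE_uniform_unit[OF V(1)] by eventually_elim (use y in auto)
  have "sigma_moment M \<sigma> p (\<lambda>\<omega>. y (V \<omega>)) \<le> ennreal (b powr p)"
    using sigma_moment_comonotone[OF V(1) y(1) _ AEy p] y(2) mom by simp
  moreover have "(\<lambda>\<omega>. y (V \<omega>)) \<in> borel_measurable M" by (rule measurable_uniform_comp[OF V(1)]) measurable
  ultimately have "(\<integral>\<^sup>+\<omega>. ennreal (W \<omega> * y (V \<omega>)) \<partial>M) \<le> ennreal (D * b)"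
    using paired b by (auto simp: paired_def)
  also have "(\<integral>\<^sup>+\<omega>. ennreal (W \<omega> * y (V \<omega>)) \<partial>M) = (\<integral>\<^sup>+\<omega>. ennreal (quantile M W (V \<omega>) * y (V \<omega>)) \<partial>M)"
    using V(2) by (intro nn_integral_cong_AE) (auto elim!: eventually_mono)
  also have "\<dots> = (\<integral>\<^sup>+u. ennreal (quantile M W u * y u) \<partial>unit_leb)"
    by (rule nn_integral_uniform[OF V(1)]) measurable
  finally show ?thesis .
qed

text \<open>The norm bounds the quantile tails of \<open>Z\<close> by \<open>D\<close> times those
  of \<open>\<sigma>\<close>. The layer-cake comparison extends this from tails to all increasing
  \<open>y\<close>; conversely each tail is recovered by testing with
  \<open>indicator {a<..}\<close>.\<close>

lemma star_norm_top_le_iff: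
  fixes Z :: "'w \<Rightarrow> 'k::real_or_complex"
  assumes Z: "Z \<in> borel_measurable M" and D: "0 \<le> D"
  shows "star_norm M \<sigma> \<top> Z \<le> ennreal D \<longleftrightarrow> paired 1 (\<lambda>\<omega>. norm (Z \<omega>)) D"
proof
  let ?W = "\<lambda>\<omega>. norm (Z \<omega>)"
  have W [measurable]: "?W \<in> borel_measurable M" using Z by measurable
  let ?S = "\<lambda>a. \<integral>\<^sup>+u. ennreal (\<sigma> u) * indicator {a<..} u \<partial>unit_leb"
  have "star_norm M \<sigma> \<top> Z \<le> ennreal D \<longleftrightarrow> (\<forall>a\<in>{0..<1}. quantile_tail M ?W a / ?S a \<le> ennreal D)"
    by (simp add: star_norm_def SUP_le_iff sigma_tail_eq)
  also have "\<dots> \<longleftrightarrow> (\<forall>a\<in>{0..<1}. quantile_tail M ?W a \<le> ennreal D * ?S a)"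
  proof (intro ball_cong refl)
    fix a :: real assume "a \<in> {0..<1}"
    then have S: "0 < ?S a" "?S a < \<top>" using sigma_tail_pos[of a] sigma_tail_less_top[of a] by simp_all
    show "quantile_tail M ?W a / ?S a \<le> ennreal D \<longleftrightarrow> quantile_tail M ?W a \<le> ennreal D * ?S a"
    proof
      assume "quantile_tail M ?W a / ?S a \<le> ennreal D"
      then have "quantile_tail M ?W a / ?S a * ?S a \<le> ennreal D * ?S a" by (rule mult_right_mono) simp
      moreover have "quantile_tail M ?W a / ?S a * ?S a = quantile_tail M ?W a"
        unfolding ennreal_divide_times using S by (simp add: ennreal_divide_self)
      ultimately show "quantile_tail M ?W a \<le> ennreal D * ?S a" by simp
    qed (auto intro!: divide_le_posI_ennreal S(1) simp: mult.commute)
  qed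
  finally have star_iff: "star_norm M \<sigma> \<top> Z \<le> ennreal D \<longleftrightarrow> (\<forall>a\<in>{0..<1}. quantile_tail M ?W a \<le> ennreal D * ?S a)" .
  {
    assume "star_norm M \<sigma> \<top> Z \<le> ennreal D"
    then have tails: "\<And>a. a \<in> {0..<1} \<Longrightarrow> quantile_tail M ?W a \<le> ennreal D * ?S a" using star_iff by blast
    show "paired 1 ?W D"
    proof (rule pairedI_comonotone[OF W])
      fix V y b assume V: "V \<in> uniform_rvs M" and y: "mono_on {0<..<1} y" "\<And>u. u \<in> {0<..<1} \<Longrightarrow> 0 \<le> y u" and b: "(0::real) \<le> b"
        and mom: "(\<integral>\<^sup>+u. ennreal (\<sigma> u * y u powr 1) \<partial>unit_leb) \<le> ennreal (b powr 1)"
      note [measurable] = uniform_rvsD(1)[OF V] measurable_uniform_comp[OF V borel_measurable_sigma]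
        borel_measurable_unit_leb_mono_on[OF y(1)]
      have "(\<integral>\<^sup>+\<omega>. ennreal (?W \<omega>) * ennreal (y (V \<omega>)) \<partial>M) \<le> (\<integral>\<^sup>+\<omega>. (ennreal D * ennreal (\<sigma> (V \<omega>))) * ennreal (y (V \<omega>)) \<partial>M)"
      proof (rule nn_integral_mono_tails[OF V y(1)])
        fix a :: real assume a: "0 \<le> a" "a < 1"
        have "(\<integral>\<^sup>+\<omega>. ennreal (?W \<omega>) * indicator {a<..} (V \<omega>) \<partial>M) \<le> ennreal D * ?S a"
          using nn_integral_tail_le_quantile_tail[OF V W a] tails[of a] a by simp
        also have "?S a = (\<integral>\<^sup>+\<omega>. ennreal (\<sigma> (V \<omega>)) * indicator {a<..} (V \<omega>) \<partial>M)"
          by (rule nn_integral_uniform_tail[OF V, symmetric]) measurable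
        also have "ennreal D * \<dots> = (\<integral>\<^sup>+\<omega>. ennreal D * ennreal (\<sigma> (V \<omega>)) * indicator {a<..} (V \<omega>) \<partial>M)"
          by (subst nn_integral_cmult[symmetric]) (auto simp: mult.assoc)
        finally show "(\<integral>\<^sup>+\<omega>. ennreal (?W \<omega>) * indicator {a<..} (V \<omega>) \<partial>M) \<le>
          (\<integral>\<^sup>+\<omega>. ennreal D * ennreal (\<sigma> (V \<omega>)) * indicator {a<..} (V \<omega>) \<partial>M)" .
      qed measurable
      also have "\<dots> = (\<integral>\<^sup>+u. ennreal D * ennreal (\<sigma> u) * ennreal (y u) \<partial>unit_leb)"
        by (rule nn_integral_uniform[OF V, of "\<lambda>u. ennreal D * ennreal (\<sigma> u) * ennreal (y u)"]) measurable
      also have "\<dots> = (\<integral>\<^sup>+u. ennreal D * ennreal (\<sigma> u * y u powr 1) \<partial>unit_leb)"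
        using y by (intro nn_integral_cong) (auto simp: mult.assoc ennreal_mult'')
      also have "\<dots> \<le> ennreal D * ennreal (b powr 1)"
        using mom by (subst nn_integral_cmult) (auto intro!: mult_left_mono)
      finally show "(\<integral>\<^sup>+\<omega>. ennreal (?W \<omega>) * ennreal (y (V \<omega>)) \<partial>M) \<le> ennreal (D * b)"
        using D b by (simp add: ennreal_mult)
    qed auto
  }
  assume paired: "paired 1 ?W D"
  obtain V where V: "V \<in> uniform_rvs M" "AE \<omega> in M. ?W \<omega> = quantile M ?W (V \<omega>)"
    using ex_uniform_quantile[OF ex_uniform W] by auto
  have "quantile_tail M ?W a \<le> ennreal D * ?S a" if a: "a \<in> {0..<1}" for a
  proof -
    \<comment> \<open>The first weighted moment of \<open>indicator {a<..}\<close> is the tail of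
      \<open>\<sigma>\<close>, so this \<open>b\<close> is its exact norm.\<close>
    define b where "b = enn2real (?S a)"
    have Sb: "?S a = ennreal b" unfolding b_def using sigma_tail_less_top[of a] by simp
    have b: "0 \<le> b" by (simp add: b_def)
    have "(\<integral>\<^sup>+u. ennreal (quantile M ?W u * indicator {a<..} u) \<partial>unit_leb) \<le> ennreal (D * b)"
    proof (rule paired_comonotone[OF paired _ V W _ _ b])
      have "(\<integral>\<^sup>+u. ennreal (\<sigma> u * indicator {a<..} u powr 1) \<partial>unit_leb) = ?S a"
        by (intro nn_integral_cong) (auto simp: indicator_def)
      then show "(\<integral>\<^sup>+u. ennreal (\<sigma> u * indicator {a<..} u powr 1) \<partial>unit_leb) \<le> ennreal (b powr 1)"
        using b by (simp add: Sb)
    qed (auto intro!: mono_onI simp: indicator_def)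
    also have "(\<integral>\<^sup>+u. ennreal (quantile M ?W u * indicator {a<..} u) \<partial>unit_leb) = quantile_tail M ?W a"
      using a by (subst quantile_tail_unit_leb) (auto intro!: nn_integral_cong simp: indicator_def)
    finally show ?thesis using D b by (simp add: Sb ennreal_mult)
  qed
  then show "star_norm M \<sigma> \<top> Z \<le> ennreal D" using star_iff by blast
qed

text \<open>Domination compares the tails of \<open>norm (Z)\<close> with the quantile tails of
  \<open>T = \<sigma> (U) * norm (Z')\<close>, hence the pairings with increasing \<open>y\<close>.
  Hoelder's inequality with weight \<open>\<sigma> (U)\<close> then separates \<open>Z'\<close> from
  \<open>y\<close>.\<close>

lemma dominates_paired:
  fixes Z Z' :: "'w \<Rightarrow> 'k::real_or_complex"
  assumes Z [measurable]: "Z \<in> borel_measurable M" and Z' [measurable]: "Z' \<in> borel_measurable M"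
    and dom: "sigma_dominates M \<sigma> Z' Z" and p: "1 < p" "1 / p + 1 / q = 1" and C: "0 \<le> C"
    and norm: "sigma_norm M \<sigma> q Z' \<le> ennreal C"
  shows "paired p (\<lambda>\<omega>. norm (Z \<omega>)) C"
proof (rule pairedI_comonotone)
  note q = conjugate_exponents[OF p]
  let ?W = "\<lambda>\<omega>. norm (Z \<omega>)"
  show W [measurable]: "?W \<in> borel_measurable M" by measurable
  fix V y b assume V: "V \<in> uniform_rvs M" and y: "mono_on {0<..<1} y" "\<And>u. u \<in> {0<..<1} \<Longrightarrow> 0 \<le> y u" and b: "(0::real) \<le> b"
    and mom: "(\<integral>\<^sup>+u. ennreal (\<sigma> u * y u powr p) \<partial>unit_leb) \<le> ennreal (b powr p)"
  obtain U where U: "U \<in> uniform_rvs M"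
    and dom: "\<And>a. a \<in> {0..<1} \<Longrightarrow> quantile_tail M ?W a \<le> quantile_tail M (\<lambda>\<omega>. \<sigma> (U \<omega>) * norm (Z' \<omega>)) a"
    using dom by (auto simp: sigma_dominates_def avar_le_iff)
  define T where "T \<omega> = \<sigma> (U \<omega>) * norm (Z' \<omega>)" for \<omega>
  note [measurable] = measurable_uniform_comp[OF U borel_measurable_sigma]
  have T [measurable]: "T \<in> borel_measurable M" unfolding T_def by measurable
  obtain V'' where V'': "V'' \<in> uniform_rvs M" "AE \<omega> in M. T \<omega> = quantile M T (V'' \<omega>)"
    using ex_uniform_quantile[OF ex_uniform T] by auto
  note [measurable] = borel_measurable_quantile[OF T] borel_measurable_unit_leb_mono_on[OF y(1)]
    measurable_uniform_comp[OF V borel_measurable_quantile[OF T]]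
    measurable_uniform_comp[OF V''(1) borel_measurable_unit_leb_mono_on[OF y(1)]]
  have "(\<integral>\<^sup>+\<omega>. ennreal (?W \<omega>) * ennreal (y (V \<omega>)) \<partial>M) \<le> (\<integral>\<^sup>+\<omega>. ennreal (quantile M T (V \<omega>)) * ennreal (y (V \<omega>)) \<partial>M)"
  proof (rule nn_integral_mono_tails[OF V y(1)])
    fix a :: real assume a: "0 \<le> a" "a < 1"
    have "(\<integral>\<^sup>+\<omega>. ennreal (?W \<omega>) * indicator {a<..} (V \<omega>) \<partial>M) \<le> quantile_tail M ?W a"
      by (rule nn_integral_tail_le_quantile_tail[OF V W a])
    also have "\<dots> \<le> quantile_tail M T a" using dom[of a] a by (simp add: T_def[abs_def])
    also have "\<dots> = (\<integral>\<^sup>+\<omega>. ennreal (quantile M T (V \<omega>)) * indicator {a<..} (V \<omega>) \<partial>M)"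
      unfolding quantile_tail_unit_leb[OF a(1)] by (rule nn_integral_uniform_tail[OF V, symmetric]) measurable
    finally show "(\<integral>\<^sup>+\<omega>. ennreal (?W \<omega>) * indicator {a<..} (V \<omega>) \<partial>M) \<le>
      (\<integral>\<^sup>+\<omega>. ennreal (quantile M T (V \<omega>)) * indicator {a<..} (V \<omega>) \<partial>M)" .
  qed measurable
  also have "\<dots> = (\<integral>\<^sup>+u. ennreal (quantile M T u) * ennreal (y u) \<partial>unit_leb)"
    by (rule nn_integral_uniform[OF V, of "\<lambda>u. ennreal (quantile M T u) * ennreal (y u)"]) measurable
  \<comment> \<open>Return to the probability space along \<open>V''\<close>, the variable that
    represents \<open>T\<close>: there the quantile of \<open>T\<close> becomes the product
    \<open>\<sigma> (U) * norm (Z')\<close> again, with the weight visible.\<close>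
  also have "\<dots> = (\<integral>\<^sup>+\<omega>. ennreal (quantile M T (V'' \<omega>)) * ennreal (y (V'' \<omega>)) \<partial>M)"
    by (rule nn_integral_uniform[OF V''(1), of "\<lambda>u. ennreal (quantile M T u) * ennreal (y u)", symmetric]) measurable
  also have "\<dots> = (\<integral>\<^sup>+\<omega>. ennreal (\<sigma> (U \<omega>) * norm (Z' \<omega>) * y (V'' \<omega>)) \<partial>M)"
  proof (rule nn_integral_cong_AE)
    show "AE \<omega> in M. ennreal (quantile M T (V'' \<omega>)) * ennreal (y (V'' \<omega>)) = ennreal (\<sigma> (U \<omega>) * norm (Z' \<omega>) * y (V'' \<omega>))"
      using V''(2) AE_uniform_unit[OF V''(1)]
      by eventually_elim (use y(2) in \<open>simp add: ennreal_mult'' T_def\<close>)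
  qed
  also have "\<dots> \<le> ennreal (C * b)"
  proof (rule nn_integral_Hoelder_le[OF _ _ _ _ _ _ p C b])
    show "AE \<omega> in M. 0 \<le> \<sigma> (U \<omega>)" by (rule AE_sigma_nonneg[OF U])
    show AEy: "AE \<omega> in M. 0 \<le> y (V'' \<omega>)"
      using AE_uniform_unit[OF V''(1)] by eventually_elim (use y in auto)
    have "sigma_moment M \<sigma> q Z' \<le> ennreal (C powr q)" using norm q C by (simp add: sigma_norm_le_iff)
    then show "(\<integral>\<^sup>+\<omega>. ennreal (\<sigma> (U \<omega>) * norm (Z' \<omega>) powr q) \<partial>M) \<le> ennreal (C powr q)"
      unfolding sigma_moment_def SUP_le_iff using U by blast
    have "AE \<omega> in M. norm (y (V'' \<omega>)) = y (V'' \<omega>)" using AEy by eventually_elim simp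
    then have "sigma_moment M \<sigma> p (\<lambda>\<omega>. y (V'' \<omega>)) \<le> ennreal (b powr p)"
      using sigma_moment_comonotone[OF V''(1) y(1), of "\<lambda>\<omega>. y (V'' \<omega>)" p] y(2) p mom by simp
    then have "(\<integral>\<^sup>+\<omega>. ennreal (\<sigma> (U \<omega>) * norm (y (V'' \<omega>)) powr p) \<partial>M) \<le> ennreal (b powr p)"
      unfolding sigma_moment_def SUP_le_iff using U by blast
    also have "(\<integral>\<^sup>+\<omega>. ennreal (\<sigma> (U \<omega>) * norm (y (V'' \<omega>)) powr p) \<partial>M) = (\<integral>\<^sup>+\<omega>. ennreal (\<sigma> (U \<omega>) * y (V'' \<omega>) powr p) \<partial>M)"
      using AEy by (intro nn_integral_cong_AE) (auto elim!: eventually_mono)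
    finally show "(\<integral>\<^sup>+\<omega>. ennreal (\<sigma> (U \<omega>) * y (V'' \<omega>) powr p) \<partial>M) \<le> ennreal (b powr p)" .
  qed (auto intro: measurable_uniform_comp[OF U borel_measurable_sigma])
  finally show "(\<integral>\<^sup>+\<omega>. ennreal (?W \<omega>) * ennreal (y (V \<omega>)) \<partial>M) \<le> ennreal (C * b)" .
qed (use p in auto)

text \<open>The pairing bound, tested on functions of \<open>V\<close>, is the hypothesis of the
  level problem for the quantile of \<open>norm (Z)\<close>. The level function \<open>h\<close>
  evaluated along \<open>V\<close> is the dominating variable, with \<open>V\<close> itself as the
  uniform variable of the domination.\<close>

lemma paired_ex_dominating:
  fixes Z :: "'w \<Rightarrow> 'k::real_or_complex"
  assumes Z [measurable]: "Z \<in> borel_measurable M" and D: "0 \<le> D" and p: "1 < p" "1 / p + 1 / q = 1"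
    and paired: "paired p (\<lambda>\<omega>. norm (Z \<omega>)) D"
  shows "\<exists>Z'::'w \<Rightarrow> 'k. Z' \<in> borel_measurable M \<and> sigma_dominates M \<sigma> Z' Z \<and> sigma_norm M \<sigma> q Z' \<le> ennreal D"
proof -
  note q = conjugate_exponents[OF p]
  let ?W = "\<lambda>\<omega>. norm (Z \<omega>)"
  have W [measurable]: "?W \<in> borel_measurable M" by measurable
  obtain V where V: "V \<in> uniform_rvs M" "AE \<omega> in M. ?W \<omega> = quantile M ?W (V \<omega>)"
    using ex_uniform_quantile[OF ex_uniform W] by auto
  interpret level_problem "quantile M ?W" \<sigma> p q D
  proof
    show "quantile M ?W \<in> borel_measurable unit_leb" by (rule borel_measurable_quantile[OF W])
    show "(\<integral>\<^sup>+u. ennreal (quantile M ?W u * y u) \<partial>unit_leb) \<le> ennreal (D * b)"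
      if "mono_on {0<..<1} y" "\<And>u. u \<in> {0<..<1} \<Longrightarrow> 0 \<le> y u" "0 \<le> b"
        "(\<integral>\<^sup>+u. ennreal (\<sigma> u * y u powr p) \<partial>unit_leb) \<le> ennreal (b powr p)" for y b
      using that p by (intro paired_comonotone[OF paired _ V W]) auto
  qed (use p D in \<open>auto simp: sigma_nonneg nn_integral_sigma intro!: quantile_nonneg sigma_tail_pos\<close>)
  obtain h where h: "mono_on {0<..<1} h" "\<And>u. u \<in> {0<..<1} \<Longrightarrow> 0 \<le> h u"
    and hq: "(\<integral>\<^sup>+u. ennreal (\<sigma> u * h u powr q) \<partial>unit_leb) \<le> ennreal (D powr q)"
    and tails: "\<And>a. a \<in> {0..<1} \<Longrightarrow> (\<integral>\<^sup>+u. ennreal (quantile M ?W u) * indicator {a<..} u \<partial>unit_leb) \<le>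
      (\<integral>\<^sup>+u. ennreal (\<sigma> u * h u) * indicator {a<..} u \<partial>unit_leb)"
    using ex_level_function by auto
  note [measurable] = borel_measurable_unit_leb_mono_on[OF h(1)]
    measurable_uniform_comp[OF V(1) borel_measurable_unit_leb_mono_on[OF h(1)]]
    measurable_uniform_comp[OF V(1) borel_measurable_sigma]
  define Z' :: "'w \<Rightarrow> 'k" where "Z' \<omega> = of_real (h (V \<omega>))" for \<omega>
  have Zm: "Z' \<in> borel_measurable M" unfolding Z'_def by measurable
  have AEh: "AE \<omega> in M. norm (Z' \<omega>) = h (V \<omega>)"
    using AE_uniform_unit[OF V(1)] by eventually_elim (use h in \<open>auto simp: Z'_def\<close>)
  have "sigma_norm M \<sigma> q Z' \<le> ennreal D"
    using q D hq sigma_moment_comonotone[OF V(1) h(1) _ AEh, of q] h(2) by (simp add: sigma_norm_le_iff)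
  moreover have "sigma_dominates M \<sigma> Z' Z"
    unfolding sigma_dominates_def
  proof (intro bexI[OF _ V(1)] ballI)
    fix a :: real assume a: "a \<in> {0..<1}"
    let ?T = "\<lambda>\<omega>. \<sigma> (V \<omega>) * norm (Z' \<omega>)"
    have [measurable]: "?T \<in> borel_measurable M" using Zm by measurable
    have "quantile_tail M ?W a \<le> (\<integral>\<^sup>+u. ennreal (\<sigma> u * h u) * indicator {a<..} u \<partial>unit_leb)"
      using tails[OF a] a by (simp add: quantile_tail_unit_leb)
    also have "\<dots> = (\<integral>\<^sup>+\<omega>. ennreal (\<sigma> (V \<omega>) * h (V \<omega>)) * indicator {a<..} (V \<omega>) \<partial>M)"
      by (rule nn_integral_uniform_tail[OF V(1), symmetric]) measurable
    also have "\<dots> = (\<integral>\<^sup>+\<omega>. ennreal (?T \<omega>) * indicator {a<..} (V \<omega>) \<partial>M)"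
      using AEh by (intro nn_integral_cong_AE) (auto elim!: eventually_mono)
    also have "\<dots> \<le> quantile_tail M ?T a"
      using a by (intro nn_integral_tail_le_quantile_tail[OF V(1)]) auto
    finally show "avar M a ?W \<le> avar M a ?T" using a by (simp add: avar_le_iff)
  qed
  ultimately show ?thesis using Zm by blast
qed

text \<open>Both branches of \<open>star_norm\<close> describe the same associate norm. For finite
  \<open>q\<close>, a bound on the infimum gives dominating variables of norm below
  \<open>D + e\<close>, so the pairing holds first with \<open>D + e\<close> and then with
  \<open>D\<close>.\<close>

lemma star_norm_le_iff:
  fixes Z :: "'w \<Rightarrow> 'k::real_or_complex"
  assumes Z: "Z \<in> borel_measurable M" and D: "0 \<le> D" and p: "1 \<le> p" and pq: "1 / ennreal p + 1 / q = 1"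
  shows "star_norm M \<sigma> q Z \<le> ennreal D \<longleftrightarrow> paired p (\<lambda>\<omega>. norm (Z \<omega>)) D"
proof (cases "p = 1")
  case True
  \<comment> \<open>In \<open>ennreal\<close> the exponent conjugate to \<open>1\<close> is
    \<open>\<top>\<close>, since \<open>1 / \<top> = 0\<close>; this selects the first branch of
    \<open>star_norm\<close>.\<close>
  then have "1 + 1 / q = 1 + 0" using pq by simp
  then have "1 / q = 0" by (subst (asm) ennreal_add_left_cancel) simp
  then have "q = \<top>" by (auto simp: divide_ennreal_def ennreal_inverse_eq_0_iff)
  then show ?thesis using star_norm_top_le_iff[OF Z D] True by simp
next
  case False
  then have p1: "1 < p" using p by simp
  have "q \<noteq> \<top>" using pq False p by (auto simp: divide_ennreal_def inverse_ennreal ennreal_inverse_eq_0_iff)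
  then obtain r where r: "q = ennreal r" "0 \<le> r" by (metis ennreal_cases)
  have "r \<noteq> 0" using pq r by auto
  then have "ennreal (1 / p + 1 / r) = ennreal 1"
    using pq r p by (simp add: divide_ennreal_def inverse_ennreal divide_inverse)
  then have pr: "1 / p + 1 / r = 1" using p r by (subst (asm) ennreal_inj) auto
  have q: "enn2real q = r" using r by simp
  have star: "star_norm M \<sigma> q Z = (INF Z'\<in>{Z'\<in>borel_measurable M. sigma_dominates M \<sigma> Z' Z}. sigma_norm M \<sigma> r Z')"
    using r q by (simp add: star_norm_def)
  show ?thesis
  proof
    assume "paired p (\<lambda>\<omega>. norm (Z \<omega>)) D"
    then obtain Z' :: "'w \<Rightarrow> 'k" where Z': "Z' \<in> borel_measurable M" "sigma_dominates M \<sigma> Z' Z" "sigma_norm M \<sigma> r Z' \<le> ennreal D"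
      using paired_ex_dominating[OF Z D p1 pr] by blast
    show "star_norm M \<sigma> q Z \<le> ennreal D"
      unfolding star by (rule INF_lower2[of Z']) (use Z' in auto)
  next
    assume le: "star_norm M \<sigma> q Z \<le> ennreal D"
    have *: "paired p (\<lambda>\<omega>. norm (Z \<omega>)) (D + e)" if e: "0 < e" for e
    proof -
      have "star_norm M \<sigma> q Z < ennreal (D + e)"
        using le D e by (intro le_less_trans[OF le]) (simp add: ennreal_less_iff)
      then obtain Z' where "Z' \<in> borel_measurable M" "sigma_dominates M \<sigma> Z' Z" "sigma_norm M \<sigma> r Z' < ennreal (D + e)"
        unfolding star INF_less_iff by blast
      then show ?thesis using D e by (intro dominates_paired[OF Z _ _ p1 pr]) auto
    qed
    show "paired p (\<lambda>\<omega>. norm (Z \<omega>)) D"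
      unfolding paired_def
    proof (intro allI impI)
      fix Y :: "'w \<Rightarrow> real" and b :: real
      assume Y: "Y \<in> borel_measurable M" "0 \<le> b" "sigma_moment M \<sigma> p Y \<le> ennreal (b powr p)"
      have "(\<lambda>n. ennreal ((D + inverse (real (Suc n))) * b)) \<longlonglongrightarrow> ennreal ((D + 0) * b)"
        by (intro tendsto_ennrealI tendsto_intros LIMSEQ_inverse_real_of_nat)
      then have lim: "(\<lambda>n. ennreal ((D + inverse (real (Suc n))) * b)) \<longlonglongrightarrow> ennreal (D * b)" by simp
      show "(\<integral>\<^sup>+\<omega>. ennreal (norm (Z \<omega>) * Y \<omega>) \<partial>M) \<le> ennreal (D * b)"
        by (rule LIMSEQ_le_const[OF lim]) (use * Y in \<open>auto simp: paired_def\<close>)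
    qed
  qed
qed

end

subsection \<open>The variation of a vector measure\<close>

lemma ennreal_norm_sums_le:
  fixes f :: "nat \<Rightarrow> 'b::real_normed_vector"
  assumes "f sums s"
  shows "ennreal (norm s) \<le> (\<Sum>i. ennreal (norm (f i)))"
proof (rule LIMSEQ_le_const2)
  show "(\<lambda>n. ennreal (norm (\<Sum>i<n. f i))) \<longlonglongrightarrow> ennreal (norm s)"
    using assms unfolding sums_def by (intro tendsto_ennrealI tendsto_norm)
  have "ennreal (norm (\<Sum>i<n. f i)) \<le> (\<Sum>i. ennreal (norm (f i)))" for n
  proof -
    have "ennreal (norm (\<Sum>i<n. f i)) \<le> ennreal (\<Sum>i<n. norm (f i))"
      by (intro ennreal_leI norm_sum)
    also have "\<dots> = (\<Sum>i<n. ennreal (norm (f i)))" by (simp add: sum_ennreal)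
    also have "\<dots> \<le> (\<Sum>i. ennreal (norm (f i)))" by (intro sum_le_suminf) auto
    finally show ?thesis .
  qed
  then show "\<exists>N. \<forall>n\<ge>N. ennreal (norm (\<Sum>i<n. f i)) \<le> (\<Sum>i. ennreal (norm (f i)))" by auto
qed

locale additive_set_function =
  fixes M :: "'w measure" and \<mu> :: "'w set \<Rightarrow> 'b::real_normed_vector"
  assumes sums: "range A \<subseteq> sets M \<Longrightarrow> disjoint_family A \<Longrightarrow> (\<lambda>i::nat. \<mu> (A i)) sums \<mu> (\<Union>i. A i)"
begin

text \<open>The constant sequence of empty sets is disjoint, and a convergent series with constant
  terms has zero terms.\<close>

lemma empty: "\<mu> {} = 0"
proof -
  have "(\<lambda>i::nat. \<mu> {}) sums \<mu> (\<Union>i::nat. {})" by (rule sums) (auto simp: disjoint_family_on_def)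
  then have "(\<lambda>i::nat. \<mu> {}) \<longlonglongrightarrow> 0" by (intro summable_LIMSEQ_zero sums_summable)
  then show ?thesis by (simp add: LIMSEQ_const_iff)
qed

lemma Un:
  assumes "A \<in> sets M" "B \<in> sets M" "A \<inter> B = {}"
  shows "\<mu> (A \<union> B) = \<mu> A + \<mu> B"
proof -
  have "(\<lambda>i. \<mu> (binaryset A B i)) sums \<mu> (\<Union>i. binaryset A B i)"
    using assms by (intro sums) (auto simp: range_binaryset_eq disjoint_family_on_def binaryset_def)
  moreover have "(\<lambda>i. \<mu> (binaryset A B i)) sums (\<mu> A + \<mu> B)"
    by (rule binaryset_sums) (rule empty)
  ultimately show ?thesis by (simp add: UN_binaryset_eq sums_unique2)
qed

lemma UN:
  assumes "finite J" "disjoint_family_on E J" "\<And>j. j \<in> J \<Longrightarrow> E j \<in> sets M"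
  shows "\<mu> (\<Union>j\<in>J. E j) = (\<Sum>j\<in>J. \<mu> (E j))"
  using assms
proof (induction J)
  case (insert k J)
  have "\<mu> (E k \<union> (\<Union>j\<in>J. E j)) = \<mu> (E k) + \<mu> (\<Union>j\<in>J. E j)"
    using insert by (intro Un) (auto simp: disjoint_family_on_def)
  also have "\<mu> (\<Union>j\<in>J. E j) = (\<Sum>j\<in>J. \<mu> (E j))"
    using insert by (intro insert.IH) (auto simp: disjoint_family_on_def)
  finally show ?case using insert by simp
qed (simp add: empty)

text \<open>\<open>partition_on\<close> forbids empty cells and asks for a full cover. Dropping the
  empty members of the family and adding the uncovered remainder of \<open>F\<close> turns the
  family into a partition without decreasing the sum.\<close>

lemma sum_le_variation:
  assumes J: "finite J" and disj: "disjoint_family_on E J" and E: "\<And>j. j \<in> J \<Longrightarrow> E j \<in> sets M"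
    and sub: "(\<Union>j\<in>J. E j) \<subseteq> F" and F: "F \<in> sets M"
  shows "(\<Sum>j\<in>J. ennreal (norm (\<mu> (E j)))) \<le> variation M \<mu> F"
proof -
  define J' where "J' = {j\<in>J. E j \<noteq> {}}"
  define \<pi> where "\<pi> = insert (F - (\<Union>j\<in>J. E j)) (E ` J) - {{}}"
  have J': "finite J'" "J' \<subseteq> J" using J by (auto simp: J'_def)
  have inj: "inj_on E J'"
    using disj by (auto simp: inj_on_def disjoint_family_on_def J'_def)
  have R: "F - (\<Union>j\<in>J. E j) \<in> sets M" using E J F by auto
  have part: "partition_on F \<pi>"
  proof -
    have "\<Union>\<pi> = \<Union>(insert (F - (\<Union>j\<in>J. E j)) (E ` J))" unfolding \<pi>_def by blast
    then have "\<Union>\<pi> = F" using sub by (simp add: Un_absorb2)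
    moreover have "disjoint \<pi>"
      unfolding disjoint_def
    proof (intro ballI impI)
      fix a b assume ab: "a \<in> \<pi>" "b \<in> \<pi>" "a \<noteq> b"
      consider "a = F - (\<Union>j\<in>J. E j)" "b \<in> E ` J" | "b = F - (\<Union>j\<in>J. E j)" "a \<in> E ` J"
        | i j where "i \<in> J" "j \<in> J" "a = E i" "b = E j"
        using ab unfolding \<pi>_def by blast
      then show "a \<inter> b = {}"
      proof cases
        case 3
        then have "i \<noteq> j" using ab(3) by auto
        then show ?thesis using 3 disjoint_family_onD[OF disj] by simp
      qed auto
    qed
    ultimately show ?thesis by (auto simp: partition_on_def \<pi>_def)
  qed
  have "(\<Sum>j\<in>J. ennreal (norm (\<mu> (E j)))) = (\<Sum>j\<in>J'. ennreal (norm (\<mu> (E j))))"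
    by (rule sum.mono_neutral_right) (auto simp: J J'_def empty)
  also have "\<dots> = (\<Sum>A\<in>E ` J'. ennreal (norm (\<mu> A)))" by (simp add: sum.reindex[OF inj])
  also have "\<dots> \<le> (\<Sum>A\<in>\<pi>. ennreal (norm (\<mu> A)))"
    using J by (intro sum_mono2) (auto simp: \<pi>_def J'_def)
  also have "\<dots> \<le> variation M \<mu> F"
    unfolding variation_def using part J E R by (intro SUP_upper) (auto simp: \<pi>_def)
  finally show ?thesis .
qed

lemma norm_le_variation:
  assumes "E \<in> sets M" shows "ennreal (norm (\<mu> E)) \<le> variation M \<mu> E"
  using sum_le_variation[of "{()}" "\<lambda>_. E" E] assms by (simp add: disjoint_family_on_def)

lemma variation_empty: "variation M \<mu> {} = 0"
proof -
  have "variation M \<mu> {} \<le> 0"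
    unfolding variation_def by (intro SUP_least) (auto simp: partition_on_empty)
  then show ?thesis by simp
qed

lemma sum_partition_le_variation:
  assumes "finite \<pi>" "\<pi> \<subseteq> sets M" "disjoint \<pi>" "\<Union>\<pi> \<subseteq> F" "F \<in> sets M"
  shows "(\<Sum>A\<in>\<pi>. ennreal (norm (\<mu> A))) \<le> variation M \<mu> F"
  using assms by (intro sum_le_variation[where E="\<lambda>A. A"]) (auto simp: disjoint_family_on_def disjoint_def)

lemma variation_mono:
  assumes "E \<subseteq> F" "F \<in> sets M"
  shows "variation M \<mu> E \<le> variation M \<mu> F"
  unfolding variation_def[of M \<mu> E]
proof (rule SUP_least)
  fix \<pi> assume "\<pi> \<in> {\<pi>. finite \<pi> \<and> \<pi> \<subseteq> sets M \<and> partition_on E \<pi>}"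
  then have "finite \<pi>" "\<pi> \<subseteq> sets M" "disjoint \<pi>" "\<Union>\<pi> = E" by (auto simp: partition_on_def)
  then show "(\<Sum>A\<in>\<pi>. ennreal (norm (\<mu> A))) \<le> variation M \<mu> F"
    using assms by (intro sum_partition_le_variation) simp_all
qed

lemma ex_partition:
  assumes "E \<in> sets M"
  shows "{\<pi>. finite \<pi> \<and> \<pi> \<subseteq> sets M \<and> partition_on E \<pi>} \<noteq> {}"
proof (cases "E = {}")
  case True
  then have "{} \<in> {\<pi>. finite \<pi> \<and> \<pi> \<subseteq> sets M \<and> partition_on E \<pi>}" by (simp add: partition_on_empty)
  then show ?thesis by blast
next
  case False
  then have "{E} \<in> {\<pi>. finite \<pi> \<and> \<pi> \<subseteq> sets M \<and> partition_on E \<pi>}"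
    using assms partition_on_space[OF False] by simp
  then show ?thesis by blast
qed

text \<open>A partition of \<open>A\<close> and one of \<open>B\<close> share no cell, since cells
  are nonempty, and together they partition the union. The two suprema are taken one after the
  other.\<close>

lemma variation_superadditive:
  assumes A: "A \<in> sets M" and B: "B \<in> sets M" and AB: "A \<inter> B = {}"
  shows "variation M \<mu> A + variation M \<mu> B \<le> variation M \<mu> (A \<union> B)"
proof -
  let ?P = "\<lambda>E. {\<pi>. finite \<pi> \<and> \<pi> \<subseteq> sets M \<and> partition_on E \<pi>}" and ?s = "\<lambda>\<pi>. \<Sum>A\<in>\<pi>. ennreal (norm (\<mu> A))"
  have *: "?s \<pi> + ?s \<rho> \<le> variation M \<mu> (A \<union> B)" if "\<pi> \<in> ?P A" "\<rho> \<in> ?P B" for \<pi> \<rho>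
  proof -
    have un: "\<Union>\<pi> = A" "\<Union>\<rho> = B" "disjoint \<pi>" "disjoint \<rho>" and ne: "{} \<notin> \<pi>"
      using that by (auto simp: partition_on_def)
    have "\<pi> \<inter> \<rho> = {}"
    proof (rule ccontr)
      assume "\<pi> \<inter> \<rho> \<noteq> {}"
      then obtain C where "C \<in> \<pi>" "C \<in> \<rho>" by auto
      then have "C \<subseteq> A \<inter> B" using un by blast
      then show False using AB ne \<open>C \<in> \<pi>\<close> by auto
    qed
    then have "?s \<pi> + ?s \<rho> = ?s (\<pi> \<union> \<rho>)" using that by (subst sum.union_disjoint) auto
    also have "\<dots> \<le> variation M \<mu> (A \<union> B)"
    proof (rule sum_partition_le_variation)
      show "disjoint (\<pi> \<union> \<rho>)"
        using un AB by (intro disjoint_union) auto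
    qed (use that A B in \<open>auto simp: partition_on_def\<close>)
    finally show ?thesis .
  qed
  have **: "variation M \<mu> A + ?s \<rho> \<le> variation M \<mu> (A \<union> B)" if "\<rho> \<in> ?P B" for \<rho>
    unfolding variation_def[of M \<mu> A] ennreal_SUP_add_left[OF ex_partition[OF A], symmetric]
    by (intro SUP_least *[OF _ that])
  show ?thesis
    unfolding variation_def[of M \<mu> B] ennreal_SUP_add_right[OF ex_partition[OF B]]
    by (intro SUP_least **)
qed

text \<open>One inequality is superadditivity in the limit. For the other, each cell
  \<open>B\<close> of a partition of the union is cut into the pieces \<open>B \<inter> A i\<close>:
  countable additivity of \<open>\<mu>\<close> bounds \<open>norm (\<mu> B)\<close> by the sum over
  the pieces, and exchanging the sums collects them by \<open>i\<close>.\<close>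

lemma variation_suminf:
  assumes A: "range A \<subseteq> sets M" "disjoint_family (A :: nat \<Rightarrow> 'w set)"
  shows "(\<Sum>i. variation M \<mu> (A i)) = variation M \<mu> (\<Union>i. A i)"
proof (rule antisym)
  have Ai: "A i \<in> sets M" for i using A by auto
  have fin: "(\<Sum>i<n. variation M \<mu> (A i)) \<le> variation M \<mu> (\<Union>i<n. A i)" for n
  proof (induction n)
    case (Suc n)
    have "(\<Sum>i<Suc n. variation M \<mu> (A i)) \<le> variation M \<mu> (\<Union>i<n. A i) + variation M \<mu> (A n)"
      using Suc by (simp add: add_right_mono)
    also have "\<dots> \<le> variation M \<mu> ((\<Union>i<n. A i) \<union> A n)"
    proof (rule variation_superadditive)
      show "(\<Union>i<n. A i) \<inter> A n = {}"
      proof -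
        have "A i \<inter> A n = {}" if "i < n" for i
          using that by (intro disjoint_family_onD[OF A(2)]) auto
        then show ?thesis by auto
      qed
    qed (use Ai in auto)
    also have "(\<Union>i<n. A i) \<union> A n = (\<Union>i<Suc n. A i)" by (auto simp: lessThan_Suc)
    finally show ?case .
  qed (simp add: variation_empty)
  have "(\<Sum>i<n. variation M \<mu> (A i)) \<le> variation M \<mu> (\<Union>i. A i)" for n
    using fin[of n] variation_mono[of "\<Union>i<n. A i" "\<Union>i. A i"] Ai by (force intro: order_trans)
  then show "(\<Sum>i. variation M \<mu> (A i)) \<le> variation M \<mu> (\<Union>i. A i)"
    by (intro suminf_le_const) auto
  show "variation M \<mu> (\<Union>i. A i) \<le> (\<Sum>i. variation M \<mu> (A i))"
    unfolding variation_def[of M \<mu> "\<Union>i. A i"]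
  proof (rule SUP_least)
    fix \<pi> assume \<pi>: "\<pi> \<in> {\<pi>. finite \<pi> \<and> \<pi> \<subseteq> sets M \<and> partition_on (\<Union>i. A i) \<pi>}"
    have "ennreal (norm (\<mu> B)) \<le> (\<Sum>i. ennreal (norm (\<mu> (B \<inter> A i))))" if B: "B \<in> \<pi>" for B
    proof (rule ennreal_norm_sums_le)
      have "(\<lambda>i. \<mu> (B \<inter> A i)) sums \<mu> (\<Union>i. B \<inter> A i)"
        using B \<pi> A Ai by (intro sums) (auto simp: disjoint_family_on_def)
      moreover have "(\<Union>i. B \<inter> A i) = B" using B \<pi> by (auto simp: partition_on_def)
      ultimately show "(\<lambda>i. \<mu> (B \<inter> A i)) sums \<mu> B" by simp
    qed
    then have "(\<Sum>B\<in>\<pi>. ennreal (norm (\<mu> B))) \<le> (\<Sum>B\<in>\<pi>. \<Sum>i. ennreal (norm (\<mu> (B \<inter> A i))))"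
      by (rule sum_mono)
    also have "\<dots> = (\<Sum>i. \<Sum>B\<in>\<pi>. ennreal (norm (\<mu> (B \<inter> A i))))"
      by (rule suminf_sum[symmetric]) auto
    also have "\<dots> \<le> (\<Sum>i. variation M \<mu> (A i))"
    proof (intro suminf_le sum_le_variation)
      have "disjoint \<pi>" using \<pi> by (simp add: partition_on_def)
      then have "disjoint_family_on (\<lambda>B. B) \<pi>" by (simp add: disjoint_family_on_def disjoint_def)
      then show "disjoint_family_on (\<lambda>B. B \<inter> A i) \<pi>" for i
        unfolding disjoint_family_on_def by blast
    qed (use \<pi> Ai in auto)
    finally show "(\<Sum>B\<in>\<pi>. ennreal (norm (\<mu> B))) \<le> (\<Sum>i. variation M \<mu> (A i))" .
  qed
qed

lemma sets_variation_measure [simp, measurable_cong]: "sets (variation_measure M \<mu>) = sets M"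
  and space_variation_measure [simp]: "space (variation_measure M \<mu>) = space M"
  using sets.space_closed[of M] sets.sigma_sets_eq[of M]
  by (auto simp: variation_measure_def sets_measure_of space_measure_of)

lemma emeasure_variation_measure:
  assumes "E \<in> sets M"
  shows "emeasure (variation_measure M \<mu>) E = variation M \<mu> E"
  unfolding variation_measure_def
proof (rule emeasure_measure_of_sigma)
  show "sigma_algebra (space M) (sets M)" by (rule sets.sigma_algebra_axioms)
  show "positive (sets M) (variation M \<mu>)" by (simp add: positive_def variation_empty)
  show "countably_additive (sets M) (variation M \<mu>)"
    by (auto simp: countably_additive_def variation_suminf)
qed fact

end

subsection \<open>Strongly measurable functions\<close>

lemma simple_function_imp_strongly_measurable: "simple_function M s \<Longrightarrow> strongly_measurable M s"
  unfolding strongly_measurable_def by (intro exI[of _ "\<lambda>_. s"]) auto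

lemma borel_measurable_norm_strongly_measurable:
  assumes "strongly_measurable M Y"
  shows "(\<lambda>\<omega>. norm (Y \<omega>)) \<in> borel_measurable M"
proof -
  obtain s where s: "\<And>n. simple_function M (s n)" "\<And>\<omega>. \<omega> \<in> space M \<Longrightarrow> (\<lambda>n. s n \<omega>) \<longlonglongrightarrow> Y \<omega>"
    using assms by (auto simp: strongly_measurable_def)
  have "(\<lambda>\<omega>. norm (s n \<omega>)) \<in> borel_measurable M" for n
    using simple_function_compose1[OF s(1)] by (rule borel_measurable_simple_function)
  then show ?thesis by (rule borel_measurable_LIMSEQ_real[rotated]) (auto intro: tendsto_norm s)
qed

text \<open>The argument works on the approximating simple functions, because in a nonseparable
  space a sum of Borel functions may fail to be Borel. Continuity of \<open>h\<close> is therefore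
  stated by sequences.\<close>

lemma strongly_measurable_compose2:
  assumes Y: "strongly_measurable M Y" and Z: "strongly_measurable M Z"
    and cont: "\<And>s t y z. s \<longlonglongrightarrow> y \<Longrightarrow> t \<longlonglongrightarrow> z \<Longrightarrow> (\<lambda>n. h (s n) (t n)) \<longlonglongrightarrow> h y z"
  shows "strongly_measurable M (\<lambda>\<omega>. h (Y \<omega>) (Z \<omega>))"
proof -
  obtain s where s: "\<And>n. simple_function M (s n)" "\<And>\<omega>. \<omega> \<in> space M \<Longrightarrow> (\<lambda>n. s n \<omega>) \<longlonglongrightarrow> Y \<omega>"
    using Y by (auto simp: strongly_measurable_def)
  obtain t where t: "\<And>n. simple_function M (t n)" "\<And>\<omega>. \<omega> \<in> space M \<Longrightarrow> (\<lambda>n. t n \<omega>) \<longlonglongrightarrow> Z \<omega>"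
    using Z by (auto simp: strongly_measurable_def)
  have "simple_function M (\<lambda>\<omega>. h (s n \<omega>) (t n \<omega>))" for n
    by (rule simple_function_compose2[OF s(1) t(1)])
  then show ?thesis
    unfolding strongly_measurable_def
    by (intro exI[of _ "\<lambda>n \<omega>. h (s n \<omega>) (t n \<omega>)"] conjI allI ballI cont s t)
qed

lemma strongly_measurable_add:
  "strongly_measurable M Y \<Longrightarrow> strongly_measurable M Z \<Longrightarrow> strongly_measurable M (\<lambda>\<omega>. Y \<omega> + Z \<omega>)"
  by (rule strongly_measurable_compose2) (auto intro: tendsto_add)

lemma strongly_measurable_diff:
  "strongly_measurable M Y \<Longrightarrow> strongly_measurable M Z \<Longrightarrow> strongly_measurable M (\<lambda>\<omega>. Y \<omega> - Z \<omega>)"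
  by (rule strongly_measurable_compose2) (auto intro: tendsto_diff)

text \<open>Truncate any approximating sequence at twice the norm of the limit. Where
  \<open>Y\<close> is nonzero the factor \<open>2\<close> leaves room, so the truncation is
  eventually inactive; where \<open>Y\<close> vanishes the truncated sequence is constantly
  \<open>0\<close>.\<close>

lemma strongly_measurable_approx:
  fixes Y :: "'w \<Rightarrow> 'x::real_normed_vector"
  assumes "strongly_measurable M Y"
  obtains s where "\<And>n. simple_function M (s n)" "\<And>\<omega>. \<omega> \<in> space M \<Longrightarrow> (\<lambda>n. s n \<omega>) \<longlonglongrightarrow> Y \<omega>"
    "\<And>n \<omega>. norm (s n \<omega>) \<le> 2 * norm (Y \<omega>)"
proof -
  obtain t where t: "\<And>n. simple_function M (t n)" "\<And>\<omega>. \<omega> \<in> space M \<Longrightarrow> (\<lambda>n. t n \<omega>) \<longlonglongrightarrow> Y \<omega>"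
    using assms by (auto simp: strongly_measurable_def)
  define s where "s n \<omega> = (if norm (t n \<omega>) \<le> 2 * norm (Y \<omega>) then t n \<omega> else 0)" for n \<omega>
  show ?thesis
  proof
    fix n
    have [measurable]: "(\<lambda>\<omega>. norm (t n \<omega>)) \<in> borel_measurable M"
      using simple_function_compose1[OF t(1)] by (rule borel_measurable_simple_function)
    note [measurable] = borel_measurable_norm_strongly_measurable[OF assms]
    have "{\<omega>\<in>space M. norm (t n \<omega>) \<le> 2 * norm (Y \<omega>)} \<in> sets M" by measurable
    then show "simple_function M (s n)"
      unfolding s_def by (rule simple_function_If[rotated 2]) (auto intro: t)
  next
    fix \<omega> assume \<omega>: "\<omega> \<in> space M"
    show "(\<lambda>n. s n \<omega>) \<longlonglongrightarrow> Y \<omega>"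
    proof (cases "Y \<omega> = 0")
      case True
      then have "s n \<omega> = 0" for n by (simp add: s_def)
      then show ?thesis using True by simp
    next
      case False
      have "\<forall>\<^sub>F n in sequentially. norm (t n \<omega>) < 2 * norm (Y \<omega>)"
        using False by (intro order_tendstoD(2)[OF tendsto_norm[OF t(2)[OF \<omega>]]]) simp
      then have "\<forall>\<^sub>F n in sequentially. t n \<omega> = s n \<omega>"
        by eventually_elim (simp add: s_def)
      then show ?thesis by (rule Lim_transform_eventually[OF t(2)[OF \<omega>]])
    qed
  qed (auto simp: s_def)
qed

subsection \<open>Integration with respect to a vector measure\<close>

definition vm_simple ::
  "'w measure \<Rightarrow> ('w set \<Rightarrow> 'x::real_normed_vector \<Rightarrow>\<^sub>L 'k::real_normed_vector) \<Rightarrow> ('w \<Rightarrow> 'x) \<Rightarrow> 'k" where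
  "vm_simple M \<mu> s = (\<Sum>x\<in>s ` space M. blinfun_apply (\<mu> (s -` {x} \<inter> space M)) x)"

locale operator_measure = additive_set_function M \<mu>
  for M :: "'w measure" and \<mu> :: "'w set \<Rightarrow> 'x::real_normed_vector \<Rightarrow>\<^sub>L 'k::banach"
begin

text \<open>Independence of the representation: grouping the cells by their value \<open>v j\<close>
  recovers the level sets of \<open>s\<close>, on which \<open>\<mu>\<close> is finitely
  additive.\<close>

lemma vm_simple_partition:
  assumes J: "finite J" and disj: "disjoint_family_on E J" and E: "\<And>j. j \<in> J \<Longrightarrow> E j \<in> sets M"
    and un: "(\<Union>j\<in>J. E j) = space M" and s: "\<And>j \<omega>. j \<in> J \<Longrightarrow> \<omega> \<in> E j \<Longrightarrow> s \<omega> = v j"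
  shows "vm_simple M \<mu> s = (\<Sum>j\<in>J. blinfun_apply (\<mu> (E j)) (v j))"
proof -
  \<comment> \<open>On an empty cell \<open>v j\<close> is unconstrained and need not be a value of
    \<open>s\<close>.\<close>
  define J' where "J' = {j\<in>J. E j \<noteq> {}}"
  have J': "finite J'" using J by (simp add: J'_def)
  have img: "s ` space M = v ` J'"
  proof
    show "s ` space M \<subseteq> v ` J'"
      using s un by (fastforce simp: J'_def)
    show "v ` J' \<subseteq> s ` space M"
    proof
      fix x assume "x \<in> v ` J'"
      then obtain j \<omega> where "j \<in> J" "x = v j" "\<omega> \<in> E j" by (auto simp: J'_def)
      then show "x \<in> s ` space M" using s[of j \<omega>] un by (intro image_eqI[of _ _ \<omega>]) auto
    qed
  qed
  have "vm_simple M \<mu> s = (\<Sum>x\<in>v ` J'. \<Sum>j\<in>{j\<in>J'. v j = x}. blinfun_apply (\<mu> (E j)) (v j))"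
    unfolding vm_simple_def img
  proof (rule sum.cong[OF refl])
    fix x assume "x \<in> v ` J'"
    have "s -` {x} \<inter> space M = (\<Union>j\<in>{j\<in>J'. v j = x}. E j)"
    proof (intro set_eqI iffI)
      fix \<omega> assume \<omega>: "\<omega> \<in> s -` {x} \<inter> space M"
      then obtain j where "j \<in> J" "\<omega> \<in> E j" using un by blast
      then show "\<omega> \<in> (\<Union>j\<in>{j\<in>J'. v j = x}. E j)" using s[of j \<omega>] \<omega> by (auto simp: J'_def)
    next
      fix \<omega> assume "\<omega> \<in> (\<Union>j\<in>{j\<in>J'. v j = x}. E j)"
      then obtain j where "j \<in> J" "v j = x" "\<omega> \<in> E j" by (auto simp: J'_def)
      then show "\<omega> \<in> s -` {x} \<inter> space M" using s[of j \<omega>] un by auto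
    qed
    also have "\<mu> \<dots> = (\<Sum>j\<in>{j\<in>J'. v j = x}. \<mu> (E j))"
    proof (rule UN)
      show "finite {j\<in>J'. v j = x}" using J' by simp
    qed (use disj E in \<open>auto simp: J'_def disjoint_family_on_def\<close>)
    finally have "blinfun_apply (\<mu> (s -` {x} \<inter> space M)) x = (\<Sum>j\<in>{j\<in>J'. v j = x}. blinfun_apply (\<mu> (E j)) x)"
      by (simp add: blinfun.sum_left)
    then show "blinfun_apply (\<mu> (s -` {x} \<inter> space M)) x = (\<Sum>j\<in>{j\<in>J'. v j = x}. blinfun_apply (\<mu> (E j)) (v j))"
      by simp
  qed
  also have "\<dots> = (\<Sum>j\<in>J'. blinfun_apply (\<mu> (E j)) (v j))"
    using J' by (intro sum.group) auto
  also have "\<dots> = (\<Sum>j\<in>J. blinfun_apply (\<mu> (E j)) (v j))"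
    by (rule sum.mono_neutral_left) (auto simp: J J'_def empty)
  finally show ?thesis .
qed

text \<open>Everything is written over the joint level sets of \<open>s\<close> and
  \<open>t\<close>. Choosing \<open>h\<close> as a projection expresses \<open>s\<close> or
  \<open>t\<close> alone over the same cells, so linearity reduces to linearity in each
  summand.\<close>

lemma vm_simple_compose2:
  assumes s: "simple_function M s" and t: "simple_function M t"
  shows "vm_simple M \<mu> (\<lambda>\<omega>. h (s \<omega>) (t \<omega>)) =
    (\<Sum>j\<in>s ` space M \<times> t ` space M. blinfun_apply (\<mu> ((s -` {fst j} \<inter> space M) \<inter> (t -` {snd j} \<inter> space M))) (h (fst j) (snd j)))"
proof (rule vm_simple_partition[where v="\<lambda>j. h (fst j) (snd j)"])
  show "finite (s ` space M \<times> t ` space M)"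
    by (intro finite_cartesian_product simple_functionD(1) s t)
  show "s -` {fst j} \<inter> space M \<inter> (t -` {snd j} \<inter> space M) \<in> sets M" for j
    by (intro sets.Int simple_functionD(2) s t)
qed (auto simp: disjoint_family_on_def)

lemma vm_simple_add:
  assumes s: "simple_function M s" and t: "simple_function M t"
  shows "vm_simple M \<mu> (\<lambda>\<omega>. s \<omega> + t \<omega>) = vm_simple M \<mu> s + vm_simple M \<mu> t"
  using vm_simple_compose2[OF s t, of "\<lambda>x y. x + y"] vm_simple_compose2[OF s t, of "\<lambda>x y. x"]
    vm_simple_compose2[OF s t, of "\<lambda>x y. y"]
  by (simp add: blinfun.add_right sum.distrib)

lemma vm_simple_diff:
  assumes s: "simple_function M s" and t: "simple_function M t"
  shows "vm_simple M \<mu> (\<lambda>\<omega>. s \<omega> - t \<omega>) = vm_simple M \<mu> s - vm_simple M \<mu> t"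
  using vm_simple_compose2[OF s t, of "\<lambda>x y. x - y"] vm_simple_compose2[OF s t, of "\<lambda>x y. x"]
    vm_simple_compose2[OF s t, of "\<lambda>x y. y"]
  by (simp add: blinfun.diff_right sum_subtractf)

lemma vm_simple_indicator:
  assumes "E \<in> sets M"
  shows "vm_simple M \<mu> (\<lambda>\<omega>. indicator E \<omega> *\<^sub>R x) = blinfun_apply (\<mu> E) x"
proof -
  have "vm_simple M \<mu> (\<lambda>\<omega>. indicator E \<omega> *\<^sub>R x) =
    (\<Sum>b\<in>{True, False}. blinfun_apply (\<mu> (if b then E else space M - E)) (if b then x else 0))"
    using sets.sets_into_space[OF assms] assms
    by (intro vm_simple_partition) (auto simp: disjoint_family_on_def split: if_splits)
  then show ?thesis by simp
qed

lemma simple_function_indicator_scaleR: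
  "E \<in> sets M \<Longrightarrow> simple_function M (\<lambda>\<omega>. indicator E \<omega> *\<^sub>R (x :: 'y::real_vector))"
  by (rule simple_function_compose1[where f="indicator E" and g="\<lambda>r::real. r *\<^sub>R x"]) simp

lemma norm_vm_simple_le:
  assumes s: "simple_function M s"
  shows "ennreal (norm (vm_simple M \<mu> s)) \<le> (\<integral>\<^sup>+\<omega>. ennreal (norm (s \<omega>)) \<partial>variation_measure M \<mu>)"
proof -
  let ?E = "\<lambda>x. s -` {x} \<inter> space M"
  have E: "?E x \<in> sets M" for x by (rule simple_functionD(2)[OF s])
  have fin: "finite (s ` space M)" by (rule simple_functionD(1)[OF s])
  have "norm (vm_simple M \<mu> s) \<le> (\<Sum>x\<in>s ` space M. norm (\<mu> (?E x)) * norm x)"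
    unfolding vm_simple_def by (intro sum_norm_le norm_blinfun)
  then have "ennreal (norm (vm_simple M \<mu> s)) \<le> ennreal (\<Sum>x\<in>s ` space M. norm (\<mu> (?E x)) * norm x)"
    by (rule ennreal_leI)
  also have "\<dots> = (\<Sum>x\<in>s ` space M. ennreal (norm x) * ennreal (norm (\<mu> (?E x))))"
    by (subst sum_ennreal[symmetric]) (auto simp: ennreal_mult mult.commute)
  also have "\<dots> \<le> (\<Sum>x\<in>s ` space M. ennreal (norm x) * emeasure (variation_measure M \<mu>) (?E x))"
    using E by (intro sum_mono mult_left_mono) (auto simp: emeasure_variation_measure norm_le_variation)
  also have "\<dots> = (\<Sum>x\<in>s ` space M. \<integral>\<^sup>+\<omega>. ennreal (norm x) * indicator (?E x) \<omega> \<partial>variation_measure M \<mu>)"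
    using E by (intro sum.cong refl nn_integral_cmult_indicator[symmetric]) simp
  also have "\<dots> = (\<integral>\<^sup>+\<omega>. (\<Sum>x\<in>s ` space M. ennreal (norm x) * indicator (?E x) \<omega>) \<partial>variation_measure M \<mu>)"
    using E by (intro nn_integral_sum[symmetric]) simp
  also have "\<dots> = (\<integral>\<^sup>+\<omega>. ennreal (norm (s \<omega>)) \<partial>variation_measure M \<mu>)"
  proof (rule nn_integral_cong)
    fix \<omega> assume \<omega>: "\<omega> \<in> space (variation_measure M \<mu>)"
    have "(\<Sum>x\<in>s ` space M. ennreal (norm x) * indicator (?E x) \<omega>) = (\<Sum>x\<in>s ` space M. if x = s \<omega> then ennreal (norm x) else 0)"
      using \<omega> by (intro sum.cong) (auto simp: indicator_def)
    then show "(\<Sum>x\<in>s ` space M. ennreal (norm x) * indicator (?E x) \<omega>) = ennreal (norm (s \<omega>))"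
      using \<omega> fin by simp
  qed
  finally show ?thesis .
qed

text \<open>A Bochner-type integral, by simple approximation in \<open>L^1\<close> of the variation.
  It is a relation, so that additivity and the norm bound can precede, and then prove, uniqueness of
  the value.\<close>

definition has_vm_integral :: "('w \<Rightarrow> 'x) \<Rightarrow> 'k \<Rightarrow> bool" where
  "has_vm_integral Y l \<longleftrightarrow> (\<exists>s. (\<forall>n::nat. simple_function M (s n)) \<and>
     (\<lambda>n. \<integral>\<^sup>+\<omega>. ennreal (norm (s n \<omega> - Y \<omega>)) \<partial>variation_measure M \<mu>) \<longlonglongrightarrow> 0 \<and>
     (\<lambda>n. vm_simple M \<mu> (s n)) \<longlonglongrightarrow> l)"

lemma borel_measurable_ennreal_norm:
  "strongly_measurable M Y \<Longrightarrow> (\<lambda>\<omega>. ennreal (norm (Y \<omega>))) \<in> borel_measurable (variation_measure M \<mu>)"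
  using borel_measurable_norm_strongly_measurable[of M Y] by (simp cong: measurable_cong_sets)

lemma nn_integral_norm_triangle:
  fixes Y Z :: "'w \<Rightarrow> 'y::real_normed_vector"
  assumes "strongly_measurable M Y" "strongly_measurable M Z" "\<And>\<omega>. norm (W \<omega>) \<le> norm (Y \<omega>) + norm (Z \<omega>)"
  shows "(\<integral>\<^sup>+\<omega>. ennreal (norm (W \<omega>)) \<partial>variation_measure M \<mu>) \<le>
    (\<integral>\<^sup>+\<omega>. ennreal (norm (Y \<omega>)) \<partial>variation_measure M \<mu>) + (\<integral>\<^sup>+\<omega>. ennreal (norm (Z \<omega>)) \<partial>variation_measure M \<mu>)"
proof -
  have "(\<integral>\<^sup>+\<omega>. ennreal (norm (W \<omega>)) \<partial>variation_measure M \<mu>) \<le>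
      (\<integral>\<^sup>+\<omega>. ennreal (norm (Y \<omega>)) + ennreal (norm (Z \<omega>)) \<partial>variation_measure M \<mu>)"
    using assms(3) by (intro nn_integral_mono) (simp add: ennreal_plus[symmetric] ennreal_leI del: ennreal_plus)
  also have "\<dots> = (\<integral>\<^sup>+\<omega>. ennreal (norm (Y \<omega>)) \<partial>variation_measure M \<mu>) + (\<integral>\<^sup>+\<omega>. ennreal (norm (Z \<omega>)) \<partial>variation_measure M \<mu>)"
    by (intro nn_integral_add borel_measurable_ennreal_norm assms)
  finally show ?thesis .
qed

lemma has_vm_integral_simple:
  assumes "simple_function M s"
  shows "has_vm_integral s (vm_simple M \<mu> s)"
  unfolding has_vm_integral_def using assms by (intro exI[of _ "\<lambda>_. s"]) simp

lemma has_vm_integral_add: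
  assumes Y: "strongly_measurable M Y" "has_vm_integral Y k" and Z: "strongly_measurable M Z" "has_vm_integral Z l"
  shows "has_vm_integral (\<lambda>\<omega>. Y \<omega> + Z \<omega>) (k + l)"
proof -
  obtain s where s: "\<And>n. simple_function M (s n)"
    "(\<lambda>n. \<integral>\<^sup>+\<omega>. ennreal (norm (s n \<omega> - Y \<omega>)) \<partial>variation_measure M \<mu>) \<longlonglongrightarrow> 0" "(\<lambda>n. vm_simple M \<mu> (s n)) \<longlonglongrightarrow> k"
    using Y by (auto simp: has_vm_integral_def)
  obtain t where t: "\<And>n. simple_function M (t n)"
    "(\<lambda>n. \<integral>\<^sup>+\<omega>. ennreal (norm (t n \<omega> - Z \<omega>)) \<partial>variation_measure M \<mu>) \<longlonglongrightarrow> 0" "(\<lambda>n. vm_simple M \<mu> (t n)) \<longlonglongrightarrow> l"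
    using Z by (auto simp: has_vm_integral_def)
  show ?thesis
    unfolding has_vm_integral_def
  proof (intro exI[of _ "\<lambda>n \<omega>. s n \<omega> + t n \<omega>"] conjI allI)
    show "simple_function M (\<lambda>\<omega>. s n \<omega> + t n \<omega>)" for n by (intro simple_function_add s t)
    show "(\<lambda>n. vm_simple M \<mu> (\<lambda>\<omega>. s n \<omega> + t n \<omega>)) \<longlonglongrightarrow> k + l"
      unfolding vm_simple_add[OF s(1) t(1)] by (intro tendsto_add s t)
    show "(\<lambda>n. \<integral>\<^sup>+\<omega>. ennreal (norm (s n \<omega> + t n \<omega> - (Y \<omega> + Z \<omega>))) \<partial>variation_measure M \<mu>) \<longlonglongrightarrow> 0"
    proof (rule tendsto_sandwich[OF _ _ tendsto_const])
      show "(\<lambda>n. (\<integral>\<^sup>+\<omega>. ennreal (norm (s n \<omega> - Y \<omega>)) \<partial>variation_measure M \<mu>) +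
          (\<integral>\<^sup>+\<omega>. ennreal (norm (t n \<omega> - Z \<omega>)) \<partial>variation_measure M \<mu>)) \<longlonglongrightarrow> 0"
        using tendsto_add[OF s(2) t(2)] by simp
      show "\<forall>\<^sub>F n in sequentially. (\<integral>\<^sup>+\<omega>. ennreal (norm (s n \<omega> + t n \<omega> - (Y \<omega> + Z \<omega>))) \<partial>variation_measure M \<mu>) \<le>
          (\<integral>\<^sup>+\<omega>. ennreal (norm (s n \<omega> - Y \<omega>)) \<partial>variation_measure M \<mu>) + (\<integral>\<^sup>+\<omega>. ennreal (norm (t n \<omega> - Z \<omega>)) \<partial>variation_measure M \<mu>)"
        by (intro always_eventually allI nn_integral_norm_triangle strongly_measurable_diff
            simple_function_imp_strongly_measurable s t Y Z norm_diff_triangle_ineq)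
    qed auto
  qed
qed

lemma has_vm_integral_norm_le:
  assumes Y: "strongly_measurable M Y" "has_vm_integral Y l"
  shows "ennreal (norm l) \<le> (\<integral>\<^sup>+\<omega>. ennreal (norm (Y \<omega>)) \<partial>variation_measure M \<mu>)"
proof -
  obtain s where s: "\<And>n. simple_function M (s n)"
    "(\<lambda>n. \<integral>\<^sup>+\<omega>. ennreal (norm (s n \<omega> - Y \<omega>)) \<partial>variation_measure M \<mu>) \<longlonglongrightarrow> 0" "(\<lambda>n. vm_simple M \<mu> (s n)) \<longlonglongrightarrow> l"
    using Y by (auto simp: has_vm_integral_def)
  show ?thesis
  proof (rule LIMSEQ_le)
    show "(\<lambda>n. ennreal (norm (vm_simple M \<mu> (s n)))) \<longlonglongrightarrow> ennreal (norm l)"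
      by (intro tendsto_ennrealI tendsto_norm s)
    show "(\<lambda>n. (\<integral>\<^sup>+\<omega>. ennreal (norm (s n \<omega> - Y \<omega>)) \<partial>variation_measure M \<mu>) + (\<integral>\<^sup>+\<omega>. ennreal (norm (Y \<omega>)) \<partial>variation_measure M \<mu>))
        \<longlonglongrightarrow> (\<integral>\<^sup>+\<omega>. ennreal (norm (Y \<omega>)) \<partial>variation_measure M \<mu>)"
      using tendsto_add[OF s(2) tendsto_const] by simp
    have "ennreal (norm (vm_simple M \<mu> (s n))) \<le> (\<integral>\<^sup>+\<omega>. ennreal (norm (s n \<omega> - Y \<omega>)) \<partial>variation_measure M \<mu>) + (\<integral>\<^sup>+\<omega>. ennreal (norm (Y \<omega>)) \<partial>variation_measure M \<mu>)" for n
    proof (rule order_trans[OF norm_vm_simple_le[OF s(1)]], rule nn_integral_norm_triangle)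
      show "norm (s n \<omega>) \<le> norm (s n \<omega> - Y \<omega>) + norm (Y \<omega>)" for \<omega>
        using norm_triangle_ineq[of "s n \<omega> - Y \<omega>" "Y \<omega>"] by simp
    qed (intro strongly_measurable_diff simple_function_imp_strongly_measurable s Y)+
    then show "\<exists>N. \<forall>n\<ge>N. ennreal (norm (vm_simple M \<mu> (s n))) \<le> (\<integral>\<^sup>+\<omega>. ennreal (norm (s n \<omega> - Y \<omega>)) \<partial>variation_measure M \<mu>) + (\<integral>\<^sup>+\<omega>. ennreal (norm (Y \<omega>)) \<partial>variation_measure M \<mu>)"
      by auto
  qed
qed

lemma has_vm_integral_uminus:
  assumes Y: "has_vm_integral Y l"
  shows "has_vm_integral (\<lambda>\<omega>. - Y \<omega>) (- l)"
proof -
  obtain s where s: "\<And>n. simple_function M (s n)"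
    "(\<lambda>n. \<integral>\<^sup>+\<omega>. ennreal (norm (s n \<omega> - Y \<omega>)) \<partial>variation_measure M \<mu>) \<longlonglongrightarrow> 0" "(\<lambda>n. vm_simple M \<mu> (s n)) \<longlonglongrightarrow> l"
    using Y by (auto simp: has_vm_integral_def)
  have zero: "simple_function M (\<lambda>_. 0 :: 'x)" by simp
  have "vm_simple M \<mu> (\<lambda>_. 0) = 0" using vm_simple_diff[OF zero zero] by simp
  then have "vm_simple M \<mu> (\<lambda>\<omega>. - s n \<omega>) = - vm_simple M \<mu> (s n)" for n
    using vm_simple_diff[OF zero s(1)] by simp
  then show ?thesis
    unfolding has_vm_integral_def using s simple_function_compose1[OF s(1), of uminus]
    by (intro exI[of _ "\<lambda>n \<omega>. - s n \<omega>"]) (auto intro: tendsto_minus simp: norm_minus_commute)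
qed

text \<open>The zero function \<open>Y - Y\<close> has the integral \<open>k - l\<close>, whose norm
  is at most the integral of \<open>0\<close>.\<close>

lemma has_vm_integral_unique:
  assumes Y: "strongly_measurable M Y" and "has_vm_integral Y k" "has_vm_integral Y l"
  shows "k = l"
proof -
  have m: "strongly_measurable M (\<lambda>\<omega>. - Y \<omega>)"
    using strongly_measurable_diff[OF simple_function_imp_strongly_measurable Y, of "\<lambda>_. 0"] by simp
  have "has_vm_integral (\<lambda>\<omega>. Y \<omega> + - Y \<omega>) (k + - l)"
    by (intro has_vm_integral_add Y m assms has_vm_integral_uminus)
  from has_vm_integral_norm_le[OF _ this] strongly_measurable_add[OF Y m] show ?thesis by simp
qed

lemma has_vm_integral_cong_AE:
  assumes "has_vm_integral Y l" "AE \<omega> in variation_measure M \<mu>. Y \<omega> = Z \<omega>"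
  shows "has_vm_integral Z l"
proof -
  have "(\<integral>\<^sup>+\<omega>. ennreal (norm (s \<omega> - Y \<omega>)) \<partial>variation_measure M \<mu>) = (\<integral>\<^sup>+\<omega>. ennreal (norm (s \<omega> - Z \<omega>)) \<partial>variation_measure M \<mu>)" for s
    using assms(2) by (intro nn_integral_cong_AE) (auto elim!: eventually_mono)
  then show ?thesis using assms(1) by (simp add: has_vm_integral_def)
qed

text \<open>Dominated convergence gives approximation in \<open>L^1\<close>; the majorant
  \<open>3 * norm (Y)\<close> is \<open>2\<close> for the truncated approximants plus
  \<open>1\<close> for \<open>Y\<close>. The integrals of the approximants are then Cauchy by
  \<open>norm_vm_simple_le\<close>.\<close>

lemma ex_has_vm_integral:
  assumes Y: "strongly_measurable M Y" and fin: "(\<integral>\<^sup>+\<omega>. ennreal (norm (Y \<omega>)) \<partial>variation_measure M \<mu>) < \<top>"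
  shows "\<exists>l. has_vm_integral Y l"
proof -
  obtain s where s: "\<And>n. simple_function M (s n)" "\<And>\<omega>. \<omega> \<in> space M \<Longrightarrow> (\<lambda>n. s n \<omega>) \<longlonglongrightarrow> Y \<omega>"
    "\<And>n \<omega>. norm (s n \<omega>) \<le> 2 * norm (Y \<omega>)"
    using strongly_measurable_approx[OF Y] by blast
  let ?I = "\<lambda>Z::'w \<Rightarrow> 'x. \<integral>\<^sup>+\<omega>. ennreal (norm (Z \<omega>)) \<partial>variation_measure M \<mu>"
  note sm = simple_function_imp_strongly_measurable[OF s(1)]
  have lim: "(\<lambda>n. ?I (\<lambda>\<omega>. s n \<omega> - Y \<omega>)) \<longlonglongrightarrow> (\<integral>\<^sup>+\<omega>. 0 \<partial>variation_measure M \<mu>)"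
  proof (rule nn_integral_dominated_convergence[where w="\<lambda>\<omega>. 3 * ennreal (norm (Y \<omega>))"])
    show "AE \<omega> in variation_measure M \<mu>. ennreal (norm (s n \<omega> - Y \<omega>)) \<le> 3 * ennreal (norm (Y \<omega>))" for n
    proof (rule AE_I2)
      fix \<omega>
      have "norm (s n \<omega> - Y \<omega>) \<le> 3 * norm (Y \<omega>)"
        using norm_triangle_ineq4[of "s n \<omega>" "Y \<omega>"] s(3)[of n \<omega>] by linarith
      then have "ennreal (norm (s n \<omega> - Y \<omega>)) \<le> ennreal (3 * norm (Y \<omega>))" by (rule ennreal_leI)
      then show "ennreal (norm (s n \<omega> - Y \<omega>)) \<le> 3 * ennreal (norm (Y \<omega>))" by (simp add: ennreal_mult)
    qed
    show "(\<integral>\<^sup>+\<omega>. 3 * ennreal (norm (Y \<omega>)) \<partial>variation_measure M \<mu>) < \<infinity>"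
      using fin by (simp add: nn_integral_cmult[OF borel_measurable_ennreal_norm[OF Y]] ennreal_mult_less_top)
    show "AE \<omega> in variation_measure M \<mu>. (\<lambda>n. ennreal (norm (s n \<omega> - Y \<omega>))) \<longlonglongrightarrow> 0"
    proof (rule AE_I2)
      fix \<omega> assume "\<omega> \<in> space (variation_measure M \<mu>)"
      then have "(\<lambda>n. s n \<omega> - Y \<omega>) \<longlonglongrightarrow> 0" using s(2) by (intro LIM_zero) simp
      then show "(\<lambda>n. ennreal (norm (s n \<omega> - Y \<omega>))) \<longlonglongrightarrow> 0"
        using tendsto_ennrealI[OF tendsto_norm_zero] by fastforce
    qed
    show "(\<lambda>\<omega>. ennreal (norm (s n \<omega> - Y \<omega>))) \<in> borel_measurable (variation_measure M \<mu>)" for n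
      by (intro borel_measurable_ennreal_norm strongly_measurable_diff sm Y)
    show "(\<lambda>\<omega>. 3 * ennreal (norm (Y \<omega>))) \<in> borel_measurable (variation_measure M \<mu>)"
      by (intro borel_measurable_times_ennreal borel_measurable_const borel_measurable_ennreal_norm Y)
  qed simp
  have "Cauchy (\<lambda>n. vm_simple M \<mu> (s n))"
  proof (rule CauchyI)
    fix e :: real assume e: "0 < e"
    have "\<forall>\<^sub>F n in sequentially. ?I (\<lambda>\<omega>. s n \<omega> - Y \<omega>) < ennreal (e / 2)"
      using lim e by (intro order_tendstoD(2)[OF lim]) simp
    then obtain N where N: "\<And>n. n \<ge> N \<Longrightarrow> ?I (\<lambda>\<omega>. s n \<omega> - Y \<omega>) < ennreal (e / 2)"
      by (auto simp: eventually_sequentially)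
    show "\<exists>N. \<forall>m\<ge>N. \<forall>n\<ge>N. norm (vm_simple M \<mu> (s m) - vm_simple M \<mu> (s n)) < e"
    proof (intro exI allI impI)
      fix m n assume mn: "N \<le> m" "N \<le> n"
      have "ennreal (norm (vm_simple M \<mu> (s m) - vm_simple M \<mu> (s n))) \<le> ?I (\<lambda>\<omega>. s m \<omega> - s n \<omega>)"
        unfolding vm_simple_diff[OF s(1) s(1), symmetric] by (intro norm_vm_simple_le simple_function_diff s)
      also have "\<dots> \<le> ?I (\<lambda>\<omega>. s m \<omega> - Y \<omega>) + ?I (\<lambda>\<omega>. s n \<omega> - Y \<omega>)"
      proof (rule nn_integral_norm_triangle)
        show "norm (s m \<omega> - s n \<omega>) \<le> norm (s m \<omega> - Y \<omega>) + norm (s n \<omega> - Y \<omega>)" for \<omega>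
          using norm_triangle_ineq4[of "s m \<omega> - Y \<omega>" "s n \<omega> - Y \<omega>"] by simp
      qed (intro strongly_measurable_diff sm Y)+
      also have "\<dots> < ennreal (e / 2) + ennreal (e / 2)"
        using N[OF mn(1)] N[OF mn(2)] by (rule add_strict_mono)
      also have "\<dots> = ennreal e" using e by (simp add: ennreal_plus[symmetric] del: ennreal_plus)
      finally show "norm (vm_simple M \<mu> (s m) - vm_simple M \<mu> (s n)) < e"
        by (simp add: ennreal_less_iff)
    qed
  qed
  then obtain l where "(\<lambda>n. vm_simple M \<mu> (s n)) \<longlonglongrightarrow> l" using Cauchy_convergent convergent_def by blast
  then show ?thesis using lim s(1) unfolding has_vm_integral_def by auto
qed

end

subsection \<open>The dual space and its representing measures\<close>

text \<open>Transport of structure along a linear map \<open>g\<close> with inverse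
  \<open>f\<close>. The norm axioms and completeness of \<open>V\<close> are read off from
  \<open>W\<close>, because \<open>NV\<close> agrees with \<open>NW\<close> along
  \<open>g\<close>.\<close>

lemma isometric_transfer:
  fixes g :: "'w::ab_group_add \<Rightarrow> 'v::ab_group_add" and f :: "'v \<Rightarrow> 'w"
  assumes W: "banach_space_on sW W NW" and vs: "vector_space sV" and V: "V = g ` W"
    and add: "\<And>a b. a \<in> W \<Longrightarrow> b \<in> W \<Longrightarrow> g (a + b) = g a + g b"
    and scale: "\<And>c a. a \<in> W \<Longrightarrow> g (sW c a) = sV c (g a)"
    and N: "\<And>a. a \<in> W \<Longrightarrow> NV (g a) = NW a" and inv: "\<And>a. a \<in> W \<Longrightarrow> f (g a) = a"
  shows "banach_space_on sV V NV \<and> isometric_isomorphism sV V NV sW W NW f"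
proof -
  interpret W: banach_space_on sW W NW by fact
  interpret V: vector_space sV by fact
  note clW = W.subspace_add[OF W.subspace_carrier] W.subspace_scale[OF W.subspace_carrier]
    W.subspace_0[OF W.subspace_carrier] W.subspace_diff[OF W.subspace_carrier]
  have g0: "g 0 = 0" using scale[OF clW(3), of 0] by simp
  have diff: "g (a - b) = g a - g b" if "a \<in> W" "b \<in> W" for a b
    using add[OF clW(4)[OF that] that(2)] by simp
  have fV: "f v \<in> W" "g (f v) = v" if "v \<in> V" for v using that inv by (auto simp: V)
  have nV: "normed_space_on sV V NV"
  proof
    show "V.subspace V"
    proof (rule V.subspaceI)
      show "0 \<in> V" using g0 clW(3) by (force simp: V)
      show "x + y \<in> V" if xy: "x \<in> V" "y \<in> V" for x y
      proof -
        obtain a b where ab: "a \<in> W" "x = g a" "b \<in> W" "y = g b" using xy by (auto simp: V)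
        then show ?thesis unfolding V using add[OF ab(1,3), symmetric] clW(1)[OF ab(1,3)] by simp
      qed
      show "sV c x \<in> V" if "x \<in> V" for c x
      proof -
        obtain a where a: "a \<in> W" "x = g a" using \<open>x \<in> V\<close> by (auto simp: V)
        then show ?thesis unfolding V using scale[OF a(1), of c, symmetric] clW(2)[OF a(1), of c] by simp
      qed
    qed
    show "0 \<le> NV v" if "v \<in> V" for v using that W.N_nonneg by (auto simp: V N)
    show "NV v = 0 \<longleftrightarrow> v = 0" if "v \<in> V" for v
    proof -
      obtain a where a: "a \<in> W" "v = g a" using \<open>v \<in> V\<close> by (auto simp: V)
      have "v = 0 \<longleftrightarrow> a = 0" using a inv[OF a(1)] inv[OF clW(3)] g0 by metis
      then show ?thesis using a W.N_eq_0_iff[OF a(1)] by (simp add: N)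
    qed
    show "NV (v + w) \<le> NV v + NV w" if "v \<in> V" "w \<in> V" for v w
      using that W.N_triangle by (auto simp: V N clW add[symmetric])
    show "NV (sV c v) = norm c * NV v" if "v \<in> V" for c v
      using that W.N_scale by (auto simp: V N clW scale[symmetric])
  qed
  moreover have "banach_space_on sV V NV"
  proof -
    interpret V: normed_space_on sV V NV by fact
    show ?thesis
    proof
      fix s :: "nat \<Rightarrow> 'v"
      assume s: "\<And>n. s n \<in> V" and Cauchy: "\<And>e. 0 < e \<Longrightarrow> \<exists>n0. \<forall>m\<ge>n0. \<forall>n\<ge>n0. NV (s m - s n) < e"
      have sg: "s n - g a = g (f (s n) - a)" if "a \<in> W" for n a
        using fV[OF s] that by (simp add: diff)
      have "NV (s m - s n) = NW (f (s m) - f (s n))" for m n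
        using sg[OF fV(1)[OF s[of n]], of m] fV[OF s] by (simp add: N clW)
      then have "\<exists>n0. \<forall>m\<ge>n0. \<forall>n\<ge>n0. NW (f (s m) - f (s n)) < e" if "0 < e" for e
        using Cauchy[OF that] by simp
      then obtain a where a: "a \<in> W" "(\<lambda>n. NW (f (s n) - a)) \<longlonglongrightarrow> 0"
        using W.complete_carrier[of "\<lambda>n. f (s n)"] fV(1)[OF s] by blast
      then show "\<exists>v\<in>V. (\<lambda>n. NV (s n - v)) \<longlonglongrightarrow> 0"
        using fV(1)[OF s] by (intro bexI[of _ "g a"]) (auto simp: sg N clW V)
    qed
  qed
  moreover have "isometric_isomorphism sV V NV sW W NW f"
    unfolding isometric_isomorphism_def
  proof (intro conjI ballI allI)
    show "normed_space_on sV V NV" by fact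
    show "normed_space_on sW W NW" by (rule W.normed_space_on_axioms)
    show "bij_betw f V W" using inv by (intro bij_betw_byWitness[of _ g]) (auto simp: V)
    show "f (v + w) = f v + f w" if "v \<in> V" "w \<in> V" for v w
      using that by (auto simp: V inv clW add[symmetric])
    show "f (sV c v) = sW c (f v)" if "v \<in> V" for c v
      using that by (auto simp: V inv clW scale[symmetric])
    show "NW (f v) = NV v" if "v \<in> V" for v
      using that by (auto simp: V inv N)
  qed
  ultimately show ?thesis by blast
qed

lemma vector_space_functional_scale: "vector_space (functional_scale :: 'k::real_or_complex \<Rightarrow> ('c \<Rightarrow> 'k) \<Rightarrow> _)"
  by unfold_locales (auto simp: functional_scale_def fun_eq_iff algebra_simps)

lemma vector_space_measure_scale:
  "vector_space (measure_scale :: 'k::real_or_complex \<Rightarrow> ('w set \<Rightarrow> 'x::banach \<Rightarrow>\<^sub>L 'k) \<Rightarrow> _)"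
  by unfold_locales (auto simp: measure_scale_def fun_eq_iff blinfun.add_left intro!: blinfun_eqI simp: algebra_simps)

lemma ae_class_eqI:
  "AE \<omega> in M. Y \<omega> = Z \<omega> \<Longrightarrow> ae_class M Y = ae_class M Z"
  by (auto simp: ae_class_def elim: eventually_elim2)

lemma ae_class_self: "strongly_measurable M Y \<Longrightarrow> Y \<in> ae_class M Y"
  by (simp add: ae_class_def)

context distortion_space
begin

text \<open>The variation is finite, so its Radon-Nikodym derivative is finite almost everywhere,
  and encoding it as a scalar function through \<open>enn2real\<close> and \<open>of_real\<close>
  loses nothing.\<close>

lemma nn_integral_variation_measure:
  fixes \<mu> :: "'w set \<Rightarrow> 'x::banach \<Rightarrow>\<^sub>L 'k::real_or_complex"
  assumes \<mu>: "additive_set_function M \<mu>" and fin: "variation M \<mu> (space M) < \<top>"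
    and ac: "absolutely_continuous M (variation_measure M \<mu>)" and f: "f \<in> borel_measurable M"
  shows "(\<integral>\<^sup>+\<omega>. f \<omega> \<partial>variation_measure M \<mu>) = (\<integral>\<^sup>+\<omega>. ennreal (norm (variation_density M \<mu> \<omega>)) * f \<omega> \<partial>M)"
proof -
  interpret additive_set_function M \<mu> by fact
  have "finite_measure (variation_measure M \<mu>)"
    using fin by (intro finite_measureI) (simp add: emeasure_variation_measure)
  then interpret N: finite_measure "variation_measure M \<mu>" .
  have "AE \<omega> in M. RN_deriv M (variation_measure M \<mu>) \<omega> \<noteq> \<infinity>"
    by (rule RN_deriv_finite[OF _ ac]) (auto intro: N.sigma_finite_measure_axioms)
  then have eq: "AE \<omega> in M. RN_deriv M (variation_measure M \<mu>) \<omega> = ennreal (norm (variation_density M \<mu> \<omega>))"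
    by eventually_elim (simp add: variation_density_def less_top)
  have "(\<integral>\<^sup>+\<omega>. f \<omega> \<partial>variation_measure M \<mu>) = (\<integral>\<^sup>+\<omega>. RN_deriv M (variation_measure M \<mu>) \<omega> * f \<omega> \<partial>M)"
    by (rule RN_deriv_nn_integral[OF ac]) (auto simp: f)
  also have "\<dots> = (\<integral>\<^sup>+\<omega>. ennreal (norm (variation_density M \<mu> \<omega>)) * f \<omega> \<partial>M)"
    using eq by (intro nn_integral_cong_AE) (auto elim!: eventually_mono)
  finally show ?thesis .
qed

lemma borel_measurable_variation_density:
  "variation_density M (\<mu> :: 'w set \<Rightarrow> 'x::banach \<Rightarrow>\<^sub>L 'k::real_or_complex) \<in> borel_measurable M"
  unfolding variation_density_def by measurable

end

section \<open>The vector-valued function space and its dual as a Banach space\<close>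

locale star_duality = distortion_space M \<sigma> + scalar_banach smul
  for M :: "'w measure" and \<sigma> :: "real \<Rightarrow> real" and smul :: "'k::real_or_complex \<Rightarrow> 'x::banach \<Rightarrow> 'x" +
  fixes p :: real
  assumes p: "1 \<le> p"
begin

abbreviation "SF \<equiv> (sigma_fun M \<sigma> p :: ('w \<Rightarrow> 'x) set)"
abbreviation "Dual \<equiv> sigma_dual smul M \<sigma> p"
abbreviation "mom \<equiv> sigma_moment M \<sigma> p"
abbreviation "dnorm \<equiv> (sigma_dual_norm M \<sigma> p :: (('w \<Rightarrow> 'x) set \<Rightarrow> 'k) \<Rightarrow> real)"
abbreviation "cls \<equiv> (ae_class M :: ('w \<Rightarrow> 'x) \<Rightarrow> _)"

lemma p0: "0 < p" "0 \<le> p" using p by auto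

lemma sigma_fun_iff: "Y \<in> sigma_fun M \<sigma> p \<longleftrightarrow> strongly_measurable M Y \<and> mom Y < \<top>"
  by (simp add: sigma_fun_def sigma_norm_less_top_iff)

lemma sigma_fun_norm: "Y \<in> SF \<Longrightarrow> (\<lambda>\<omega>. norm (Y \<omega>)) \<in> borel_measurable M"
  by (auto simp: sigma_fun_iff intro: borel_measurable_norm_strongly_measurable)

lemma bounded_linear_smul: "bounded_linear (smul c)"
proof (rule bounded_linear_intro[where K="norm c"])
  show "smul c (r *\<^sub>R x) = r *\<^sub>R smul c x" for r x
    by (simp add: scale_of_real[symmetric] mult.commute)
qed (auto simp: scale_right_distrib norm_scale mult.commute)

lemma smul_scaleR: "smul c (r *\<^sub>R x) = r *\<^sub>R smul c x"
  by (rule linear_scale[OF bounded_linear.linear[OF bounded_linear_smul]])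

lemma strongly_measurable_smul: "strongly_measurable M Y \<Longrightarrow> strongly_measurable M (\<lambda>\<omega>. smul c (Y \<omega>))"
  using strongly_measurable_compose2[of M Y Y "\<lambda>x y. smul c x"] bounded_linear.tendsto[OF bounded_linear_smul] by blast

lemma sigma_fun_smul:
  assumes "Y \<in> SF" shows "(\<lambda>\<omega>. smul c (Y \<omega>)) \<in> SF"
  using assms sigma_moment_scale[OF sigma_fun_norm[OF assms], of "\<lambda>\<omega>. smul c (Y \<omega>)" "norm c" p]
  by (auto simp: sigma_fun_iff norm_scale ennreal_mult_less_top intro: strongly_measurable_smul)

lemma sigma_fun_add:
  assumes "Y \<in> SF" "Z \<in> SF" shows "(\<lambda>\<omega>. Y \<omega> + Z \<omega>) \<in> SF"
proof -
  have "mom (\<lambda>\<omega>. Y \<omega> + Z \<omega>) \<le> ennreal (2 powr p) * (mom Y + mom Z)"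
    using assms p0 by (intro sigma_moment_add_le sigma_fun_norm)
  also have "\<dots> < \<top>" using assms by (auto simp: sigma_fun_iff ennreal_mult_less_top)
  finally show ?thesis using assms by (auto simp: sigma_fun_iff intro: strongly_measurable_add)
qed

lemma sigma_fun_diff:
  assumes "Y \<in> SF" "Z \<in> SF" shows "(\<lambda>\<omega>. Y \<omega> - Z \<omega>) \<in> SF"
  using sigma_fun_add[OF assms(1) sigma_fun_smul[OF assms(2), of "-1"]] by simp

lemma sigma_moment_le:
  fixes Y :: "'w \<Rightarrow> 'y::real_normed_vector"
  assumes "\<And>\<omega>. \<omega> \<in> space M \<Longrightarrow> norm (Y \<omega>) \<le> C" "0 \<le> C"
  shows "mom Y \<le> ennreal (C powr p)"
proof -
  have "mom Y \<le> mom (\<lambda>\<omega>. C)" using assms p0 by (intro sigma_moment_mono) auto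
  also have "\<dots> = ennreal (C powr p) * mom (\<lambda>\<omega>. 1::real)"
    using assms by (intro sigma_moment_scale) auto
  also have "\<dots> \<le> ennreal (C powr p) * 1"
    using p0 by (intro mult_left_mono sigma_moment_le_1) auto
  finally show ?thesis by simp
qed

lemma sigma_fun_simple:
  assumes s: "simple_function M s" shows "s \<in> SF"
proof -
  let ?C = "Max (insert 0 (norm ` s ` space M))"
  have fin: "finite (insert 0 (norm ` s ` space M))" using simple_functionD(1)[OF s] by simp
  have "mom s \<le> ennreal (?C powr p)"
    using fin by (intro sigma_moment_le Max_ge) auto
  then show ?thesis
    using s by (auto simp: sigma_fun_iff intro: simple_function_imp_strongly_measurable le_less_trans)
qed

lemma sigma_fun_indicator: "E \<in> sets M \<Longrightarrow> (\<lambda>\<omega>. indicator E \<omega> *\<^sub>R x) \<in> SF"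
  by (intro sigma_fun_simple simple_function_compose1[where f="indicator E" and g="\<lambda>r::real. r *\<^sub>R x"]) simp

lemma ex_moment_bound:
  assumes "Y \<in> SF" shows "\<exists>b\<ge>0. mom Y \<le> ennreal (b powr p) \<and> enn2real (sigma_norm M \<sigma> p Y) = b"
proof (intro exI conjI)
  have "sigma_norm M \<sigma> p Y < \<top>" using assms by (simp add: sigma_fun_def)
  then have "sigma_norm M \<sigma> p Y \<le> ennreal (enn2real (sigma_norm M \<sigma> p Y))" by simp
  then show "mom Y \<le> ennreal (enn2real (sigma_norm M \<sigma> p Y) powr p)"
    using p0 by (subst (asm) sigma_norm_le_iff) auto
qed auto

lemma dualD:
  assumes "\<phi> \<in> Dual"
  shows "C \<notin> sigma_space M \<sigma> p \<Longrightarrow> \<phi> C = 0"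
    "Y \<in> SF \<Longrightarrow> Z \<in> SF \<Longrightarrow> \<phi> (cls (\<lambda>\<omega>. Y \<omega> + Z \<omega>)) = \<phi> (cls Y) + \<phi> (cls Z)"
    "Y \<in> SF \<Longrightarrow> \<phi> (cls (\<lambda>\<omega>. smul c (Y \<omega>))) = c * \<phi> (cls Y)"
    "\<exists>B. \<forall>Y\<in>SF. norm (\<phi> (cls Y)) \<le> B * enn2real (sigma_norm M \<sigma> p Y)"
  using assms unfolding sigma_dual_def by blast+

lemma zero_SF: "(\<lambda>\<omega>. 0) \<in> SF" by (intro sigma_fun_simple) simp

lemma dual_diff:
  assumes "\<phi> \<in> Dual" "Y \<in> SF" "Z \<in> SF"
  shows "\<phi> (cls (\<lambda>\<omega>. Y \<omega> - Z \<omega>)) = \<phi> (cls Y) - \<phi> (cls Z)"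
  using dualD(2)[OF assms(1,2) sigma_fun_smul[OF assms(3), of "-1"]] dualD(3)[OF assms(1,3), of "-1"] by simp

lemma dual_zero: "\<phi> \<in> Dual \<Longrightarrow> \<phi> (cls (\<lambda>\<omega>. 0)) = 0"
  using dual_diff[OF _ zero_SF zero_SF] by simp

lemma dual_sum:
  assumes "\<phi> \<in> Dual" "finite J" "\<And>j. j \<in> J \<Longrightarrow> Y j \<in> SF"
  shows "(\<lambda>\<omega>. \<Sum>j\<in>J. Y j \<omega>) \<in> SF \<and> \<phi> (cls (\<lambda>\<omega>. \<Sum>j\<in>J. Y j \<omega>)) = (\<Sum>j\<in>J. \<phi> (cls (Y j)))"
  using assms(2,3)
  by (induction J) (auto simp: zero_SF dual_zero[OF assms(1)] sigma_fun_add dualD(2)[OF assms(1)])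

lemma sigma_norm_le_1_iff: "sigma_norm M \<sigma> p Y \<le> 1 \<longleftrightarrow> mom Y \<le> 1"
  using sigma_norm_le_iff[OF p0(1), of 1 M \<sigma> Y] by simp

lemma dnorm_upper:
  assumes \<phi>: "\<phi> \<in> Dual" and Y: "Y \<in> SF" "mom Y \<le> 1"
  shows "norm (\<phi> (cls Y)) \<le> dnorm \<phi>"
  unfolding sigma_dual_norm_def
proof (rule cSUP_upper)
  show "Y \<in> {Y \<in> SF. sigma_norm M \<sigma> p Y \<le> 1}" using Y by (simp add: sigma_norm_le_1_iff)
  obtain B where B: "\<And>Y. Y \<in> SF \<Longrightarrow> norm (\<phi> (cls Y)) \<le> B * enn2real (sigma_norm M \<sigma> p Y)"
    using dualD(4)[OF \<phi>] by blast
  show "bdd_above ((\<lambda>Y. norm (\<phi> (cls Y))) ` {Y \<in> SF. sigma_norm M \<sigma> p Y \<le> 1})"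
  proof (rule bdd_aboveI2)
    fix Z assume Z: "Z \<in> {Y \<in> SF. sigma_norm M \<sigma> p Y \<le> 1}"
    have "enn2real (sigma_norm M \<sigma> p Z) \<le> 1"
      using Z by (auto intro: enn2real_leI)
    \<comment> \<open>\<open>B\<close> may be negative, hence the absolute value.\<close>
    then have "B * enn2real (sigma_norm M \<sigma> p Z) \<le> \<bar>B\<bar> * 1"
      by (intro mult_mono) auto
    then show "norm (\<phi> (cls Z)) \<le> \<bar>B\<bar>" using B[of Z] Z by simp
  qed
qed

lemma dnorm_least:
  assumes "\<And>Y. Y \<in> SF \<Longrightarrow> mom Y \<le> 1 \<Longrightarrow> norm (\<phi> (cls Y)) \<le> D"
  shows "dnorm \<phi> \<le> D"
  unfolding sigma_dual_norm_def
proof (rule cSUP_least)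
  have "(\<lambda>\<omega>. 0) \<in> {Y \<in> SF. sigma_norm M \<sigma> p Y \<le> 1}"
    using zero_SF sigma_moment_le[of "\<lambda>_. 0::'x" 0] p0 by (simp add: sigma_norm_le_1_iff)
  then show "{Y \<in> SF. sigma_norm M \<sigma> p Y \<le> 1} \<noteq> {}" by blast
qed (use assms in \<open>auto simp: sigma_norm_le_1_iff\<close>)

lemma dnorm_nonneg: "\<phi> \<in> Dual \<Longrightarrow> 0 \<le> dnorm \<phi>"
  using dnorm_upper[OF _ zero_SF] sigma_moment_le[of "\<lambda>_. 0::'x" 0] p0 by (simp add: dual_zero)

text \<open>Rescale \<open>Y\<close> by \<open>1 / c\<close> into the unit ball. As \<open>b\<close>
  may be \<open>0\<close>, this is done for positive \<open>c \<ge> b\<close>, and then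
  \<open>c\<close> decreases to \<open>b\<close>.\<close>

lemma dual_apply_le:
  assumes \<phi>: "\<phi> \<in> Dual" and Y: "Y \<in> SF" and b: "0 \<le> b" "mom Y \<le> ennreal (b powr p)"
  shows "norm (\<phi> (cls Y)) \<le> dnorm \<phi> * b"
proof -
  have *: "norm (\<phi> (cls Y)) \<le> dnorm \<phi> * c" if c: "b \<le> c" "0 < c" for c
  proof -
    let ?Z = "\<lambda>\<omega>. smul (of_real (1 / c)) (Y \<omega>)"
    have "mom ?Z = ennreal ((1 / c) powr p) * mom Y"
      using c by (intro sigma_moment_scale sigma_fun_norm Y) (auto simp: norm_scale norm_divide)
    also have "\<dots> \<le> ennreal ((1 / c) powr p) * ennreal (c powr p)"
      using b c p0 by (intro mult_left_mono order_trans[OF b(2)] ennreal_leI powr_mono2) auto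
    also have "\<dots> = 1" using c by (simp add: ennreal_mult[symmetric] powr_mult[symmetric])
    finally have "norm (\<phi> (cls ?Z)) \<le> dnorm \<phi>" by (intro dnorm_upper \<phi> sigma_fun_smul Y)
    then show ?thesis using c by (simp add: dualD(3)[OF \<phi> Y] norm_mult norm_divide field_simps)
  qed
  have "(\<lambda>n. dnorm \<phi> * (b + inverse (real (Suc n)))) \<longlonglongrightarrow> dnorm \<phi> * (b + 0)"
    by (intro tendsto_intros LIMSEQ_inverse_real_of_nat)
  then have lim: "(\<lambda>n. dnorm \<phi> * (b + inverse (real (Suc n)))) \<longlonglongrightarrow> dnorm \<phi> * b" by simp
  show ?thesis
    by (rule LIMSEQ_le_const[OF lim]) (use b in \<open>auto intro!: * add_nonneg_pos\<close>)
qed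

lemma ex_null_bounds:
  assumes "(\<lambda>n. mom (Z n)) \<longlonglongrightarrow> 0" "\<And>n. mom (Z n) < \<top>"
  shows "\<exists>b. (\<forall>n::nat. 0 \<le> b n \<and> mom (Z n) \<le> ennreal (b n powr p)) \<and> b \<longlonglongrightarrow> 0"
proof (intro exI[of _ "\<lambda>n. enn2real (mom (Z n)) powr (1 / p)"] conjI allI)
  show "mom (Z n) \<le> ennreal ((enn2real (mom (Z n)) powr (1 / p)) powr p)" for n
    using p0 assms(2)[of n] by (simp add: powr_powr)
  have "(\<lambda>n. enn2real (mom (Z n))) \<longlonglongrightarrow> 0"
    using tendsto_enn2real[of "\<lambda>n. mom (Z n)" 0] assms(1) by simp
  then have "(\<lambda>n. enn2real (mom (Z n)) powr (1 / p)) \<longlonglongrightarrow> 0 powr (1 / p)"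
    using p0 by (intro tendsto_powr2) auto
  then show "(\<lambda>n. enn2real (mom (Z n)) powr (1 / p)) \<longlonglongrightarrow> 0" by simp
qed simp

lemma dual_ext:
  assumes "\<phi> \<in> Dual" "\<psi> \<in> Dual" "\<And>Y. Y \<in> SF \<Longrightarrow> \<phi> (cls Y) = \<psi> (cls Y)"
  shows "\<phi> = \<psi>"
proof
  fix C
  show "\<phi> C = \<psi> C"
  proof (cases "C \<in> sigma_space M \<sigma> p")
    case True
    then show ?thesis using assms(3) by (auto simp: sigma_space_def)
  next
    case False
    then show ?thesis using dualD(1) assms by metis
  qed
qed

lemma dualI:
  assumes "\<And>C. C \<notin> sigma_space M \<sigma> p \<Longrightarrow> \<phi> C = 0"
    "\<And>Y Z. Y \<in> SF \<Longrightarrow> Z \<in> SF \<Longrightarrow> \<phi> (cls (\<lambda>\<omega>. Y \<omega> + Z \<omega>)) = \<phi> (cls Y) + \<phi> (cls Z)"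
    "\<And>Y c. Y \<in> SF \<Longrightarrow> \<phi> (cls (\<lambda>\<omega>. smul c (Y \<omega>))) = c * \<phi> (cls Y)"
    "\<And>Y b. Y \<in> SF \<Longrightarrow> 0 \<le> b \<Longrightarrow> mom Y \<le> ennreal (b powr p) \<Longrightarrow> norm (\<phi> (cls Y)) \<le> B * b"
  shows "\<phi> \<in> Dual"
proof -
  have "norm (\<phi> (cls Y)) \<le> B * enn2real (sigma_norm M \<sigma> p Y)" if Y: "Y \<in> SF" for Y
    using ex_moment_bound[OF Y] assms(4)[OF Y] by auto
  then show ?thesis using assms(1-3) unfolding sigma_dual_def by blast
qed

lemma dual_add: "\<phi> \<in> Dual \<Longrightarrow> \<psi> \<in> Dual \<Longrightarrow> \<phi> + \<psi> \<in> Dual"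
proof (rule dualI[where B="dnorm \<phi> + dnorm \<psi>"])
  assume *: "\<phi> \<in> Dual" "\<psi> \<in> Dual"
  fix Y b assume "Y \<in> SF" "(0::real) \<le> b" "mom Y \<le> ennreal (b powr p)"
  then show "norm ((\<phi> + \<psi>) (cls Y)) \<le> (dnorm \<phi> + dnorm \<psi>) * b"
    using norm_triangle_ineq[of "\<phi> (cls Y)" "\<psi> (cls Y)"] dual_apply_le[OF *(1), of Y b] dual_apply_le[OF *(2), of Y b]
    by (simp add: distrib_right)
qed (auto simp: dualD algebra_simps)

lemma dual_scale: "\<phi> \<in> Dual \<Longrightarrow> functional_scale c \<phi> \<in> Dual"
proof (rule dualI[where B="norm c * dnorm \<phi>"])
  assume *: "\<phi> \<in> Dual"
  fix Y b assume "Y \<in> SF" "(0::real) \<le> b" "mom Y \<le> ennreal (b powr p)"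
  then show "norm (functional_scale c \<phi> (cls Y)) \<le> norm c * dnorm \<phi> * b"
    using dual_apply_le[OF *, of Y b] by (simp add: functional_scale_def norm_mult mult.assoc mult_left_mono)
qed (auto simp: dualD functional_scale_def algebra_simps)

lemma dual_0: "0 \<in> Dual"
  by (rule dualI[where B=0]) auto

lemma dual_minus: "\<phi> \<in> Dual \<Longrightarrow> \<psi> \<in> Dual \<Longrightarrow> \<phi> - \<psi> \<in> Dual"
  using dual_add[OF _ dual_scale[of \<psi> "-1"], of \<phi>] by (simp add: functional_scale_def plus_fun_def fun_diff_def)

lemma dnorm_scale_le: "\<phi> \<in> Dual \<Longrightarrow> dnorm (functional_scale c \<phi>) \<le> norm c * dnorm \<phi>"
  by (intro dnorm_least) (auto simp: functional_scale_def norm_mult intro!: mult_left_mono dnorm_upper)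

lemma dual_normed_space: "normed_space_on functional_scale Dual dnorm"
proof -
  interpret F: vector_space "functional_scale :: 'k \<Rightarrow> (('w \<Rightarrow> 'x) set \<Rightarrow> 'k) \<Rightarrow> _"
    by (rule vector_space_functional_scale)
  show ?thesis
  proof
    show "F.subspace Dual" by (intro F.subspaceI dual_0 dual_add dual_scale)
    fix \<phi> assume \<phi>: "\<phi> \<in> Dual"
    show "0 \<le> dnorm \<phi>" by (rule dnorm_nonneg[OF \<phi>])
    show "dnorm \<phi> = 0 \<longleftrightarrow> \<phi> = 0"
    proof
      assume 0: "dnorm \<phi> = 0"
      show "\<phi> = 0"
      proof (rule dual_ext[OF \<phi> dual_0])
        fix Y assume Y: "Y \<in> SF"
        obtain b where "0 \<le> b" "mom Y \<le> ennreal (b powr p)" using ex_moment_bound[OF Y] by blast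
        then show "\<phi> (cls Y) = 0 (cls Y)" using dual_apply_le[OF \<phi> Y, of b] 0 by simp
      qed
    next
      assume "\<phi> = 0"
      then have "dnorm \<phi> \<le> 0" by (intro dnorm_least) simp
      then show "dnorm \<phi> = 0" using dnorm_nonneg[OF \<phi>] by simp
    qed
    show "dnorm (\<phi> + \<psi>) \<le> dnorm \<phi> + dnorm \<psi>" if \<psi>: "\<psi> \<in> Dual" for \<psi>
    proof (rule dnorm_least)
      fix Y assume "Y \<in> SF" "mom Y \<le> 1"
      then show "norm ((\<phi> + \<psi>) (cls Y)) \<le> dnorm \<phi> + dnorm \<psi>"
        using norm_triangle_ineq[of "\<phi> (cls Y)" "\<psi> (cls Y)"] dnorm_upper[OF \<phi>, of Y] dnorm_upper[OF \<psi>, of Y] by simp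
    qed
    show "dnorm (functional_scale c \<phi>) = norm c * dnorm \<phi>" for c
    proof (cases "c = 0")
      case True
      then show ?thesis
        using dnorm_scale_le[OF \<phi>, of 0] dnorm_nonneg[OF dual_scale[OF \<phi>], of 0] by simp
    next
      case False
      have "dnorm \<phi> = dnorm (functional_scale (inverse c) (functional_scale c \<phi>))"
        using False by simp
      also have "\<dots> \<le> norm (inverse c) * dnorm (functional_scale c \<phi>)"
        by (rule dnorm_scale_le[OF dual_scale[OF \<phi>]])
      finally have "norm c * dnorm \<phi> \<le> norm c * (norm (inverse c) * dnorm (functional_scale c \<phi>))"
        by (rule mult_left_mono) simp
      then have "norm c * dnorm \<phi> \<le> norm (c * inverse c) * dnorm (functional_scale c \<phi>)"
        by (simp only: norm_mult mult.assoc)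
      then have "norm c * dnorm \<phi> \<le> dnorm (functional_scale c \<phi>)" using False by simp
      then show ?thesis using dnorm_scale_le[OF \<phi>, of c] by simp
    qed
  qed
qed

lemma dual_banach_space: "banach_space_on functional_scale Dual dnorm"
proof -
  interpret F: normed_space_on functional_scale Dual dnorm by (rule dual_normed_space)
  show ?thesis
  proof
    fix s :: "nat \<Rightarrow> ('w \<Rightarrow> 'x) set \<Rightarrow> 'k"
    assume s: "\<And>n. s n \<in> Dual" and Cau: "\<And>e. 0 < e \<Longrightarrow> \<exists>n0. \<forall>m\<ge>n0. \<forall>n\<ge>n0. dnorm (s m - s n) < e"
    have le: "norm (s m (cls Y) - s n (cls Y)) \<le> dnorm (s m - s n) * b"
      if "Y \<in> SF" "0 \<le> b" "mom Y \<le> ennreal (b powr p)" for m n Y b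
      using dual_apply_le[OF dual_minus[OF s s] that, of m n] by simp
    have "\<exists>l. (\<lambda>n. s n C) \<longlonglongrightarrow> l" for C
    proof (cases "C \<in> sigma_space M \<sigma> p")
      case True
      then obtain Y where Y: "Y \<in> SF" "C = cls Y" by (auto simp: sigma_space_def)
      obtain b where b: "0 \<le> b" "mom Y \<le> ennreal (b powr p)" using ex_moment_bound[OF Y(1)] by blast
      have "Cauchy (\<lambda>n. s n C)"
      proof (rule CauchyI)
        fix e :: real assume e: "0 < e"
        then obtain n0 where n0: "\<And>m n. n0 \<le> m \<Longrightarrow> n0 \<le> n \<Longrightarrow> dnorm (s m - s n) < e / (b + 1)"
          using Cau[of "e / (b + 1)"] b by auto
        show "\<exists>n0. \<forall>m\<ge>n0. \<forall>n\<ge>n0. norm (s m C - s n C) < e"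
        proof (intro exI allI impI)
          fix m n assume "n0 \<le> m" "n0 \<le> n"
          then have "dnorm (s m - s n) * (b + 1) < e" using n0[of m n] b by (simp add: field_simps)
          moreover have "dnorm (s m - s n) * b \<le> dnorm (s m - s n) * (b + 1)"
            using dnorm_nonneg[OF dual_minus[OF s s], of m n] by (intro mult_left_mono) auto
          ultimately show "norm (s m C - s n C) < e" using le[OF Y(1) b, of m n] Y(2) by simp
        qed
      qed
      then show ?thesis using Cauchy_convergent convergent_def by blast
    next
      case False
      then have "(\<lambda>n. s n C) = (\<lambda>n. 0)" using dualD(1)[OF s] by auto
      then show ?thesis by auto
    qed
    then obtain \<phi> where lim: "\<And>C. (\<lambda>n. s n C) \<longlonglongrightarrow> \<phi> C" by metis
    \<comment> \<open>Letting \<open>m\<close> tend to infinity at fixed \<open>n\<close> makes the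
      Cauchy estimate uniform over the unit ball. It is used twice: for boundedness of the pointwise
      limit and for convergence in the dual norm.\<close>
    have lim_le: "norm (s n (cls Y) - \<phi> (cls Y)) \<le> e * b"
      if "\<And>m. n0 \<le> m \<Longrightarrow> dnorm (s n - s m) \<le> e" "Y \<in> SF" "0 \<le> b" "mom Y \<le> ennreal (b powr p)" for n n0 e Y b
    proof (rule LIMSEQ_le_const2)
      show "(\<lambda>m. norm (s n (cls Y) - s m (cls Y))) \<longlonglongrightarrow> norm (s n (cls Y) - \<phi> (cls Y))"
        by (intro tendsto_intros lim)
      have "norm (s n (cls Y) - s m (cls Y)) \<le> e * b" if "n0 \<le> m" for m
        using le[OF \<open>Y \<in> SF\<close> \<open>0 \<le> b\<close> \<open>mom Y \<le> _\<close>, of n m] mult_right_mono[OF \<open>\<And>m. n0 \<le> m \<Longrightarrow> dnorm (s n - s m) \<le> e\<close>[OF that] \<open>0 \<le> b\<close>] by linarith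
      then show "\<exists>N. \<forall>m\<ge>N. norm (s n (cls Y) - s m (cls Y)) \<le> e * b" by blast
    qed
    have \<phi>: "\<phi> \<in> Dual"
    proof -
      obtain n0 where n0: "\<And>m. n0 \<le> m \<Longrightarrow> dnorm (s n0 - s m) \<le> 1"
        using Cau[of 1] by (force intro: less_imp_le)
      show ?thesis
      proof (rule dualI[where B="dnorm (s n0) + 1"])
        show "\<phi> C = 0" if "C \<notin> sigma_space M \<sigma> p" for C
          using lim[of C] dualD(1)[OF s that] by (simp add: LIMSEQ_const_iff)
        show "\<phi> (cls (\<lambda>\<omega>. Y \<omega> + Z \<omega>)) = \<phi> (cls Y) + \<phi> (cls Z)" if "Y \<in> SF" "Z \<in> SF" for Y Z
          by (rule LIMSEQ_unique[OF lim]) (simp add: dualD(2)[OF s that] tendsto_add lim)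
        show "\<phi> (cls (\<lambda>\<omega>. smul c (Y \<omega>))) = c * \<phi> (cls Y)" if "Y \<in> SF" for Y c
          by (rule LIMSEQ_unique[OF lim]) (simp add: dualD(3)[OF s that] tendsto_mult_left lim)
        show "norm (\<phi> (cls Y)) \<le> (dnorm (s n0) + 1) * b"
          if "Y \<in> SF" "0 \<le> b" "mom Y \<le> ennreal (b powr p)" for Y b
          using lim_le[of n0 n0 1 Y b] n0 that dual_apply_le[OF s that, of n0] norm_triangle_ineq2[of "\<phi> (cls Y)" "s n0 (cls Y)"]
          by (simp add: distrib_right norm_minus_commute)
      qed
    qed
    show "\<exists>\<phi>\<in>Dual. (\<lambda>n. dnorm (s n - \<phi>)) \<longlonglongrightarrow> 0"
    proof (intro bexI[OF _ \<phi>] LIMSEQ_I)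
      fix e :: real assume e: "0 < e"
      then obtain n0 where n0: "\<And>m n. n0 \<le> m \<Longrightarrow> n0 \<le> n \<Longrightarrow> dnorm (s m - s n) < e / 2"
        using Cau[of "e / 2"] by auto
      show "\<exists>n0. \<forall>n\<ge>n0. norm (dnorm (s n - \<phi>) - 0) < e"
      proof (intro exI allI impI)
        fix n assume n: "n0 \<le> n"
        have "dnorm (s n - \<phi>) \<le> e / 2"
        proof (rule dnorm_least)
          fix Y assume Y: "Y \<in> SF" "mom Y \<le> 1"
          then show "norm ((s n - \<phi>) (cls Y)) \<le> e / 2"
            using lim_le[of n0 n "e/2" Y 1] n0[OF n] by (simp add: less_imp_le)
        qed
        then show "norm (dnorm (s n - \<phi>) - 0) < e"
          using e dnorm_nonneg[OF dual_minus[OF s \<phi>], of n] by simp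
      qed
    qed
  qed
qed

section \<open>The representing measure of a functional\<close>

definition repr :: "(('w \<Rightarrow> 'x) set \<Rightarrow> 'k) \<Rightarrow> 'w set \<Rightarrow> 'x \<Rightarrow>\<^sub>L 'k" where
  "repr \<phi> E = (if E \<in> sets M then Blinfun (\<lambda>x. \<phi> (cls (\<lambda>\<omega>. indicator E \<omega> *\<^sub>R x))) else 0)"

text \<open>\<open>Blinfun\<close> is meaningful only for bounded linear maps. Boundedness holds
  because \<open>1_E x\<close> has norm at most \<open>norm x\<close> everywhere, and so in the
  function space.\<close>

lemma repr_apply:
  assumes \<phi>: "\<phi> \<in> Dual" and E: "E \<in> sets M"
  shows "blinfun_apply (repr \<phi> E) x = \<phi> (cls (\<lambda>\<omega>. indicator E \<omega> *\<^sub>R x))"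
proof -
  have "bounded_linear (\<lambda>x. \<phi> (cls (\<lambda>\<omega>. indicator E \<omega> *\<^sub>R x)))"
  proof (rule bounded_linear_intro[where K="dnorm \<phi>"])
    show "\<phi> (cls (\<lambda>\<omega>. indicator E \<omega> *\<^sub>R (x + y))) = \<phi> (cls (\<lambda>\<omega>. indicator E \<omega> *\<^sub>R x)) + \<phi> (cls (\<lambda>\<omega>. indicator E \<omega> *\<^sub>R y))" for x y
      using dualD(2)[OF \<phi> sigma_fun_indicator[OF E] sigma_fun_indicator[OF E], of x y] by (simp add: scaleR_right_distrib)
    show "\<phi> (cls (\<lambda>\<omega>. indicator E \<omega> *\<^sub>R (r *\<^sub>R x))) = r *\<^sub>R \<phi> (cls (\<lambda>\<omega>. indicator E \<omega> *\<^sub>R x))" for r x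
      using dualD(3)[OF \<phi> sigma_fun_indicator[OF E], of "of_real r" x] by (simp add: scale_of_real scaleR_conv_of_real mult.commute)
    show "norm (\<phi> (cls (\<lambda>\<omega>. indicator E \<omega> *\<^sub>R x))) \<le> norm x * dnorm \<phi>" for x
      using dual_apply_le[OF \<phi> sigma_fun_indicator[OF E], of "norm x" x]
        sigma_moment_le[of "\<lambda>\<omega>. indicator E \<omega> *\<^sub>R x" "norm x"] by (simp add: indicator_def mult.commute)
  qed
  then show ?thesis using E by (simp add: repr_def bounded_linear_Blinfun_apply)
qed

text \<open>Controls the set function by the norm of the indicator; both countable additivity and
  absolute continuity come from this estimate.\<close>

lemma norm_repr_le:
  assumes \<phi>: "\<phi> \<in> Dual" and E: "E \<in> sets M" and b: "0 \<le> b" "mom (indicator E :: 'w \<Rightarrow> real) \<le> ennreal (b powr p)"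
  shows "norm (repr \<phi> E) \<le> dnorm \<phi> * b"
proof (rule norm_blinfun_bound)
  show "0 \<le> dnorm \<phi> * b" using b dnorm_nonneg[OF \<phi>] by simp
  fix x :: 'x
  have "mom (\<lambda>\<omega>. indicator E \<omega> *\<^sub>R x) = ennreal (norm x powr p) * mom (indicator E :: 'w \<Rightarrow> real)"
    using E by (intro sigma_moment_scale) auto
  also have "\<dots> \<le> ennreal (norm x powr p) * ennreal (b powr p)" by (intro mult_left_mono b) auto
  also have "\<dots> = ennreal ((norm x * b) powr p)" using b by (simp add: ennreal_mult[symmetric] powr_mult)
  finally show "norm (blinfun_apply (repr \<phi> E) x) \<le> dnorm \<phi> * b * norm x"
    using dual_apply_le[OF \<phi> sigma_fun_indicator[OF E], of "norm x * b" x] b by (simp add: repr_apply[OF \<phi> E] mult_ac)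
qed

lemma repr_Un:
  assumes \<phi>: "\<phi> \<in> Dual" and A: "A \<in> sets M" and B: "B \<in> sets M" and AB: "A \<inter> B = {}"
  shows "repr \<phi> (A \<union> B) = repr \<phi> A + repr \<phi> B"
proof (rule blinfun_eqI)
  fix x :: 'x
  have "(\<lambda>\<omega>. indicator (A \<union> B) \<omega> *\<^sub>R x) = (\<lambda>\<omega>. indicator A \<omega> *\<^sub>R x + indicator B \<omega> *\<^sub>R x)"
  proof
    fix \<omega> show "indicator (A \<union> B) \<omega> *\<^sub>R x = indicator A \<omega> *\<^sub>R x + indicator B \<omega> *\<^sub>R x"
      using AB by (cases "\<omega> \<in> A"; cases "\<omega> \<in> B") auto
  qed
  then show "blinfun_apply (repr \<phi> (A \<union> B)) x = blinfun_apply (repr \<phi> A + repr \<phi> B) x"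
    using dualD(2)[OF \<phi> sigma_fun_indicator[OF A] sigma_fun_indicator[OF B], of x x] A B
    by (simp add: repr_apply[OF \<phi>] blinfun.add_left)
qed

text \<open>After finite additivity only the remainders \<open>R n\<close> are left. They decrease
  to the empty set, so the moments of their indicators tend to \<open>0\<close> by order continuity,
  and \<open>norm_repr_le\<close> carries this over to the norms of the operators.\<close>

lemma repr_additive:
  assumes \<phi>: "\<phi> \<in> Dual"
  shows "additive_set_function M (repr \<phi>)"
proof
  fix A :: "nat \<Rightarrow> 'w set" assume A: "range A \<subseteq> sets M" "disjoint_family A"
  have Am [measurable]: "A i \<in> sets M" for i using A by auto
  have empty: "repr \<phi> {} = 0"
    using repr_Un[OF \<phi>, of "{}" "{}"] by simp
  have fin: "repr \<phi> (\<Union>i<n. A i) = (\<Sum>i<n. repr \<phi> (A i))" for n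
  proof (induction n)
    case (Suc n)
    have "A i \<inter> A n = {}" if "i < n" for i
      using that by (intro disjoint_family_onD[OF A(2)]) auto
    then have "repr \<phi> ((\<Union>i<n. A i) \<union> A n) = repr \<phi> (\<Union>i<n. A i) + repr \<phi> (A n)"
      by (intro repr_Un \<phi>) auto
    moreover have "(\<Union>i<Suc n. A i) = (\<Union>i<n. A i) \<union> A n" by (auto simp: lessThan_Suc)
    ultimately show ?case using Suc by simp
  qed (simp add: empty)
  define R where "R n = (\<Union>i. A i) - (\<Union>i<n. A i)" for n
  have R: "R n \<in> sets M" for n unfolding R_def by auto
  have split: "repr \<phi> (\<Union>i. A i) = (\<Sum>i<n. repr \<phi> (A i)) + repr \<phi> (R n)" for n
  proof -
    have "(\<Union>i. A i) = (\<Union>i<n. A i) \<union> R n" by (auto simp: R_def)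
    moreover have "repr \<phi> ((\<Union>i<n. A i) \<union> R n) = repr \<phi> (\<Union>i<n. A i) + repr \<phi> (R n)"
      using R[of n] by (intro repr_Un \<phi>) (auto simp: R_def)
    ultimately show ?thesis by (simp add: fin)
  qed
  have "(\<lambda>n. mom (indicator (R n) :: 'w \<Rightarrow> real)) \<longlonglongrightarrow> 0"
  proof (rule sigma_moment_tendsto_0[where W="\<lambda>_. 1::real"])
    show "mom (\<lambda>_. 1::real) < \<top>" using sigma_moment_le[of "\<lambda>_. 1::real" 1] by (simp add: le_less_trans)
    show "(\<lambda>n. indicator (R n) \<omega> :: real) \<longlonglongrightarrow> 0" for \<omega>
    proof (cases "\<omega> \<in> (\<Union>i. A i)")
      case True
      then obtain k where "\<omega> \<in> A k" by auto
      then have "indicator (R n) \<omega> = (0::real)" if "Suc k \<le> n" for n using that \<open>\<omega> \<in> A k\<close> by (auto simp: R_def indicator_def)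
      then show ?thesis by (intro tendsto_eventually) (auto simp: eventually_sequentially)
    next
      case False
      then show ?thesis by (simp add: R_def)
    qed
  qed (use R p0 in \<open>auto simp: indicator_def\<close>)
  moreover have "mom (indicator (R n) :: 'w \<Rightarrow> real) < \<top>" for n
    using sigma_moment_le[of "indicator (R n) :: 'w \<Rightarrow> real" 1] by (simp add: indicator_def le_less_trans)
  ultimately obtain b where b: "\<And>n. 0 \<le> b n" "\<And>n. mom (indicator (R n) :: 'w \<Rightarrow> real) \<le> ennreal (b n powr p)" "b \<longlonglongrightarrow> 0"
    using ex_null_bounds[of "\<lambda>n. indicator (R n) :: 'w \<Rightarrow> real"] by blast
  have "(\<lambda>n. norm (repr \<phi> (R n))) \<longlonglongrightarrow> 0"
  proof (rule tendsto_sandwich[OF _ _ tendsto_const])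
    show "(\<lambda>n. dnorm \<phi> * b n) \<longlonglongrightarrow> 0" using tendsto_mult_left[OF b(3), of "dnorm \<phi>"] by simp
    show "\<forall>\<^sub>F n in sequentially. norm (repr \<phi> (R n)) \<le> dnorm \<phi> * b n"
      by (intro always_eventually allI norm_repr_le \<phi> R b)
  qed simp
  then have "(\<lambda>n. repr \<phi> (R n)) \<longlonglongrightarrow> 0" by (rule tendsto_norm_zero_cancel)
  then have "(\<lambda>n. repr \<phi> (\<Union>i. A i) - repr \<phi> (R n)) \<longlonglongrightarrow> repr \<phi> (\<Union>i. A i) - 0"
    by (intro tendsto_diff tendsto_const)
  moreover have "repr \<phi> (\<Union>i. A i) - repr \<phi> (R n) = (\<Sum>i<n. repr \<phi> (A i))" for n
    using split[of n] by simp
  ultimately show "(\<lambda>i. repr \<phi> (A i)) sums repr \<phi> (\<Union>i. A i)" by (simp add: sums_def)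
qed

lemma repr_scalar_dual: "\<phi> \<in> Dual \<Longrightarrow> repr \<phi> E \<in> scalar_dual smul"
proof -
  assume \<phi>: "\<phi> \<in> Dual"
  show ?thesis
  proof (cases "E \<in> sets M")
    case True
    then show ?thesis
      using dualD(3)[OF \<phi> sigma_fun_indicator[OF True]] by (simp add: scalar_dual_def repr_apply[OF \<phi>] smul_scaleR)
  qed (simp add: repr_def scalar_dual_def)
qed

lemma repr_vector_measure:
  assumes "\<phi> \<in> Dual" shows "vector_measure smul M (repr \<phi>)"
proof -
  have "repr \<phi> E = 0" if "E \<notin> sets M" for E using that by (simp add: repr_def)
  then show ?thesis
    unfolding vector_measure_def
    using additive_set_function.sums[OF repr_additive[OF assms]] repr_scalar_dual[OF assms] by blast
qed

text \<open>The norm of \<open>f\<close> need not be attained, hence the loss \<open>e\<close>.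
  Compatibility with scalars lets the value be rotated onto the real axis, so that values of several
  functionals can be added without cancellation.\<close>

lemma scalar_dual_almost_norming:
  assumes f: "f \<in> scalar_dual smul" and e: "0 < e"
  obtains x r where "norm x \<le> 1" "norm f - e \<le> r" "blinfun_apply f x = of_real r"
proof (cases "norm f - e < 0")
  case True
  show ?thesis by (rule that[of 0 0]) (use True in \<open>auto simp: blinfun.zero_right\<close>)
next
  case False
  have "\<exists>x. (norm f - e) * norm x < norm (blinfun_apply f x)"
  proof (rule ccontr)
    assume "\<not> ?thesis"
    then have "norm (blinfun_apply f x) \<le> (norm f - e) * norm x" for x by (simp add: not_less)
    then have "norm f \<le> norm f - e" using False by (intro norm_blinfun_bound) auto
    then show False using e by simp
  qed
  then obtain x where x: "(norm f - e) * norm x < norm (blinfun_apply f x)" by blast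
  let ?z = "blinfun_apply f x"
  have "0 \<le> (norm f - e) * norm x" using False by simp
  then have z: "?z \<noteq> 0" using x by auto
  then have x0: "x \<noteq> 0" by (auto simp: blinfun.zero_right)
  \<comment> \<open>Normalises \<open>x\<close> to length one and turns its value under
    \<open>f\<close> into a positive real number.\<close>
  let ?c = "of_real (norm ?z / norm x) / ?z"
  have "norm (smul ?c x) \<le> 1" using z x0 by (simp add: norm_scale norm_divide norm_mult)
  moreover have "norm f - e \<le> norm ?z / norm x" using x x0 by (simp add: field_simps)
  moreover have "blinfun_apply f (smul ?c x) = of_real (norm ?z / norm x)"
    using f z by (simp add: scalar_dual_def)
  ultimately show ?thesis by (rule that)
qed

text \<open>Test \<open>\<phi>\<close> on the simple function with the almost norming vector
  \<open>x j\<close> scaled by \<open>a j\<close> on \<open>E j\<close>. Its norm is at most the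
  scalar step function in \<open>mom\<close>, and its value is the real sum of the
  \<open>a j * r j\<close>. The sets \<open>E j\<close> may overlap.\<close>

lemma sum_norm_repr_le:
  assumes \<phi>: "\<phi> \<in> Dual" and J: "finite J" and E: "\<And>j. j \<in> J \<Longrightarrow> E j \<in> sets M"
    and a: "\<And>j. j \<in> J \<Longrightarrow> 0 \<le> a j" and b: "0 \<le> b"
    and mom: "mom (\<lambda>\<omega>. \<Sum>j\<in>J. a j * indicator (E j) \<omega> :: real) \<le> ennreal (b powr p)"
  shows "(\<Sum>j\<in>J. a j * norm (repr \<phi> (E j))) \<le> dnorm \<phi> * b"
proof -
  have *: "(\<Sum>j\<in>J. a j * (norm (repr \<phi> (E j)) - e)) \<le> dnorm \<phi> * b" if e: "0 < e" for e
  proof -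
    have "\<forall>j. \<exists>x r. norm x \<le> 1 \<and> norm (repr \<phi> (E j)) - e \<le> r \<and> blinfun_apply (repr \<phi> (E j)) x = of_real r"
      using scalar_dual_almost_norming[OF repr_scalar_dual[OF \<phi>] e] by metis
    then obtain x r where x: "\<And>j. norm (x j) \<le> 1" and r: "\<And>j. norm (repr \<phi> (E j)) - e \<le> r j"
      and xr: "\<And>j. blinfun_apply (repr \<phi> (E j)) (x j) = of_real (r j)"
      by metis
    let ?Y = "\<lambda>\<omega>. \<Sum>j\<in>J. indicator (E j) \<omega> *\<^sub>R (a j *\<^sub>R x j)"
    have Y: "?Y \<in> SF" "\<phi> (cls ?Y) = (\<Sum>j\<in>J. \<phi> (cls (\<lambda>\<omega>. indicator (E j) \<omega> *\<^sub>R (a j *\<^sub>R x j))))"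
      using dual_sum[OF \<phi> J, of "\<lambda>j \<omega>. indicator (E j) \<omega> *\<^sub>R (a j *\<^sub>R x j)", OF sigma_fun_indicator[OF E]] by blast+
    note Y(2)
    also have "(\<Sum>j\<in>J. \<phi> (cls (\<lambda>\<omega>. indicator (E j) \<omega> *\<^sub>R (a j *\<^sub>R x j)))) = (\<Sum>j\<in>J. of_real (a j * r j))"
    proof (rule sum.cong[OF refl])
      fix j assume j: "j \<in> J"
      show "\<phi> (cls (\<lambda>\<omega>. indicator (E j) \<omega> *\<^sub>R (a j *\<^sub>R x j))) = of_real (a j * r j)"
        unfolding repr_apply[OF \<phi> E[OF j], symmetric] blinfun.scaleR_right xr by (simp add: scaleR_conv_of_real)
    qed
    also have "\<dots> = of_real (\<Sum>j\<in>J. a j * r j)" by simp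
    finally have "\<bar>\<Sum>j\<in>J. a j * r j\<bar> = norm (\<phi> (cls ?Y))" by (simp only: norm_of_real)
    also have "\<dots> \<le> dnorm \<phi> * b"
    proof (rule dual_apply_le[OF \<phi> Y(1) b order_trans[OF sigma_moment_mono mom]])
      have "norm (?Y \<omega>) \<le> norm (\<Sum>j\<in>J. a j * indicator (E j) \<omega> :: real)" for \<omega>
      proof -
        have "norm (?Y \<omega>) \<le> (\<Sum>j\<in>J. a j * indicator (E j) \<omega>)"
        proof (rule sum_norm_le)
          fix j assume "j \<in> J"
          then show "norm (indicator (E j) \<omega> *\<^sub>R (a j *\<^sub>R x j)) \<le> a j * indicator (E j) \<omega>"
            using a[of j] x[of j] by (auto simp: indicator_def mult_left_le)
        qed
        then show ?thesis by simp
      qed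
      then show "AE \<omega> in M. norm (?Y \<omega>) \<le> norm (\<Sum>j\<in>J. a j * indicator (E j) \<omega> :: real)" by simp
    qed (rule p0)
    finally have "(\<Sum>j\<in>J. a j * r j) \<le> dnorm \<phi> * b" by simp
    moreover have "(\<Sum>j\<in>J. a j * (norm (repr \<phi> (E j)) - e)) \<le> (\<Sum>j\<in>J. a j * r j)"
      by (intro sum_mono mult_left_mono r a)
    ultimately show ?thesis by linarith
  qed
  have "(\<lambda>n. \<Sum>j\<in>J. a j * (norm (repr \<phi> (E j)) - inverse (real (Suc n)))) \<longlonglongrightarrow> (\<Sum>j\<in>J. a j * (norm (repr \<phi> (E j)) - 0))"
    by (intro tendsto_intros LIMSEQ_inverse_real_of_nat)
  then have lim: "(\<lambda>n. \<Sum>j\<in>J. a j * (norm (repr \<phi> (E j)) - inverse (real (Suc n)))) \<longlonglongrightarrow> (\<Sum>j\<in>J. a j * norm (repr \<phi> (E j)))"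
    by simp
  show ?thesis by (rule LIMSEQ_le_const2[OF lim]) (auto intro!: *)
qed

lemma sum_indicator_partition:
  assumes fin: "finite \<pi>" and part: "partition_on E \<pi>"
  shows "(\<Sum>A\<in>\<pi>. indicator A \<omega> :: real) = indicator E \<omega>"
proof (cases "\<omega> \<in> E")
  case True
  then obtain B where B: "B \<in> \<pi>" "\<omega> \<in> B" using part by (auto simp: partition_on_def)
  have "(\<Sum>A\<in>\<pi>. indicator A \<omega> :: real) = (\<Sum>A\<in>\<pi>. if A = B then 1 else 0)"
    using part B by (intro sum.cong) (auto simp: indicator_def partition_on_def disjoint_def)
  then show ?thesis using fin B(1) True by simp
next
  case False
  then have "\<omega> \<notin> A" if "A \<in> \<pi>" for A using that part by (auto simp: partition_on_def)
  then show ?thesis using False by simp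
qed

text \<open>With all weights \<open>1\<close> on a partition of the space, the step function is the
  constant \<open>1\<close>, of norm at most \<open>1\<close>.\<close>

lemma variation_repr_le:
  assumes \<phi>: "\<phi> \<in> Dual"
  shows "variation M (repr \<phi>) (space M) \<le> ennreal (dnorm \<phi>)"
  unfolding variation_def
proof (rule SUP_least)
  fix \<pi> assume \<pi>: "\<pi> \<in> {\<pi>. finite \<pi> \<and> \<pi> \<subseteq> sets M \<and> partition_on (space M) \<pi>}"
  have "(\<Sum>A\<in>\<pi>. 1 * norm (repr \<phi> A)) \<le> dnorm \<phi> * 1"
  proof (rule sum_norm_repr_le[OF \<phi>])
    have "norm (\<Sum>A\<in>\<pi>. 1 * indicator A \<omega> :: real) \<le> 1" for \<omega>
      using \<pi> sum_indicator_partition[of \<pi> "space M" \<omega>] by (simp add: indicator_def)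
    then show "mom (\<lambda>\<omega>. \<Sum>A\<in>\<pi>. 1 * indicator A \<omega> :: real) \<le> ennreal (1 powr p)"
      by (intro sigma_moment_le) auto
  qed (use \<pi> in auto)
  then show "(\<Sum>A\<in>\<pi>. ennreal (norm (repr \<phi> A))) \<le> ennreal (dnorm \<phi>)"
    by (subst sum_ennreal) (auto intro: ennreal_leI)
qed

text \<open>Every measurable subset of a null set has an indicator of moment zero, so each term in
  each partition sum vanishes.\<close>

lemma repr_absolutely_continuous:
  assumes \<phi>: "\<phi> \<in> Dual"
  shows "absolutely_continuous M (variation_measure M (repr \<phi>))"
proof -
  interpret additive_set_function M "repr \<phi>" by (rule repr_additive[OF \<phi>])
  show ?thesis
    unfolding absolutely_continuous_def
  proof
    fix E assume E: "E \<in> null_sets M"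
    have zero: "repr \<phi> B = 0" if B: "B \<subseteq> E" "B \<in> sets M" for B
    proof -
      have "B \<in> null_sets M" by (rule null_sets_subset[OF E B(2,1)])
      then have "AE \<omega> in M. norm (indicator B \<omega> :: real) = norm (0::real)"
        by (rule AE_mp[OF AE_not_in]) simp
      then have "mom (indicator B :: 'w \<Rightarrow> real) = mom (\<lambda>_. 0::real)" using p0(2) by (rule sigma_moment_cong)
      also have "\<dots> \<le> ennreal (0 powr p)" by (rule sigma_moment_le) auto
      finally have "norm (repr \<phi> B) \<le> dnorm \<phi> * 0" by (intro norm_repr_le \<phi> B) auto
      then show ?thesis by simp
    qed
    have "variation M (repr \<phi>) E \<le> 0"
      unfolding variation_def
    proof (rule SUP_least)
      fix \<pi> assume \<pi>: "\<pi> \<in> {\<pi>. finite \<pi> \<and> \<pi> \<subseteq> sets M \<and> partition_on E \<pi>}"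
      have "(\<Sum>A\<in>\<pi>. ennreal (norm (repr \<phi> A))) = (\<Sum>A\<in>\<pi>. 0)"
      proof (rule sum.cong[OF refl])
        fix A assume "A \<in> \<pi>"
        then show "ennreal (norm (repr \<phi> A)) = 0" using \<pi> zero[of A] by (auto simp: partition_on_def)
      qed
      then show "(\<Sum>A\<in>\<pi>. ennreal (norm (repr \<phi> A))) \<le> 0" by simp
    qed
    then show "E \<in> null_sets (variation_measure M (repr \<phi>))"
      using E by (auto simp: null_sets_def emeasure_variation_measure)
  qed
qed

text \<open>Each level set of \<open>h\<close> is partitioned so that its variation is nearly
  reached. The step function built from all these cells, weighted by the levels, is \<open>h\<close>
  again, so its moment bound applies to \<open>sum_norm_repr_le\<close>.\<close>

lemma nn_integral_simple_variation_repr_le: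
  fixes h :: "'w \<Rightarrow> real"
  assumes \<phi>: "\<phi> \<in> Dual" and h: "simple_function M h" and h0: "\<And>\<omega>. 0 \<le> h \<omega>"
    and b: "0 \<le> b" and mom: "mom h \<le> ennreal (b powr p)"
  shows "(\<integral>\<^sup>+\<omega>. ennreal (h \<omega>) \<partial>variation_measure M (repr \<phi>)) \<le> ennreal (dnorm \<phi> * b)"
proof -
  interpret additive_set_function M "repr \<phi>" by (rule repr_additive[OF \<phi>])
  define S where "S = h ` space M"
  define E where "E c = h -` {c} \<inter> space M" for c
  define v where "v c = enn2real (variation M (repr \<phi>) (E c))" for c
  have S: "finite S" "\<And>c. c \<in> S \<Longrightarrow> 0 \<le> c" using simple_functionD(1)[OF h] h0 by (auto simp: S_def)
  have E [measurable]: "E c \<in> sets M" for c unfolding E_def by (rule simple_functionD(2)[OF h])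
  have v: "variation M (repr \<phi>) (E c) = ennreal (v c)" for c
  proof -
    have "variation M (repr \<phi>) (E c) \<le> variation M (repr \<phi>) (space M)"
      by (rule variation_mono) (auto simp: E_def)
    also have "\<dots> < \<top>" using variation_repr_le[OF \<phi>] by (simp add: le_less_trans)
    finally show ?thesis by (simp add: v_def)
  qed
  have *: "(\<Sum>c\<in>S. c * (v c - e)) \<le> dnorm \<phi> * b" if e: "0 < e" for e
  proof -
    have "\<exists>\<pi>. (finite \<pi> \<and> \<pi> \<subseteq> sets M \<and> partition_on (E c) \<pi>) \<and> v c - e \<le> (\<Sum>A\<in>\<pi>. norm (repr \<phi> A))" for c
    \<comment> \<open>A nonpositive target is met by any partition; a positive one lies strictly
      below the supremum.\<close>
    proof (cases "v c - e \<le> 0")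
      case True
      obtain \<pi> where "finite \<pi> \<and> \<pi> \<subseteq> sets M \<and> partition_on (E c) \<pi>" using ex_partition[OF E] by blast
      moreover have "v c - e \<le> (\<Sum>A\<in>\<pi>. norm (repr \<phi> A))"
        using True by (rule order_trans) (auto intro: sum_nonneg)
      ultimately show ?thesis by blast
    next
      case False
      then have "ennreal (v c - e) < variation M (repr \<phi>) (E c)"
        unfolding v using e by (intro ennreal_lessI) auto
      then obtain \<pi> where \<pi>: "finite \<pi> \<and> \<pi> \<subseteq> sets M \<and> partition_on (E c) \<pi>"
        "ennreal (v c - e) < (\<Sum>A\<in>\<pi>. ennreal (norm (repr \<phi> A)))"
        unfolding variation_def less_SUP_iff by blast
      then have "v c - e < (\<Sum>A\<in>\<pi>. norm (repr \<phi> A))"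
        using False by (subst (asm) sum_ennreal) (auto simp: ennreal_less_iff)
      then show ?thesis using \<pi>(1) by (intro exI[of _ \<pi>]) auto
    qed
    then obtain \<pi> where \<pi>: "\<And>c. finite (\<pi> c)" "\<And>c. \<pi> c \<subseteq> sets M" "\<And>c. partition_on (E c) (\<pi> c)"
      and ve: "\<And>c. v c - e \<le> (\<Sum>A\<in>\<pi> c. norm (repr \<phi> A))"
      by metis
    have "(\<Sum>c\<in>S. c * (v c - e)) \<le> (\<Sum>c\<in>S. c * (\<Sum>A\<in>\<pi> c. norm (repr \<phi> A)))"
      by (intro sum_mono mult_left_mono ve S)
    also have "\<dots> = (\<Sum>j\<in>Sigma S \<pi>. fst j * norm (repr \<phi> (snd j)))"
      unfolding sum_distrib_left by (subst sum.Sigma) (auto simp: S \<pi> split_beta)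
    also have "\<dots> \<le> dnorm \<phi> * b"
    proof (rule sum_norm_repr_le[OF \<phi> _ _ _ b order_trans[OF sigma_moment_mono mom]])
      have "(\<Sum>j\<in>Sigma S \<pi>. fst j * indicator (snd j) \<omega>) = h \<omega>" if \<omega>: "\<omega> \<in> space M" for \<omega>
      proof -
        have "(\<Sum>j\<in>Sigma S \<pi>. fst j * indicator (snd j) \<omega>) = (\<Sum>c\<in>S. \<Sum>A\<in>\<pi> c. c * indicator A \<omega>)"
          by (subst sum.Sigma) (auto simp: S \<pi> split_beta)
        also have "\<dots> = (\<Sum>c\<in>S. c * indicator (E c) \<omega>)"
          by (simp add: sum_distrib_left[symmetric] sum_indicator_partition[OF \<pi>(1,3)])
        also have "\<dots> = (\<Sum>c\<in>S. if c = h \<omega> then c else 0)"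
          using \<omega> by (intro sum.cong) (auto simp: E_def indicator_def)
        also have "\<dots> = h \<omega>" using \<omega> S(1) by (simp add: S_def)
        finally show ?thesis .
      qed
      then show "AE \<omega> in M. norm (\<Sum>j\<in>Sigma S \<pi>. fst j * indicator (snd j) \<omega>) \<le> norm (h \<omega>)"
        by (intro AE_I2) simp
      show "finite (Sigma S \<pi>)" using S \<pi> by auto
      show "snd j \<in> sets M" if "j \<in> Sigma S \<pi>" for j using that \<pi>(2) by force
    qed (use S p0 in auto)
    finally show ?thesis .
  qed
  have "(\<lambda>n. \<Sum>c\<in>S. c * (v c - inverse (real (Suc n)))) \<longlonglongrightarrow> (\<Sum>c\<in>S. c * (v c - 0))"
    by (intro tendsto_intros LIMSEQ_inverse_real_of_nat)
  then have lim: "(\<lambda>n. \<Sum>c\<in>S. c * (v c - inverse (real (Suc n)))) \<longlonglongrightarrow> (\<Sum>c\<in>S. c * v c)" by simp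
  have le: "(\<Sum>c\<in>S. c * v c) \<le> dnorm \<phi> * b"
    by (rule LIMSEQ_le_const2[OF lim]) (auto intro!: *)
  have "(\<integral>\<^sup>+\<omega>. ennreal (h \<omega>) \<partial>variation_measure M (repr \<phi>)) =
      (\<integral>\<^sup>+\<omega>. (\<Sum>c\<in>S. ennreal c * indicator (E c) \<omega>) \<partial>variation_measure M (repr \<phi>))"
  proof (rule nn_integral_cong)
    fix \<omega> assume "\<omega> \<in> space (variation_measure M (repr \<phi>))"
    then have \<omega>: "\<omega> \<in> space M" by simp
    have "(\<Sum>c\<in>S. ennreal c * indicator (E c) \<omega>) = (\<Sum>c\<in>S. if c = h \<omega> then ennreal c else 0)"
      using \<omega> by (intro sum.cong) (auto simp: E_def indicator_def)
    also have "\<dots> = ennreal (h \<omega>)" using \<omega> S(1) by (simp add: S_def)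
    finally show "ennreal (h \<omega>) = (\<Sum>c\<in>S. ennreal c * indicator (E c) \<omega>)" by simp
  qed
  also have "\<dots> = (\<Sum>c\<in>S. \<integral>\<^sup>+\<omega>. ennreal c * indicator (E c) \<omega> \<partial>variation_measure M (repr \<phi>))"
    by (intro nn_integral_sum) simp
  also have "\<dots> = (\<Sum>c\<in>S. ennreal (c * v c))"
    using S(2) by (intro sum.cong) (auto simp: nn_integral_cmult_indicator emeasure_variation_measure v ennreal_mult')
  also have "\<dots> = ennreal (\<Sum>c\<in>S. c * v c)"
    using S(2) by (intro sum_ennreal mult_nonneg_nonneg) (auto simp: v_def)
  finally show ?thesis using le by (simp add: ennreal_leI)
qed

text \<open>Monotone convergence from the simple case: the approximants lie below the positive part
  of \<open>Y\<close>, so they inherit its moment bound.\<close>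

lemma paired_repr:
  assumes \<phi>: "\<phi> \<in> Dual"
  shows "paired p (\<lambda>\<omega>. norm (variation_density M (repr \<phi>) \<omega>)) (dnorm \<phi>)"
  unfolding paired_def
proof (intro allI impI)
  fix Y :: "'w \<Rightarrow> real" and b :: real
  assume Y [measurable]: "Y \<in> borel_measurable M" and b: "0 \<le> b" and mom: "mom Y \<le> ennreal (b powr p)"
  interpret additive_set_function M "repr \<phi>" by (rule repr_additive[OF \<phi>])
  have Ym: "(\<lambda>\<omega>. ennreal (Y \<omega>)) \<in> borel_measurable M" by measurable
  obtain f where f: "\<And>i. simple_function M (f i)" "incseq f" "\<And>i \<omega>. f i \<omega> < \<top>" "\<And>\<omega>. (SUP i. f i \<omega>) = ennreal (Y \<omega>)"
    using borel_measurable_implies_simple_function_sequence'[OF Ym] by blast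
  have "(\<integral>\<^sup>+\<omega>. ennreal (norm (variation_density M (repr \<phi>) \<omega>) * Y \<omega>) \<partial>M) =
      (\<integral>\<^sup>+\<omega>. ennreal (norm (variation_density M (repr \<phi>) \<omega>)) * ennreal (Y \<omega>) \<partial>M)"
    by (simp add: ennreal_mult')
  also have "\<dots> = (\<integral>\<^sup>+\<omega>. ennreal (Y \<omega>) \<partial>variation_measure M (repr \<phi>))"
  proof (rule nn_integral_variation_measure[symmetric])
    show "variation M (repr \<phi>) (space M) < \<top>" using variation_repr_le[OF \<phi>] by (simp add: le_less_trans)
  qed (auto intro: repr_additive repr_absolutely_continuous \<phi>)
  also have "\<dots> = (\<integral>\<^sup>+\<omega>. (SUP i. f i \<omega>) \<partial>variation_measure M (repr \<phi>))" by (simp add: f)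
  also have "\<dots> = (SUP i. \<integral>\<^sup>+\<omega>. f i \<omega> \<partial>variation_measure M (repr \<phi>))"
    using borel_measurable_simple_function[OF f(1)]
    by (intro nn_integral_monotone_convergence_SUP f(2)) (simp cong: measurable_cong_sets)
  also have "\<dots> \<le> ennreal (dnorm \<phi> * b)"
  proof (rule SUP_least)
    fix i
    have fi: "ennreal (enn2real (f i \<omega>)) = f i \<omega>" for \<omega> using f(3) by simp
    have "(\<integral>\<^sup>+\<omega>. ennreal (enn2real (f i \<omega>)) \<partial>variation_measure M (repr \<phi>)) \<le> ennreal (dnorm \<phi> * b)"
    proof (rule nn_integral_simple_variation_repr_le[OF \<phi> _ _ b order_trans[OF sigma_moment_mono mom]])
      show "simple_function M (\<lambda>\<omega>. enn2real (f i \<omega>))" by (rule simple_function_compose1[OF f(1)])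
      have "enn2real (f i \<omega>) \<le> norm (Y \<omega>)" for \<omega>
      proof (rule enn2real_leI)
        have "f i \<omega> \<le> ennreal (Y \<omega>)" unfolding f(4)[symmetric] by (rule SUP_upper) simp
        also have "\<dots> \<le> ennreal (norm (Y \<omega>))" by (rule ennreal_leI) simp
        finally show "f i \<omega> \<le> ennreal (norm (Y \<omega>))" .
      qed simp
      then show "AE \<omega> in M. norm (enn2real (f i \<omega>)) \<le> norm (Y \<omega>)" by simp
    qed (use p0 in auto)
    then show "(\<integral>\<^sup>+\<omega>. f i \<omega> \<partial>variation_measure M (repr \<phi>)) \<le> ennreal (dnorm \<phi> * b)" by (simp add: fi)
  qed
  finally show "(\<integral>\<^sup>+\<omega>. ennreal (norm (variation_density M (repr \<phi>) \<omega>) * Y \<omega>) \<partial>M) \<le> ennreal (dnorm \<phi> * b)" .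
qed

text \<open>The pairing bound says that the integral of \<open>norm (Y)\<close> against the
  variation is at most \<open>D\<close> times the norm of \<open>Y\<close>. So every
  \<open>Y\<close> in the space is integrable for the vector measure, and the integral is a
  functional of norm at most \<open>D\<close>.\<close>

lemma ex_dual_of_measure:
  assumes \<mu>: "vector_measure smul M \<mu>" and fin: "variation M \<mu> (space M) < \<top>"
    and ac: "absolutely_continuous M (variation_measure M \<mu>)"
    and D: "0 \<le> D" and paired: "paired p (\<lambda>\<omega>. norm (variation_density M \<mu> \<omega>)) D"
  shows "\<exists>\<phi>\<in>Dual. repr \<phi> = \<mu> \<and> dnorm \<phi> \<le> D"
proof -
  interpret operator_measure M \<mu>
    using \<mu> by unfold_locales (auto simp: vector_measure_def)
  have \<mu>_smul: "blinfun_apply (\<mu> E) (smul c x) = c * blinfun_apply (\<mu> E) x" for E c x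
    using \<mu> by (auto simp: vector_measure_def scalar_dual_def)
  have int_le: "(\<integral>\<^sup>+\<omega>. ennreal (norm (Y \<omega>)) \<partial>variation_measure M \<mu>) \<le> ennreal (D * b)"
    if Y: "Y \<in> SF" and b: "0 \<le> b" "mom Y \<le> ennreal (b powr p)" for Y b
  proof -
    note [measurable] = sigma_fun_norm[OF Y]
    have "(\<integral>\<^sup>+\<omega>. ennreal (norm (Y \<omega>)) \<partial>variation_measure M \<mu>) =
        (\<integral>\<^sup>+\<omega>. ennreal (norm (variation_density M \<mu> \<omega>)) * ennreal (norm (Y \<omega>)) \<partial>M)"
      by (rule nn_integral_variation_measure[OF additive_set_function_axioms fin ac]) measurable
    also have "\<dots> = (\<integral>\<^sup>+\<omega>. ennreal (norm (variation_density M \<mu> \<omega>) * norm (Y \<omega>)) \<partial>M)"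
      by (simp add: ennreal_mult)
    also have "\<dots> \<le> ennreal (D * b)"
    proof -
      have "mom (\<lambda>\<omega>. norm (Y \<omega>)) = mom Y" using p0 by (intro sigma_moment_cong) auto
      then show ?thesis using paired b sigma_fun_norm[OF Y] by (auto simp: paired_def)
    qed
    finally show ?thesis .
  qed
  have ex: "\<exists>l. has_vm_integral Y l" if Y: "Y \<in> SF" for Y
  proof (rule ex_has_vm_integral)
    obtain b where "0 \<le> b" "mom Y \<le> ennreal (b powr p)" using ex_moment_bound[OF Y] by blast
    then show "(\<integral>\<^sup>+\<omega>. ennreal (norm (Y \<omega>)) \<partial>variation_measure M \<mu>) < \<top>"
      using int_le[OF Y] by (meson ennreal_less_top le_less_trans)
  qed (use Y in \<open>simp add: sigma_fun_iff\<close>)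
  \<comment> \<open>A functional lives on classes, so the integral is taken over any representative.
    Absolute continuity makes the value unambiguous: functions equal almost everywhere for
    \<open>M\<close> are so for the variation.\<close>
  define \<phi> where "\<phi> C = (if C \<in> sigma_space M \<sigma> p then THE l. \<exists>Y\<in>C. has_vm_integral Y l else 0)" for C
  have \<phi>_eq: "\<phi> (cls Y) = l" if Y: "Y \<in> SF" and l: "has_vm_integral Y l" for Y l
  proof -
    have sm: "strongly_measurable M Y" using Y by (simp add: sigma_fun_iff)
    have "(THE l. \<exists>Y'\<in>cls Y. has_vm_integral Y' l) = l"
    proof (rule the_equality)
      show "\<exists>Y'\<in>cls Y. has_vm_integral Y' l" using l ae_class_self[OF sm] by blast
      fix k assume "\<exists>Y'\<in>cls Y. has_vm_integral Y' k"
      then obtain Y' where Y': "AE \<omega> in M. Y' \<omega> = Y \<omega>" "has_vm_integral Y' k" by (auto simp: ae_class_def)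
      have "AE \<omega> in variation_measure M \<mu>. Y' \<omega> = Y \<omega>"
        by (rule absolutely_continuous_AE[OF _ ac Y'(1)]) simp
      then have "has_vm_integral Y k" by (rule has_vm_integral_cong_AE[OF Y'(2)])
      then show "k = l" by (rule has_vm_integral_unique[OF sm _ l])
    qed
    then show ?thesis using Y by (simp add: \<phi>_def sigma_space_def)
  qed
  \<comment> \<open>Scalars from the field need the assumption that each \<open>\<mu> E\<close> lies
    in \<open>scalar_dual\<close>; a general operator measure is only real-linear.\<close>
  have smul_int: "has_vm_integral (\<lambda>\<omega>. smul c (Y \<omega>)) (c * l)" if Y: "Y \<in> SF" "has_vm_integral Y l" for Y l c
  proof -
    obtain s where s: "\<And>n. simple_function M (s n)"
      "(\<lambda>n. \<integral>\<^sup>+\<omega>. ennreal (norm (s n \<omega> - Y \<omega>)) \<partial>variation_measure M \<mu>) \<longlonglongrightarrow> 0" "(\<lambda>n. vm_simple M \<mu> (s n)) \<longlonglongrightarrow> l"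
      using Y by (auto simp: has_vm_integral_def)
    have sc: "vm_simple M \<mu> (\<lambda>\<omega>. smul c (s n \<omega>)) = c * vm_simple M \<mu> (s n)" for n
      using vm_simple_compose2[OF s(1) s(1), of "\<lambda>x y. smul c x" n n] vm_simple_compose2[OF s(1) s(1), of "\<lambda>x y. x" n n]
      by (simp add: \<mu>_smul sum_distrib_left)
    have eq: "(\<integral>\<^sup>+\<omega>. ennreal (norm (smul c (s n \<omega>) - smul c (Y \<omega>))) \<partial>variation_measure M \<mu>) =
        ennreal (norm c) * (\<integral>\<^sup>+\<omega>. ennreal (norm (s n \<omega> - Y \<omega>)) \<partial>variation_measure M \<mu>)" for n
    proof -
      have "strongly_measurable M (\<lambda>\<omega>. s n \<omega> - Y \<omega>)"
        using Y s by (auto simp: sigma_fun_iff intro: strongly_measurable_diff simple_function_imp_strongly_measurable)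
      from nn_integral_cmult[OF borel_measurable_ennreal_norm[OF this], of "ennreal (norm c)"]
      show ?thesis by (simp add: scale_right_diff_distrib[symmetric] norm_scale ennreal_mult)
    qed
    show ?thesis
      unfolding has_vm_integral_def
    proof (intro exI[of _ "\<lambda>n \<omega>. smul c (s n \<omega>)"] conjI allI)
      show "simple_function M (\<lambda>\<omega>. smul c (s n \<omega>))" for n by (rule simple_function_compose1[OF s(1)])
      show "(\<lambda>n. vm_simple M \<mu> (\<lambda>\<omega>. smul c (s n \<omega>))) \<longlonglongrightarrow> c * l" unfolding sc by (intro tendsto_intros s)
      show "(\<lambda>n. \<integral>\<^sup>+\<omega>. ennreal (norm (smul c (s n \<omega>) - smul c (Y \<omega>))) \<partial>variation_measure M \<mu>) \<longlonglongrightarrow> 0"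
        unfolding eq using ennreal_tendsto_cmult[OF _ s(2), of "ennreal (norm c)"] by simp
    qed
  qed
  have \<phi>_le: "norm (\<phi> (cls Y)) \<le> D * b" if Y: "Y \<in> SF" and b: "0 \<le> b" "mom Y \<le> ennreal (b powr p)" for Y b
  proof -
    obtain l where l: "has_vm_integral Y l" using ex[OF Y] by blast
    have "ennreal (norm l) \<le> ennreal (D * b)"
      using has_vm_integral_norm_le[OF _ l] int_le[OF Y b] Y by (auto simp: sigma_fun_iff intro: order_trans)
    then show ?thesis using D b by (simp add: \<phi>_eq[OF Y l] ennreal_le_iff)
  qed
  have \<phi>: "\<phi> \<in> Dual"
  proof (rule dualI[where B=D])
    show "\<phi> C = 0" if "C \<notin> sigma_space M \<sigma> p" for C using that by (simp add: \<phi>_def)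
    show "\<phi> (cls (\<lambda>\<omega>. Y \<omega> + Z \<omega>)) = \<phi> (cls Y) + \<phi> (cls Z)" if YZ: "Y \<in> SF" "Z \<in> SF" for Y Z
    proof -
      obtain k l where kl: "has_vm_integral Y k" "has_vm_integral Z l" using ex YZ by blast
      have "has_vm_integral (\<lambda>\<omega>. Y \<omega> + Z \<omega>) (k + l)"
        using YZ kl by (intro has_vm_integral_add) (auto simp: sigma_fun_iff)
      then show ?thesis using YZ kl by (simp add: \<phi>_eq sigma_fun_add)
    qed
    show "\<phi> (cls (\<lambda>\<omega>. smul c (Y \<omega>))) = c * \<phi> (cls Y)" if Y: "Y \<in> SF" for Y c
    proof -
      obtain l where l: "has_vm_integral Y l" using ex[OF Y] by blast
      then show ?thesis using smul_int[OF Y l, of c] by (simp add: \<phi>_eq Y sigma_fun_smul)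
    qed
  qed (rule \<phi>_le)
  moreover have "repr \<phi> = \<mu>"
  proof
    fix E
    show "repr \<phi> E = \<mu> E"
    proof (cases "E \<in> sets M")
      case True
      have sf: "simple_function M (\<lambda>\<omega>. indicator E \<omega> *\<^sub>R x)" for x :: 'x
        by (rule simple_function_indicator_scaleR[OF True])
      show ?thesis
        using has_vm_integral_simple[OF sf] vm_simple_indicator[OF True]
        by (intro blinfun_eqI) (simp add: repr_apply[OF \<phi> True] \<phi>_eq sigma_fun_simple[OF sf])
    next
      case False
      then show ?thesis using \<mu> by (simp add: repr_def vector_measure_def)
    qed
  qed
  moreover have "dnorm \<phi> \<le> D"
    using \<phi>_le[of _ 1] by (intro dnorm_least) simp
  ultimately show ?thesis by blast
qed

section \<open>Uniqueness of the representation and comparison of the norms\<close>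

lemma dual_tendsto_0:
  assumes \<phi>: "\<phi> \<in> Dual" and Z: "\<And>n. Z n \<in> SF" "(\<lambda>n. mom (Z n)) \<longlonglongrightarrow> 0"
  shows "(\<lambda>n. \<phi> (cls (Z n))) \<longlonglongrightarrow> 0"
proof -
  obtain b where b: "\<And>n. 0 \<le> b n" "\<And>n. mom (Z n) \<le> ennreal (b n powr p)" "b \<longlonglongrightarrow> 0"
    using ex_null_bounds[OF Z(2)] Z(1) by (auto simp: sigma_fun_iff)
  have "(\<lambda>n. norm (\<phi> (cls (Z n)))) \<longlonglongrightarrow> 0"
  proof (rule tendsto_sandwich[OF _ _ tendsto_const])
    show "(\<lambda>n. dnorm \<phi> * b n) \<longlonglongrightarrow> 0" using tendsto_mult_left[OF b(3), of "dnorm \<phi>"] by simp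
    show "\<forall>\<^sub>F n in sequentially. norm (\<phi> (cls (Z n))) \<le> dnorm \<phi> * b n"
      by (intro always_eventually allI dual_apply_le \<phi> Z b)
  qed simp
  then show ?thesis by (rule tendsto_norm_zero_cancel)
qed

text \<open>Density of simple functions: the truncated approximants satisfy
  \<open>norm (Y - s n) \<le> 3 * norm (Y)\<close>, so order continuity gives convergence in norm,
  and every simple function is a finite sum of terms \<open>1_E x\<close>.\<close>

lemma dual_eq_0I:
  assumes \<xi>: "\<xi> \<in> Dual" and 0: "\<And>E x. E \<in> sets M \<Longrightarrow> \<xi> (cls (\<lambda>\<omega>. indicator E \<omega> *\<^sub>R x)) = 0"
  shows "\<xi> = 0"
proof (rule dual_ext[OF \<xi> dual_0])
  have simple: "\<xi> (cls s) = 0" if s: "simple_function M s" for s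
  proof -
    let ?t = "\<lambda>\<omega>. \<Sum>x\<in>s ` space M. indicator (s -` {x} \<inter> space M) \<omega> *\<^sub>R x"
    have "s \<omega> = ?t \<omega>" if \<omega>: "\<omega> \<in> space M" for \<omega>
    proof -
      have "?t \<omega> = (\<Sum>x\<in>s ` space M. if x = s \<omega> then x else 0)"
        using \<omega> by (intro sum.cong) (auto simp: indicator_def)
      then show ?thesis using \<omega> simple_functionD(1)[OF s] by simp
    qed
    then have "cls s = cls ?t" by (intro ae_class_eqI AE_I2)
    moreover have "\<xi> (cls ?t) = (\<Sum>x\<in>s ` space M. \<xi> (cls (\<lambda>\<omega>. indicator (s -` {x} \<inter> space M) \<omega> *\<^sub>R x)))"
      using simple_functionD[OF s] by (intro dual_sum[OF \<xi>, THEN conjunct2] sigma_fun_indicator) auto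
    moreover have "\<dots> = 0" using simple_functionD(2)[OF s] by (intro sum.neutral ballI 0)
    ultimately show ?thesis by simp
  qed
  fix Y assume Y: "Y \<in> SF"
  then have sm: "strongly_measurable M Y" by (simp add: sigma_fun_iff)
  obtain s where s: "\<And>n. simple_function M (s n)" "\<And>\<omega>. \<omega> \<in> space M \<Longrightarrow> (\<lambda>n. s n \<omega>) \<longlonglongrightarrow> Y \<omega>"
    "\<And>n \<omega>. norm (s n \<omega>) \<le> 2 * norm (Y \<omega>)"
    using strongly_measurable_approx[OF sm] by blast
  have SF: "(\<lambda>\<omega>. Y \<omega> - s n \<omega>) \<in> SF" for n by (intro sigma_fun_diff Y sigma_fun_simple s)
  have "(\<lambda>n. mom (\<lambda>\<omega>. Y \<omega> - s n \<omega>)) \<longlonglongrightarrow> 0"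
  proof (rule sigma_moment_tendsto_0[where W="\<lambda>\<omega>. 3 * norm (Y \<omega>)"])
    show "norm (Y \<omega> - s n \<omega>) \<le> norm (3 * norm (Y \<omega>))" for n \<omega>
      using norm_triangle_ineq4[of "Y \<omega>" "s n \<omega>"] s(3)[of n \<omega>] by simp
    have "mom (\<lambda>\<omega>. 3 * norm (Y \<omega>)) = ennreal (3 powr p) * mom Y"
      using sigma_fun_norm[OF Y] by (intro sigma_moment_scale) auto
    then show "mom (\<lambda>\<omega>. 3 * norm (Y \<omega>)) < \<top>" using Y by (simp add: sigma_fun_iff ennreal_mult_less_top)
    show "(\<lambda>n. Y \<omega> - s n \<omega>) \<longlonglongrightarrow> 0" if "\<omega> \<in> space M" for \<omega>
      using tendsto_diff[OF tendsto_const s(2)[OF that], of "Y \<omega>"] by simp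
    show "(\<lambda>\<omega>. norm (3 * norm (Y \<omega>))) \<in> borel_measurable M" using sigma_fun_norm[OF Y] by simp
  qed (use SF sigma_fun_norm p0 in auto)
  then have "(\<lambda>n. \<xi> (cls (\<lambda>\<omega>. Y \<omega> - s n \<omega>))) \<longlonglongrightarrow> 0" by (intro dual_tendsto_0 \<xi> SF)
  then show "\<xi> (cls Y) = 0 (cls Y)"
    by (simp add: dual_diff[OF \<xi> Y sigma_fun_simple[OF s(1)]] simple[OF s(1)] LIMSEQ_const_iff)
qed

text \<open>The description in \<open>vm_integral\<close> needs a unique functional with the
  prescribed values on simple functions: \<open>\<phi>\<close> is one by linearity, and one-term
  sums already determine it.\<close>

lemma vm_integral_repr:
  assumes \<phi>: "\<phi> \<in> Dual"
  shows "vm_integral smul M \<sigma> p (repr \<phi>) = \<phi>"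
  unfolding vm_integral_def
proof (rule the_equality)
  show "\<phi> \<in> Dual \<and> (\<forall>(n::nat) E x. (\<forall>j<n. E j \<in> sets M) \<longrightarrow>
      \<phi> (cls (\<lambda>\<omega>. \<Sum>j<n. indicator (E j) \<omega> *\<^sub>R x j)) = (\<Sum>j<n. blinfun_apply (repr \<phi> (E j)) (x j)))"
  proof (intro conjI allI impI \<phi>)
    fix n :: nat and E x assume E: "\<forall>j<n. E j \<in> sets M"
    show "\<phi> (cls (\<lambda>\<omega>. \<Sum>j<n. indicator (E j) \<omega> *\<^sub>R x j)) = (\<Sum>j<n. blinfun_apply (repr \<phi> (E j)) (x j))"
      using dual_sum[OF \<phi>, of "{..<n}" "\<lambda>j \<omega>. indicator (E j) \<omega> *\<^sub>R x j"] E
      by (simp add: repr_apply[OF \<phi>] sigma_fun_indicator)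
  qed
  fix \<psi> assume \<psi>: "\<psi> \<in> Dual \<and> (\<forall>(n::nat) E x. (\<forall>j<n. E j \<in> sets M) \<longrightarrow>
      \<psi> (cls (\<lambda>\<omega>. \<Sum>j<n. indicator (E j) \<omega> *\<^sub>R x j)) = (\<Sum>j<n. blinfun_apply (repr \<phi> (E j)) (x j)))"
  have "\<psi> - \<phi> = 0"
  proof (rule dual_eq_0I)
    show "\<psi> - \<phi> \<in> Dual" using \<psi> \<phi> by (intro dual_minus) auto
    fix E and x :: 'x assume E: "E \<in> sets M"
    have "\<psi> (cls (\<lambda>\<omega>. indicator E \<omega> *\<^sub>R x)) = blinfun_apply (repr \<phi> E) x"
      using \<psi>[THEN conjunct2, rule_format, of "Suc 0" "\<lambda>_. E" "\<lambda>_. x"] E by simp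
    then show "(\<psi> - \<phi>) (cls (\<lambda>\<omega>. indicator E \<omega> *\<^sub>R x)) = 0" by (simp add: repr_apply[OF \<phi> E])
  qed
  then show "\<psi> = \<phi>" by simp
qed

lemma repr_inj: "\<phi> \<in> Dual \<Longrightarrow> \<psi> \<in> Dual \<Longrightarrow> repr \<phi> = repr \<psi> \<Longrightarrow> \<phi> = \<psi>"
  using vm_integral_repr by metis

lemma repr_add:
  assumes "\<phi> \<in> Dual" "\<psi> \<in> Dual" shows "repr (\<phi> + \<psi>) = repr \<phi> + repr \<psi>"
proof
  fix E show "repr (\<phi> + \<psi>) E = (repr \<phi> + repr \<psi>) E"
  proof (cases "E \<in> sets M")
    case True
    then show ?thesis
      by (intro blinfun_eqI) (simp add: repr_apply assms dual_add blinfun.add_left)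
  qed (simp add: repr_def)
qed

lemma repr_scale:
  assumes "\<phi> \<in> Dual" shows "repr (functional_scale c \<phi>) = measure_scale c (repr \<phi>)"
proof
  fix E show "repr (functional_scale c \<phi>) E = measure_scale c (repr \<phi>) E"
  proof (cases "E \<in> sets M")
    case True
    then show ?thesis
      by (intro blinfun_eqI, subst repr_apply[OF dual_scale[OF assms] True])
        (simp add: repr_apply[OF assms True] measure_scale_def functional_scale_def)
  next
    case False
    then show ?thesis
      by (intro blinfun_eqI) (simp add: repr_def measure_scale_def)
  qed
qed

text \<open>The upper bound is the pairing estimate for \<open>repr \<phi>\<close>. For the lower
  bound, the star norm \<open>D\<close> itself is a pairing bound, so the measure is represented by
  some \<open>\<psi>\<close> of norm at most \<open>D\<close>; injectivity of \<open>repr\<close>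
  identifies \<open>\<psi>\<close> with \<open>\<phi>\<close>.\<close>

lemma star_norm_repr:
  assumes \<phi>: "\<phi> \<in> Dual" and q: "1 / ennreal p + 1 / q = 1"
  shows "star_norm M \<sigma> q (variation_density M (repr \<phi>)) = ennreal (dnorm \<phi>)"
proof (rule antisym)
  note iff = star_norm_le_iff[OF borel_measurable_variation_density _ p q]
  show le: "star_norm M \<sigma> q (variation_density M (repr \<phi>)) \<le> ennreal (dnorm \<phi>)"
    by (subst iff) (auto intro: paired_repr dnorm_nonneg \<phi>)
  define D where "D = enn2real (star_norm M \<sigma> q (variation_density M (repr \<phi>)))"
  have "star_norm M \<sigma> q (variation_density M (repr \<phi>)) < \<top>" using le by (simp add: le_less_trans)
  then have D: "star_norm M \<sigma> q (variation_density M (repr \<phi>)) = ennreal D" "0 \<le> D" by (simp_all add: D_def)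
  then have "paired p (\<lambda>\<omega>. norm (variation_density M (repr \<phi>) \<omega>)) D" using iff[of D "repr \<phi>"] by simp
  moreover have "variation M (repr \<phi>) (space M) < \<top>" using variation_repr_le[OF \<phi>] by (simp add: le_less_trans)
  ultimately obtain \<psi> where "\<psi> \<in> Dual" "repr \<psi> = repr \<phi>" "dnorm \<psi> \<le> D"
    using ex_dual_of_measure[OF repr_vector_measure[OF \<phi>] _ repr_absolutely_continuous[OF \<phi>] D(2)] by blast
  then have "dnorm \<phi> \<le> D" using repr_inj \<phi> by metis
  then show "ennreal (dnorm \<phi>) \<le> star_norm M \<sigma> q (variation_density M (repr \<phi>))" by (simp add: D ennreal_leI)
qed

text \<open>A finite star norm is a pairing bound, which is what the construction of a functional
  from a measure requires; the other inclusion collects the properties of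
  \<open>repr \<phi>\<close>.\<close>

lemma star_measures_eq:
  assumes q: "1 / ennreal p + 1 / q = 1"
  shows "star_measures smul M \<sigma> q = repr ` Dual"
proof (intro equalityI subsetI)
  fix \<mu> assume "\<mu> \<in> star_measures smul M \<sigma> q"
  then have \<mu>: "vector_measure smul M \<mu>" "variation M \<mu> (space M) < \<top>"
    "absolutely_continuous M (variation_measure M \<mu>)" "star_norm M \<sigma> q (variation_density M \<mu>) < \<top>"
    by (auto simp: star_measures_def star_space_def)
  define D where "D = enn2real (star_norm M \<sigma> q (variation_density M \<mu>))"
  have D: "star_norm M \<sigma> q (variation_density M \<mu>) = ennreal D" "0 \<le> D" using \<mu>(4) by (simp_all add: D_def)
  then have "paired p (\<lambda>\<omega>. norm (variation_density M \<mu> \<omega>)) D"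
    using star_norm_le_iff[OF borel_measurable_variation_density _ p q, of D \<mu>] by simp
  then show "\<mu> \<in> repr ` Dual" using ex_dual_of_measure[OF \<mu>(1-3) D(2)] by blast
next
  fix \<mu> assume "\<mu> \<in> repr ` Dual"
  then obtain \<phi> where \<phi>: "\<phi> \<in> Dual" "\<mu> = repr \<phi>" by auto
  have "variation M (repr \<phi>) (space M) < \<top>" using variation_repr_le[OF \<phi>(1)] by (simp add: le_less_trans)
  then show "\<mu> \<in> star_measures smul M \<sigma> q"
    using repr_vector_measure[OF \<phi>(1)] repr_absolutely_continuous[OF \<phi>(1)] star_norm_repr[OF \<phi>(1) q]
    by (simp add: \<phi>(2) star_measures_def star_space_def borel_measurable_variation_density)
qed

end

theorem theorem42:
  fixes M :: "'w measure"
    and smul :: "'k::real_or_complex \<Rightarrow> 'x::banach \<Rightarrow> 'x"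
    and \<sigma> :: "real \<Rightarrow> real" and p :: real and q :: ennreal
  assumes "prob_space M"
    and "uniform_rvs M \<noteq> {}"
    and "scalar_banach smul"
    and "distortion \<sigma>"
    and "1 \<le> p"
    and "1 / ennreal p + 1 / q = 1"
  shows "banach_space_on measure_scale (star_measures smul M \<sigma> q) (star_measure_norm M \<sigma> q) \<and>
    isometric_isomorphism
      measure_scale (star_measures smul M \<sigma> q) (star_measure_norm M \<sigma> q)
      functional_scale (sigma_dual smul M \<sigma> p) (sigma_dual_norm M \<sigma> p)
      (vm_integral smul M \<sigma> p)"
proof -
  interpret prob_space M by fact
  interpret scalar_banach smul by fact
  interpret star_duality M \<sigma> smul p by unfold_locales fact+
  show ?thesis
  \<comment> \<open>The structure travels from the dual to the measures: \<open>g\<close> is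
    \<open>repr\<close>, and its inverse \<open>f\<close> is \<open>vm_integral\<close>.\<close>
  proof (rule isometric_transfer[OF dual_banach_space vector_space_measure_scale star_measures_eq])
    show "star_measure_norm M \<sigma> q (repr \<phi>) = dnorm \<phi>" if "\<phi> \<in> Dual" for \<phi>
      using star_norm_repr[OF that assms(6)] dnorm_nonneg[OF that] by (simp add: star_measure_norm_def)
  qed (fact assms(6) | rule repr_add repr_scale vm_integral_repr; assumption)+
qed

end
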